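(* Assume the standing setting and Hypothesis $(H_a)$, and let $\varphi,\theta$ be a naturally normalized system at $a$ with expansion coefficients $\varphi_n,\theta_n$ about $\lambda$ and regularization index $\ell_a$. Then for all $k\ge0$: $\lim_{x\to a^+}\varphi_{k+1}(x)/\varphi_k(x)=0$ and $\lim_{x\to a^+}\theta_{k+1}(x)/\theta_k(x)=0$; and, if $\ell_a<\infty$, also $\lim_{x\to a^+}\varphi_k(x)/\theta_{\ell_a+k}(x)=0$ and $\lim_{x\to a^+}\theta_{\ell_a+k+1}(x)/\varphi_k(x)=0$.
   Context: Standing setting: Let $-\infty\le a<b\le\infty$ and let $p,q,r$ be Lebesgue measurable functions on $(a,b)$ with $r>0$ a.e., $r\in L^1_{loc}((a,b))$; $p>0$ a.e., $1/p\in L^1_{loc}((a,b))$; $q$ real-valued a.e., $q\in L^1_{loc}((a,b))$. Let $\tau f=\frac1r\big[-(pf')'+qf\big]$ act on functions $f$ with $f,pf'\in AC_{loc}((a,b))$; write $f^{[1]}=pf'$ and $W(f,g)=fg^{[1]}-f^{[1]}g$. For $\lambda\in\mathbb R$, the equation $\tau f=\lambda f$ is nonoscillatory at $a$ if its nontrivial real solutions have finitely many zeros near $a$; then there is a solution $u_a$, unique up to constant multiples, with $\lim_{x\to a^+}u_a(x)/v_a(x)=0$ for every solution $v_a$ linearly independent of $u_a$; $u_a$ is called principal at $a$ and any such $v_a$ nonprincipal at $a$. Hypothesis $(H_a)$: there exist $\lambda\in\mathbb R$ such that $\tau f=\lambda f$ is nonoscillatory at $a$, and $c\in(a,b)$,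 such that $\int_a^c|u_a(x)v_a(x)r(x)|\,dx<\infty$, where $u_a$, $v_a$ are principal resp. nonprincipal solutions of $\tau f=\lambda f$ at $a$. Construction (C): fix $\lambda\in\mathbb R$ as in $(H_a)$ and let $u_a$ (principal) and $v_a$ (nonprincipal) be solutions of $\tau f=\lambda f$ with $W(v_a,u_a)=1$. Set $\varphi_0=u_a$, $\varphi_n(x)=\int_a^x[u_a(t)v_a(x)-v_a(t)u_a(x)]\varphi_{n-1}(t)r(t)\,dt$ for $n\ge1$, $x\in(a,b)$, and $\varphi(z,x)=\sum_{n\ge0}\varphi_n(x)(z-\lambda)^n$; this series converges for all $z\in\mathbb C$, $x\in(a,b)$, is entire in $z$ and solves $\tau\varphi(z,\cdot)=z\varphi(z,\cdot)$. Definition (RI): let $\theta(z,x)$ be any solution of $\tau\theta(z,\cdot)=z\theta(z,\cdot)$, entire in $z$ for each $x$, real for real $z$, with $W(\theta(z,\cdot),\varphi(z,\cdot))=1$, and write $\theta(z,x)=\sum_{n\ge0}\theta_n(x)(z-\lambda)^n$ (same $\lambda$ as in (C)). The limits $\lim_{x\to a^+}\varphi_0(x)/\theta_n(x)$ exist in $\mathbb R\cup\{\pm\infty\}$. The regularization index $\ell_a\in\mathbb N_0\cup\{\infty\}$ at $a$ is the smallest integer $\ell\ge0$ with $\lim_{x\to a^+}\varphi_0(x)/\theta_n(x)=0$ for $n=0,\dots,\ell$ and $\lim_{x\to a^+}\varphi_0(x)/\theta_{\ell+1}(x)\neq0$; if $\lim_{x\to a^+}\varphi_0(x)/\theta_n(x)=0$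 for all $n\ge0$, then $\ell_a=\infty$. ($\ell_a$ does not depend on the choice of $\theta$ or of the constant normalization of $\varphi$.) Naturally normalized system at $a$: a pair $\varphi,\theta$ where $\varphi$ is a nonzero constant multiple of the function of Construction (C) (equivalently: an entire-in-$z$ solution family, principal at $a$ for all real $z$, with $\lim_{x\to a^+}\varphi(z_1,x)/\varphi(z_2,x)=1$ for $z_1,z_2\in\mathbb R$), $\theta$ is as in Definition (RI) (entire in $z$, real for real $z$, $W(\theta(z,\cdot),\varphi(z,\cdot))=1$), and additionally $\lim_{x\to a^+}\theta_n(x)/\varphi_0(x)=0$ for all $n>\ell_a$ (vacuous if $\ell_a=\infty$). *)

theory Defs
  imports "HOL-Analysis.Analysis"
begin

definition SL_int :: "ereal \<Rightarrow> ereal \<Rightarrow> real set" where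
  "SL_int a b = {x. a < ereal x \<and> ereal x < b}"

definition at_left_end :: "ereal \<Rightarrow> real filter" where
  "at_left_end a = (if a = -\<infinity> then at_bot else at_right (real_of_ereal a))"

definition abs_cont_on :: "real \<Rightarrow> real \<Rightarrow> (real \<Rightarrow> 'a::real_normed_vector) \<Rightarrow> bool" where
  "abs_cont_on c d f \<longleftrightarrow>
     (\<forall>\<epsilon>>0. \<exists>\<delta>>0. \<forall>(n::nat) (s::nat \<Rightarrow> real) (t::nat \<Rightarrow> real).
        (\<forall>i<n. c \<le> s i \<and> s i \<le> t i \<and> t i \<le> d) \<and>
        (\<forall>i<n. \<forall>j<n. i \<noteq> j \<longrightarrow> t i \<le> s j \<or> t j \<le> s i) \<and>
        (\<Sum>i<n. t i - s i) < \<delta>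
        \<longrightarrow> (\<Sum>i<n. norm (f (t i) - f (s i))) < \<epsilon>)"

definition AC_loc :: "real set \<Rightarrow> (real \<Rightarrow> 'a::real_normed_vector) \<Rightarrow> bool" where
  "AC_loc I f \<longleftrightarrow> (\<forall>c d. c \<le> d \<longrightarrow> {c..d} \<subseteq> I \<longrightarrow> abs_cont_on c d f)"

definition L1_loc :: "real set \<Rightarrow> (real \<Rightarrow> real) \<Rightarrow> bool" where
  "L1_loc I f \<longleftrightarrow> (\<forall>c d. {c..d} \<subseteq> I \<longrightarrow> set_integrable lebesgue {c..d} f)"

definition SL_setting :: "ereal \<Rightarrow> ereal \<Rightarrow> (real \<Rightarrow> real) \<Rightarrow> (real \<Rightarrow> real) \<Rightarrow> (real \<Rightarrow> real) \<Rightarrow> bool" where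
  "SL_setting a b p q r \<longleftrightarrow>
     a < b \<and>
     set_borel_measurable lebesgue (SL_int a b) p \<and>
     set_borel_measurable lebesgue (SL_int a b) q \<and>
     set_borel_measurable lebesgue (SL_int a b) r \<and>
     (AE x in lebesgue. x \<in> SL_int a b \<longrightarrow> 0 < r x) \<and> L1_loc (SL_int a b) r \<and>
     (AE x in lebesgue. x \<in> SL_int a b \<longrightarrow> 0 < p x) \<and> L1_loc (SL_int a b) (\<lambda>x. 1 / p x) \<and>
     L1_loc (SL_int a b) q"

definition SL_sol :: "ereal \<Rightarrow> ereal \<Rightarrow> (real \<Rightarrow> real) \<Rightarrow> (real \<Rightarrow> real) \<Rightarrow> (real \<Rightarrow> real)
    \<Rightarrow> 'a::{real_normed_field} \<Rightarrow> (real \<Rightarrow> 'a) \<Rightarrow> (real \<Rightarrow> 'a) \<Rightarrow> bool" where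
  "SL_sol a b p q r z f f1 \<longleftrightarrow>
     AC_loc (SL_int a b) f \<and> AC_loc (SL_int a b) f1 \<and>
     (AE x in lebesgue. x \<in> SL_int a b \<longrightarrow>
        (\<exists>D. (f has_vector_derivative D) (at x) \<and> f1 x = p x *\<^sub>R D)) \<and>
     (AE x in lebesgue. x \<in> SL_int a b \<longrightarrow>
        (\<exists>D. (f1 has_vector_derivative D) (at x) \<and>
             (1 / r x) *\<^sub>R (- D + q x *\<^sub>R f x) = z * f x))"

definition nonoscillatory_at_a :: "ereal \<Rightarrow> ereal \<Rightarrow> (real \<Rightarrow> real) \<Rightarrow> (real \<Rightarrow> real) \<Rightarrow> (real \<Rightarrow> real)
    \<Rightarrow> real \<Rightarrow> bool" where
  "nonoscillatory_at_a a b p q r lam \<longleftrightarrow>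
     (\<forall>f f1. SL_sol a b p q r lam f f1 \<and> (\<exists>x\<in>SL_int a b. f x \<noteq> 0) \<longrightarrow>
        (\<exists>c\<in>SL_int a b. finite {x. a < ereal x \<and> x < c \<and> f x = 0}))"

text \<open>Linear independence of a real solution v from a nontrivial u on (a,b).\<close>
definition lin_indep_from :: "real set \<Rightarrow> (real \<Rightarrow> real) \<Rightarrow> (real \<Rightarrow> real) \<Rightarrow> bool" where
  "lin_indep_from I u v \<longleftrightarrow> (\<forall>c::real. \<exists>x\<in>I. v x \<noteq> c * u x)"

definition principal_at_a :: "ereal \<Rightarrow> ereal \<Rightarrow> (real \<Rightarrow> real) \<Rightarrow> (real \<Rightarrow> real) \<Rightarrow> (real \<Rightarrow> real)
    \<Rightarrow> real \<Rightarrow> (real \<Rightarrow> real) \<Rightarrow> bool" where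
  "principal_at_a a b p q r lam u \<longleftrightarrow>
     (\<exists>u1. SL_sol a b p q r lam u u1) \<and> (\<exists>x\<in>SL_int a b. u x \<noteq> 0) \<and>
     (\<forall>v v1. SL_sol a b p q r lam v v1 \<and> lin_indep_from (SL_int a b) u v \<longrightarrow>
        ((\<lambda>x. u x / v x) \<longlongrightarrow> 0) (at_left_end a))"

definition nonprincipal_at_a :: "ereal \<Rightarrow> ereal \<Rightarrow> (real \<Rightarrow> real) \<Rightarrow> (real \<Rightarrow> real) \<Rightarrow> (real \<Rightarrow> real)
    \<Rightarrow> real \<Rightarrow> (real \<Rightarrow> real) \<Rightarrow> (real \<Rightarrow> real) \<Rightarrow> bool" where
  "nonprincipal_at_a a b p q r lam u v \<longleftrightarrow>
     (\<exists>v1. SL_sol a b p q r lam v v1) \<and> lin_indep_from (SL_int a b) u v"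

primrec phiC_coeff :: "ereal \<Rightarrow> (real \<Rightarrow> real) \<Rightarrow> (real \<Rightarrow> real) \<Rightarrow> (real \<Rightarrow> real)
    \<Rightarrow> nat \<Rightarrow> real \<Rightarrow> real" where
  "phiC_coeff a r u v 0 = u"
| "phiC_coeff a r u v (Suc n) = (\<lambda>x. LINT t:{t. a < ereal t \<and> t \<le> x}|lebesgue.
       (u t * v x - v t * u x) * phiC_coeff a r u v n t * r t)"

definition phiC :: "ereal \<Rightarrow> (real \<Rightarrow> real) \<Rightarrow> (real \<Rightarrow> real) \<Rightarrow> (real \<Rightarrow> real) \<Rightarrow> real
    \<Rightarrow> complex \<Rightarrow> real \<Rightarrow> complex" where
  "phiC a r u v lam z x = (\<Sum>n. complex_of_real (phiC_coeff a r u v n x) * (z - complex_of_real lam) ^ n)"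

text \<open>F is the filter x -> a+, ph0 = phi_0, th n = theta_n.\<close>
definition reg_index :: "real filter \<Rightarrow> (real \<Rightarrow> complex) \<Rightarrow> (nat \<Rightarrow> real \<Rightarrow> complex) \<Rightarrow> enat" where
  "reg_index F ph0 th =
     (if (\<forall>n. ((\<lambda>x. ph0 x / th n x) \<longlongrightarrow> 0) F) then \<infinity>
      else enat (LEAST l. (\<forall>n\<le>l. ((\<lambda>x. ph0 x / th n x) \<longlongrightarrow> 0) F) \<and>
                          \<not> ((\<lambda>x. ph0 x / th (Suc l) x) \<longlongrightarrow> 0) F))"

end

(* Near a the principal solution u has no zeros, and s = v/u is strictly decreasing with
   s(x) -> oo as x -> a.  Dividing a solution f of tau f = (lam + z) f by u gives
   (f/u)' = - sigma w with sigma = 1/(p u^2) = -s' and w = W(f,u), where w' = z r f u.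
   By l'Hospital the limit of w at a is the limit of f/v, which is 0 for phi and, up to the
   constant kappa, 1 for theta: the quotient theta/phi has derivative -1/(p phi^2), and phi/u
   tends to kappa.  Comparing coefficients of z (Cauchy's estimate for theta supplies a
   majorant), both H_n = phi_n/u and Y_n = kappa theta_n/u satisfy
     X_(n+1)' = - sigma * int_a^x X_n u^2 r,
   where W(kappa theta_0, u) = 1 and W(u, u) = 0.  This recursion preserves order and sign, so
   a relation X = o(Z) is inherited by the next coefficients if these either both tend to 0 or
   the dominating one tends to +oo.  The natural normalization says that Y_n -> +oo for
   n <= l_a and Y_n -> 0 for n > l_a, while H_0 = 1 and H_n -> 0 for n > 0. *)

theory Submission
  imports Defs "HOL-Complex_Analysis.Complex_Analysis"
begin

text \<open>Nothing is known about \<open>theta_n\<close> as a function of \<open>x\<close>: it is a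
  coefficient of a series that converges pointwise in \<open>x\<close>. So no coefficient is
  differentiated. The integrated identity for \<open>f/u\<close> over \<open>[x, y]\<close> is
  expanded in real \<open>z\<close> and coefficients are compared; this needs only measurability and
  a bound \<open>C |v|\<close> uniform in \<open>n\<close>, which also makes the integrals from
  \<open>a\<close> finite because \<open>u v r\<close> is integrable there. The limit of
  \<open>W(f, u)\<close> at \<open>a\<close> is the same number for all \<open>z\<close>, so from
  order one on the Wronskian coefficients are integrals from \<open>a\<close> without an additive
  constant. Cauchy's estimate is taken on a circle of radius 1, hence \<open>theta/phi\<close> is
  needed for nonreal \<open>z\<close> as well. Moving \<open>c\<close> towards \<open>a\<close>
  until the integral of \<open>|u v r|\<close> over \<open>(a, c]\<close> is at most 1/4 keeps
  \<open>phi(z, .)\<close> free of zeros there. Order arguments need real functions: real parts are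
  taken, and \<open>kappa\<close> turns out to be real because \<open>theta\<close> is. When both
  members of a relation tend to 0, passing to the next coefficient reverses the sign, so the sign is
  carried along as an unspecified \<open>k\<close> with \<open>|k| = 1\<close>.\<close>

section \<open>Absolutely continuous functions\<close>

lemma abs_cont_onE:
  assumes "abs_cont_on c d f" "e > 0"
  obtains \<delta> where "\<delta> > 0" and "\<And>(n::nat) s t. (\<forall>i<n. c \<le> s i \<and> s i \<le> t i \<and> t i \<le> d) \<and>
      (\<forall>i<n. \<forall>j<n. i \<noteq> j \<longrightarrow> t i \<le> s j \<or> t j \<le> s i) \<and> (\<Sum>i<n. t i - s i) < \<delta>
      \<Longrightarrow> (\<Sum>i<n. norm (f (t i) - f (s i))) < e"
proof -
  note * = assms(1)[unfolded abs_cont_on_def, THEN spec, THEN mp, OF assms(2)]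
  show ?thesis
    using * by (elim exE conjE, intro that) (assumption, (drule spec)+, erule (1) mp)
qed

text \<open>All closure properties below (linear images, differences, products, inverses) reduce to
  this single estimate on increments.\<close>

lemma abs_cont_on_dominated:
  fixes f :: "real \<Rightarrow> 'a::real_normed_vector" and g :: "real \<Rightarrow> 'b::real_normed_vector"
    and h :: "real \<Rightarrow> 'c::real_normed_vector"
  assumes f: "abs_cont_on c d f" and g: "abs_cont_on c d g"
    and h: "\<And>s t. s \<in> {c..d} \<Longrightarrow> t \<in> {c..d} \<Longrightarrow>
              norm (h t - h s) \<le> K * (norm (f t - f s) + norm (g t - g s))"
  shows "abs_cont_on c d h"
  unfolding abs_cont_on_def
proof (intro allI impI)
  fix e :: real assume e: "e > 0"
  \<comment> \<open>\<open>K\<close> is an arbitrary real; \<open>K'\<close> is a positive majorant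
    by which \<open>e\<close> can be divided.\<close>
  define K' where "K' = \<bar>K\<bar> + 1"
  have K': "K' > 0" "K \<le> K'" by (auto simp: K'_def)
  have e': "e / (2 * K') > 0" using e K' by simp
  obtain d1 where d1: "d1 > 0" and D1: "\<And>(n::nat) s t. (\<forall>i<n. c \<le> s i \<and> s i \<le> t i \<and> t i \<le> d) \<and>
        (\<forall>i<n. \<forall>j<n. i \<noteq> j \<longrightarrow> t i \<le> s j \<or> t j \<le> s i) \<and> (\<Sum>i<n. t i - s i) < d1
        \<Longrightarrow> (\<Sum>i<n. norm (f (t i) - f (s i))) < e / (2 * K')"
    by (rule abs_cont_onE[OF f e']) (rule that)
  obtain d2 where d2: "d2 > 0" and D2: "\<And>(n::nat) s t. (\<forall>i<n. c \<le> s i \<and> s i \<le> t i \<and> t i \<le> d) \<and>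
        (\<forall>i<n. \<forall>j<n. i \<noteq> j \<longrightarrow> t i \<le> s j \<or> t j \<le> s i) \<and> (\<Sum>i<n. t i - s i) < d2
        \<Longrightarrow> (\<Sum>i<n. norm (g (t i) - g (s i))) < e / (2 * K')"
    by (rule abs_cont_onE[OF g e']) (rule that)
  show "\<exists>\<delta>>0. \<forall>(n::nat) s t. (\<forall>i<n. c \<le> s i \<and> s i \<le> t i \<and> t i \<le> d) \<and>
        (\<forall>i<n. \<forall>j<n. i \<noteq> j \<longrightarrow> t i \<le> s j \<or> t j \<le> s i) \<and> (\<Sum>i<n. t i - s i) < \<delta>
        \<longrightarrow> (\<Sum>i<n. norm (h (t i) - h (s i))) < e"
  proof (intro exI[of _ "min d1 d2"] conjI allI impI)
    show "min d1 d2 > 0" using d1 d2 by simp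
    fix n :: nat and s t :: "nat \<Rightarrow> real"
    assume A: "(\<forall>i<n. c \<le> s i \<and> s i \<le> t i \<and> t i \<le> d) \<and>
        (\<forall>i<n. \<forall>j<n. i \<noteq> j \<longrightarrow> t i \<le> s j \<or> t j \<le> s i) \<and> (\<Sum>i<n. t i - s i) < min d1 d2"
    have fs: "(\<Sum>i<n. norm (f (t i) - f (s i))) < e / (2 * K')"
      by (rule D1) (use A in auto)
    have gs: "(\<Sum>i<n. norm (g (t i) - g (s i))) < e / (2 * K')"
      by (rule D2) (use A in auto)
    have "(\<Sum>i<n. norm (h (t i) - h (s i))) \<le>
        (\<Sum>i<n. K' * (norm (f (t i) - f (s i)) + norm (g (t i) - g (s i))))"
    proof (rule sum_mono)
      fix i assume "i \<in> {..<n}"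
      then have "s i \<in> {c..d}" "t i \<in> {c..d}" using A by force+
      from h[OF this] show "norm (h (t i) - h (s i)) \<le>
          K' * (norm (f (t i) - f (s i)) + norm (g (t i) - g (s i)))"
        by (rule order_trans) (intro mult_right_mono K' add_nonneg_nonneg norm_ge_zero)
    qed
    also have "\<dots> = K' * ((\<Sum>i<n. norm (f (t i) - f (s i))) + (\<Sum>i<n. norm (g (t i) - g (s i))))"
      by (simp add: sum.distrib flip: sum_distrib_left)
    also have "\<dots> < K' * (e / (2 * K') + e / (2 * K'))"
      using fs gs K' by (intro mult_strict_left_mono add_strict_mono)
    also have "\<dots> = e" using K' by (simp add: field_simps)
    finally show "(\<Sum>i<n. norm (h (t i) - h (s i))) < e" .
  qed
qed

lemma abs_cont_on_subset:
  assumes "abs_cont_on c d f" "c \<le> c'" "d' \<le> d"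
  shows "abs_cont_on c' d' f"
  unfolding abs_cont_on_def
proof (intro allI impI)
  fix e :: real assume e: "e > 0"
  obtain \<delta> where \<delta>: "\<delta> > 0" "\<And>(n::nat) s t. (\<forall>i<n. c \<le> s i \<and> s i \<le> t i \<and> t i \<le> d) \<and>
        (\<forall>i<n. \<forall>j<n. i \<noteq> j \<longrightarrow> t i \<le> s j \<or> t j \<le> s i) \<and> (\<Sum>i<n. t i - s i) < \<delta>
        \<Longrightarrow> (\<Sum>i<n. norm (f (t i) - f (s i))) < e"
    by (rule abs_cont_onE[OF assms(1) e]) (rule that)
  show "\<exists>\<delta>>0. \<forall>(n::nat) s t. (\<forall>i<n. c' \<le> s i \<and> s i \<le> t i \<and> t i \<le> d') \<and>
        (\<forall>i<n. \<forall>j<n. i \<noteq> j \<longrightarrow> t i \<le> s j \<or> t j \<le> s i) \<and> (\<Sum>i<n. t i - s i) < \<delta>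
        \<longrightarrow> (\<Sum>i<n. norm (f (t i) - f (s i))) < e"
  proof (intro exI[of _ \<delta>] conjI allI impI \<delta>(1))
    fix n :: nat and s t :: "nat \<Rightarrow> real"
    assume A: "(\<forall>i<n. c' \<le> s i \<and> s i \<le> t i \<and> t i \<le> d') \<and>
        (\<forall>i<n. \<forall>j<n. i \<noteq> j \<longrightarrow> t i \<le> s j \<or> t j \<le> s i) \<and> (\<Sum>i<n. t i - s i) < \<delta>"
    then have "\<forall>i<n. c \<le> s i \<and> s i \<le> t i \<and> t i \<le> d"
      using assms(2,3) by (meson order_trans)
    with A show "(\<Sum>i<n. norm (f (t i) - f (s i))) < e"
      by (intro \<delta>(2)) simp
  qed
qed

lemma abs_cont_on_imp_continuous_on:
  fixes f :: "real \<Rightarrow> 'a::real_normed_vector"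
  assumes f: "abs_cont_on c d f"
  shows "continuous_on {c..d} f"
proof (rule continuous_on_iff[THEN iffD2], intro ballI allI impI)
  fix x e :: real assume x: "x \<in> {c..d}" and e: "e > 0"
  obtain \<delta> where \<delta>: "\<delta> > 0" and D: "\<And>(n::nat) s t. (\<forall>i<n. c \<le> s i \<and> s i \<le> t i \<and> t i \<le> d) \<and>
        (\<forall>i<n. \<forall>j<n. i \<noteq> j \<longrightarrow> t i \<le> s j \<or> t j \<le> s i) \<and> (\<Sum>i<n. t i - s i) < \<delta>
        \<Longrightarrow> (\<Sum>i<n. norm (f (t i) - f (s i))) < e"
    by (rule abs_cont_onE[OF f e]) (rule that)
  show "\<exists>d'>0. \<forall>x'\<in>{c..d}. dist x' x < d' \<longrightarrow> dist (f x') (f x) < e"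
  proof (intro exI[of _ \<delta>] conjI \<delta> ballI impI)
    fix y assume y: "y \<in> {c..d}" "dist y x < \<delta>"
    \<comment> \<open>A family consisting of one interval, with endpoints \<open>x\<close> and
      \<open>y\<close>.\<close>
    have "norm (f (max x y) - f (min x y)) < e"
      using D[of 1 "\<lambda>_. min x y" "\<lambda>_. max x y"] x y
      by (auto simp: dist_real_def max_def min_def split: if_splits)
    then show "dist (f y) (f x) < e"
      by (auto simp: dist_norm max_def min_def norm_minus_commute split: if_splits)
  qed
qed

lemma abs_cont_on_bounded:
  fixes f :: "real \<Rightarrow> 'a::real_normed_vector"
  assumes "abs_cont_on c d f"
  obtains B where "B \<ge> 0" "\<And>x. x \<in> {c..d} \<Longrightarrow> norm (f x) \<le> B"
proof -
  have "bounded (f ` {c..d})"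
    by (intro compact_imp_bounded compact_continuous_image abs_cont_on_imp_continuous_on assms) auto
  then obtain B where "\<And>x. x \<in> {c..d} \<Longrightarrow> norm (f x) \<le> B"
    unfolding bounded_iff by blast
  then have "norm (f x) \<le> max B 0" if "x \<in> {c..d}" for x
    using that by (meson max.coboundedI1)
  then show ?thesis using that[of "max B 0"] by auto
qed

lemma abs_cont_on_bounded_linear:
  assumes "bounded_linear T" "abs_cont_on c d f"
  shows "abs_cont_on c d (\<lambda>x. T (f x))"
proof -
  interpret bounded_linear T by fact
  obtain K where K: "K > 0" "\<And>x. norm (T x) \<le> norm x * K" using pos_bounded by blast
  show ?thesis
  proof (rule abs_cont_on_dominated[OF assms(2) assms(2), where K = K])
    fix s t
    have "norm (T (f t) - T (f s)) \<le> norm (f t - f s) * K"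
      using K(2)[of "f t - f s"] by (simp add: diff)
    also have "\<dots> \<le> K * (norm (f t - f s) + norm (f t - f s))"
      using K(1) by (simp add: algebra_simps)
    finally show "norm (T (f t) - T (f s)) \<le> K * (norm (f t - f s) + norm (f t - f s))" .
  qed
qed

lemma abs_cont_on_diff:
  assumes "abs_cont_on c d f" "abs_cont_on c d g"
  shows "abs_cont_on c d (\<lambda>x. f x - g x)"
proof (rule abs_cont_on_dominated[OF assms, where K = 1])
  show "norm (f t - g t - (f s - g s)) \<le> 1 * (norm (f t - f s) + norm (g t - g s))" for s t
    using norm_triangle_ineq4[of "f t - f s" "g t - g s"] by (simp add: algebra_simps)
qed

lemma abs_cont_on_mult:
  fixes f g :: "real \<Rightarrow> 'a::real_normed_algebra"
  assumes f: "abs_cont_on c d f" and g: "abs_cont_on c d g"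
  shows "abs_cont_on c d (\<lambda>x. f x * g x)"
proof -
  obtain A where A: "A \<ge> 0" "\<And>x. x \<in> {c..d} \<Longrightarrow> norm (f x) \<le> A"
    using abs_cont_on_bounded[OF f] by blast
  obtain B where B: "B \<ge> 0" "\<And>x. x \<in> {c..d} \<Longrightarrow> norm (g x) \<le> B"
    using abs_cont_on_bounded[OF g] by blast
  show ?thesis
  proof (rule abs_cont_on_dominated[OF f g, where K = "A + B"])
    fix s t assume st: "s \<in> {c..d}" "t \<in> {c..d}"
    have "norm (f t * g t - f s * g s) = norm ((f t - f s) * g t + f s * (g t - g s))"
      by (simp add: algebra_simps)
    also have "\<dots> \<le> norm (f t - f s) * norm (g t) + norm (f s) * norm (g t - g s)"
      by (rule norm_triangle_le) (intro add_mono norm_mult_ineq)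
    also have "\<dots> \<le> norm (f t - f s) * B + A * norm (g t - g s)"
      by (intro add_mono mult_left_mono mult_right_mono A B st norm_ge_zero)
    also have "\<dots> \<le> (A + B) * (norm (f t - f s) + norm (g t - g s))"
      using A(1) B(1) by (simp add: algebra_simps)
    finally show "norm (f t * g t - f s * g s) \<le> (A + B) * (norm (f t - f s) + norm (g t - g s))" .
  qed
qed

lemma abs_cont_on_inverse:
  fixes f :: "real \<Rightarrow> 'a::real_normed_field"
  assumes f: "abs_cont_on c d f" and nz: "\<And>x. x \<in> {c..d} \<Longrightarrow> f x \<noteq> 0"
  shows "abs_cont_on c d (\<lambda>x. inverse (f x))"
proof -
  have "continuous_on {c..d} (\<lambda>x. inverse (f x))"
    using abs_cont_on_imp_continuous_on[OF f] nz by (intro continuous_intros) auto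
  then have "bounded ((\<lambda>x. inverse (f x)) ` {c..d})"
    by (intro compact_imp_bounded compact_continuous_image) auto
  then obtain B where B: "\<And>x. x \<in> {c..d} \<Longrightarrow> norm (inverse (f x)) \<le> B"
    unfolding bounded_iff by blast
  show ?thesis
  proof (rule abs_cont_on_dominated[OF f f, where K = "B * B"])
    fix s t assume st: "s \<in> {c..d}" "t \<in> {c..d}"
    have B0: "B \<ge> 0" using B[OF st(1)] by (meson norm_ge_zero order_trans)
    have "inverse (f t) - inverse (f s) = - (inverse (f t) * (f t - f s) * inverse (f s))"
      using nz st by (intro inverse_diff_inverse) auto
    then have "norm (inverse (f t) - inverse (f s))
        = norm (inverse (f t)) * norm (inverse (f s)) * norm (f t - f s)"
      by (simp add: norm_mult)
    also have "\<dots> \<le> B * B * norm (f t - f s)"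
      by (intro mult_right_mono mult_mono B st B0 norm_ge_zero)
    also have "\<dots> \<le> B * B * (norm (f t - f s) + norm (f t - f s))"
      by (intro mult_left_mono) auto
    finally show "norm (inverse (f t) - inverse (f s)) \<le> \<dots>" .
  qed
qed

lemma abs_cont_on_divide:
  fixes f g :: "real \<Rightarrow> 'a::real_normed_field"
  assumes "abs_cont_on c d f" "abs_cont_on c d g" "\<And>x. x \<in> {c..d} \<Longrightarrow> g x \<noteq> 0"
  shows "abs_cont_on c d (\<lambda>x. f x / g x)"
  unfolding divide_inverse by (intro abs_cont_on_mult abs_cont_on_inverse assms)

text \<open>On the exceptional null set the gauge confines the intervals to an open set of small
  measure, where absolute continuity makes the increments of \<open>f\<close> negligible; elsewhere the usual
  straddle estimate applies.\<close>

lemma abs_cont_on_has_integral: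
  fixes f :: "real \<Rightarrow> 'a::banach"
  assumes f: "abs_cont_on c d f" and cd: "c \<le> d"
    and der: "AE x in lebesgue. x \<in> {c..d} \<longrightarrow> (f has_vector_derivative g x) (at x)"
  shows "(g has_integral (f d - f c)) {c..d}"
proof -
  obtain N where N: "N \<in> null_sets lebesgue"
    and Nder: "\<And>x. x \<in> {c..d} \<Longrightarrow> x \<notin> N \<Longrightarrow> (f has_vector_derivative g x) (at x)"
    using der unfolding eventually_ae_filter by auto
  \<comment> \<open>With the value 0 on \<open>N\<close>, tags in \<open>N\<close> contribute only
    increments of \<open>f\<close>. The original values are restored by a spike at the end.\<close>
  define g' where "g' x = (if x \<in> N then 0 else g x)" for x
  have "(g' has_integral (f d - f c)) {c..d}"
    unfolding has_integral_real
  proof (intro allI impI)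
    fix e :: real assume e: "e > 0"
    \<comment> \<open>The \<open>+ 1\<close> covers the degenerate case
      \<open>c = d\<close>.\<close>
    define e1 where "e1 = e / (2 * (d - c + 1))"
    have e1: "e1 > 0" using e cd by (simp add: e1_def)
    have e1': "e1 * (d - c) < e / 2"
      using e cd by (simp add: e1_def field_simps)
    obtain \<delta> where \<delta>: "\<delta> > 0" and D: "\<And>(n::nat) s t. (\<forall>i<n. c \<le> s i \<and> s i \<le> t i \<and> t i \<le> d) \<and>
        (\<forall>i<n. \<forall>j<n. i \<noteq> j \<longrightarrow> t i \<le> s j \<or> t j \<le> s i) \<and> (\<Sum>i<n. t i - s i) < \<delta>
        \<Longrightarrow> (\<Sum>i<n. norm (f (t i) - f (s i))) < e / 2"
      by (rule abs_cont_onE[OF f half_gt_zero[OF e]]) (rule that)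
    obtain U where U: "open U" "N \<subseteq> U" "U - N \<in> lmeasurable" "emeasure lebesgue (U - N) < ennreal \<delta>"
      using sets_lebesgue_outer_open[of N \<delta>] N \<delta> by (metis null_setsD2)
    have UU: "U \<in> lmeasurable" "measure lebesgue U < \<delta>"
    proof -
      have eU: "emeasure lebesgue U = emeasure lebesgue (U - N)"
        using N U(1) by (simp add: emeasure_Diff_null_set)
      have mU: "U \<in> sets lebesgue" using U(1) by simp
      show "U \<in> lmeasurable"
        using U(4) eU mU by (intro fmeasurableI) (auto simp: less_top intro: order_less_trans)
      then show "measure lebesgue U < \<delta>"
        using U(4) eU \<delta> by (metis emeasure_eq_measure2 ennreal_less_iff measure_nonneg)
    qed
    have "\<forall>x. \<exists>\<rho>>0. x \<in> {c..d} - N \<longrightarrow>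
         (\<forall>y. norm (y-x) < \<rho> \<longrightarrow> norm (f y - f x - (y-x) *\<^sub>R g x) \<le> e1 * norm (y-x))"
    proof
      fix x show "\<exists>\<rho>>0. x \<in> {c..d} - N \<longrightarrow>
         (\<forall>y. norm (y-x) < \<rho> \<longrightarrow> norm (f y - f x - (y-x) *\<^sub>R g x) \<le> e1 * norm (y-x))"
      proof (cases "x \<in> {c..d} - N")
        case True
        then have "(f has_vector_derivative g x) (at x)" using Nder by blast
        then show ?thesis
          using e1 unfolding has_vector_derivative_def has_derivative_at_alt by blast
      qed (auto intro: exI[of _ 1])
    qed
    then obtain \<rho> where \<rho>: "\<And>x. \<rho> x > 0" and \<rho>2: "\<And>x y. x \<in> {c..d} - N \<Longrightarrow> norm (y-x) < \<rho> x
        \<Longrightarrow> norm (f y - f x - (y-x) *\<^sub>R g x) \<le> e1 * norm (y-x)"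
      by metis
    define \<gamma> where "\<gamma> x = (if x \<in> N then U else ball x (\<rho> x))" for x
    have gauge: "gauge \<gamma>"
      using U \<rho> by (auto simp: gauge_def \<gamma>_def)
    show "\<exists>\<gamma>. gauge \<gamma> \<and> (\<forall>\<D>. \<D> tagged_division_of {c..d} \<and> \<gamma> fine \<D> \<longrightarrow>
        norm ((\<Sum>(x, k)\<in>\<D>. measure lborel k *\<^sub>R g' x) - (f d - f c)) < e)"
    proof (intro exI[of _ \<gamma>] conjI allI impI gauge)
      fix p assume "p tagged_division_of {c..d} \<and> \<gamma> fine p"
      then have p: "p tagged_division_of {c..d}" and fine: "\<gamma> fine p" by auto
      note pD = tagged_division_ofD[OF p]
      have K: "\<exists>l h. K = {l..h} \<and> l \<le> x \<and> x \<le> h \<and> c \<le> l \<and> h \<le> d \<and> Inf K = l \<and> Sup K = h \<and> measure lborel K = h - l"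
        if xK: "(x, K) \<in> p" for x K
      proof -
        obtain l h where lh: "K = {l..h}" using pD(4)[OF xK] by auto
        have "x \<in> {l..h}" "{l..h} \<subseteq> {c..d}" using pD(2,3)[OF xK] lh by auto
        then show ?thesis using lh by (intro exI[of _ l] exI[of _ h]) auto
      qed
      define pN where "pN = {(x, K) \<in> p. x \<in> N}"
      \<comment> \<open>Degenerate intervals contribute 0 and are dropped, because disjointness of
        interiors says nothing about their position relative to other intervals.\<close>
      define pP where "pP = {(x, K) \<in> pN. Inf K < Sup K}"
      have fin: "finite p" "finite pN" "finite pP"
        using pD(1) by (auto simp: pN_def pP_def intro: rev_finite_subset)
      define F where "F = (\<lambda>(x::real, K). measure lborel K *\<^sub>R g' x - (f (Sup K) - f (Inf K)))"
      have eq: "(\<Sum>(x, k)\<in>p. measure lborel k *\<^sub>R g' x) - (f d - f c) = sum F p"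
        unfolding additive_tagged_division_1[OF cd p, of f, symmetric] F_def
        by (simp add: sum_subtractf split_def)
      have "sum F p = sum F (p - pN) + sum F pN"
        using fin by (intro sum.subset_diff) (auto simp: pN_def)
      moreover have "norm (sum F (p - pN)) \<le> e1 * (d - c)"
      proof -
        have "norm (sum F (p - pN)) \<le> (\<Sum>(x, K)\<in>p - pN. e1 * (Sup K - Inf K))"
        proof (rule sum_norm_le, clarify)
          fix x K assume xK: "(x, K) \<in> p" "(x, K) \<notin> pN"
          obtain l h where lh: "K = {l..h}" "l \<le> x" "x \<le> h" "c \<le> l" "h \<le> d" "Inf K = l" "Sup K = h"
            "measure lborel K = h - l" using K[OF xK(1)] by auto
          have xN: "x \<notin> N" using xK by (auto simp: pN_def)
          have "{l..h} \<subseteq> ball x (\<rho> x)" using fineD[OF fine xK(1)] xN lh(1) by (simp add: \<gamma>_def)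
          then have "l \<in> ball x (\<rho> x)" "h \<in> ball x (\<rho> x)" using lh by (meson atLeastAtMost_iff order_refl order_trans subsetD)+
          then have lr: "norm (l - x) < \<rho> x" "norm (h - x) < \<rho> x" by (auto simp: dist_real_def)
          have "F (x, K) = (f l - f x - (l - x) *\<^sub>R g x) - (f h - f x - (h - x) *\<^sub>R g x)"
            using xN lh(2,3) by (simp add: F_def lh(6-8) g'_def algebra_simps)
          also have "norm \<dots> \<le> e1 * norm (l - x) + e1 * norm (h - x)"
            by (intro order_trans[OF norm_triangle_ineq4] add_mono \<rho>2 lr) (use lh xN in auto)
          also have "\<dots> = e1 * (Sup K - Inf K)"
            using lh by (simp add: algebra_simps)
          finally show "norm (F (x, K)) \<le> e1 * (Sup K - Inf K)" .
        qed
        also have "\<dots> \<le> (\<Sum>(x, K)\<in>p. e1 * (Sup K - Inf K))"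
          using fin(1)
        proof (rule sum_mono2)
          fix b assume "b \<in> p - (p - pN)"
          then obtain x K' where "b = (x, K')" "(x, K') \<in> p" by (cases b) auto
          then show "0 \<le> (case b of (x, K) \<Rightarrow> e1 * (Sup K - Inf K))"
            using K[of x K'] e1 by auto
        qed auto
        also have "\<dots> = e1 * (d - c)"
          unfolding additive_tagged_division_1[OF cd p, of "\<lambda>x. x", symmetric]
          by (simp add: sum_distrib_left split_def)
        finally show ?thesis .
      qed
      moreover have "norm (sum F pN) < e / 2"
      proof -
        have "sum F pN = sum F pP"
        proof (rule sum.mono_neutral_right[OF fin(2)])
          show "pP \<subseteq> pN" by (auto simp: pP_def)
          show "\<forall>i\<in>pN - pP. F i = 0"
          proof clarify
            fix x K' assume "(x, K') \<in> pN" "(x, K') \<notin> pP"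
            then have "Sup K' = Inf K'" "measure lborel K' = Sup K' - Inf K'"
              using K[of x K'] by (auto simp: pN_def pP_def)
            then show "F (x, K') = 0" by (simp add: F_def)
          qed
        qed
        moreover have "norm (sum F pP) \<le> (\<Sum>k\<in>pP. norm (f (Sup (snd k)) - f (Inf (snd k))))"
          by (intro sum_norm_le) (auto simp: F_def pP_def pN_def g'_def norm_minus_commute)
        moreover have "(\<Sum>k\<in>pP. norm (f (Sup (snd k)) - f (Inf (snd k)))) < e / 2"
        proof -
          obtain \<pi> :: "nat \<Rightarrow> real \<times> real set" and n where n: "bij_betw \<pi> {..<n} pP"
            using ex_bij_betw_nat_finite[OF fin(3)] by (auto simp: atLeast0LessThan)
          define s where "s i = Inf (snd (\<pi> i))" for i
          define t where "t i = Sup (snd (\<pi> i))" for i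
          have pi: "\<pi> i \<in> p" "\<pi> i \<in> pN" "fst (\<pi> i) \<in> N" "s i < t i" "snd (\<pi> i) = {s i..t i}" "c \<le> s i" "t i \<le> d"
             if "i < n" for i
          proof -
            have 1: "\<pi> i \<in> pP" using n that by (auto simp: bij_betw_def)
            then show 2: "\<pi> i \<in> p" and "\<pi> i \<in> pN" "fst (\<pi> i) \<in> N" "s i < t i"
              by (auto simp: pP_def pN_def s_def t_def split_beta)
            show "snd (\<pi> i) = {s i..t i}" "c \<le> s i" "t i \<le> d"
              using K[of "fst (\<pi> i)" "snd (\<pi> i)"] 2 by (auto simp: s_def t_def)
          qed
          have sep: "t i \<le> s j \<or> t j \<le> s i" if "i < n" "j < n" "i \<noteq> j" for i j
          proof (rule ccontr)
            assume "\<not> ?thesis"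
            then have a: "s j < t i" "s i < t j" by auto
            have "\<pi> i \<noteq> \<pi> j" using n that by (auto simp: bij_betw_def inj_on_def)
            then have "interior (snd (\<pi> i)) \<inter> interior (snd (\<pi> j)) = {}"
              using pD(5)[of "fst (\<pi> i)" "snd (\<pi> i)" "fst (\<pi> j)" "snd (\<pi> j)"] pi(1) that
              by (metis prod.collapse)
            then have "{s i<..<t i} \<inter> {s j<..<t j} = {}" using pi that by simp
            moreover have "(max (s i) (s j) + min (t i) (t j)) / 2 \<in> {s i<..<t i} \<inter> {s j<..<t j}"
              using a pi(4)[OF that(1)] pi(4)[OF that(2)] by (auto simp: max_def min_def field_simps)
            ultimately show False by blast
          qed
          \<comment> \<open>The intervals overlap at most in endpoints, so their total length is the
            measure of their union, and fineness puts the union inside \<open>U\<close>.\<close>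
          have "(\<Sum>i<n. t i - s i) = (\<Sum>i<n. measure lebesgue {s i..t i})"
            using pi by (intro sum.cong) (auto simp: less_imp_le)
          also have "\<dots> = measure lebesgue (\<Union>i<n. {s i..t i})"
          proof (rule measure_negligible_finite_Union_image[symmetric])
            show "pairwise (\<lambda>x y. negligible ({s x..t x} \<inter> {s y..t y})) {..<n}"
            proof (rule pairwiseI)
              fix i j assume ij: "i \<in> {..<n}" "j \<in> {..<n}" "i \<noteq> j"
              then have "{s i..t i} \<inter> {s j..t j} \<subseteq> {s i, t i}"
                using sep[of i j] by auto
              then show "negligible ({s i..t i} \<inter> {s j..t j})"
                by (rule negligible_subset[rotated]) simp
            qed
          qed auto
          also have "\<dots> \<le> measure lebesgue U"
          proof (rule measure_mono_fmeasurable)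
            show "(\<Union>i<n. {s i..t i}) \<subseteq> U"
            proof (rule UN_least)
              fix i assume "i \<in> {..<n}"
              then have i: "i < n" by simp
              have "snd (\<pi> i) \<subseteq> \<gamma> (fst (\<pi> i))"
                using fineD[OF fine, of "fst (\<pi> i)" "snd (\<pi> i)"] pi(1)[OF i] by simp
              then show "{s i..t i} \<subseteq> U" using pi(3,5)[OF i] by (simp add: \<gamma>_def)
            qed
          qed (use UU in auto)
          also have "\<dots> < \<delta>" by (rule UU)
          finally have "(\<Sum>i<n. norm (f (t i) - f (s i))) < e / 2"
            using D[where n = n and s = s and t = t] pi sep by (auto simp: less_imp_le)
          also have "(\<Sum>i<n. norm (f (t i) - f (s i))) = (\<Sum>k\<in>pP. norm (f (Sup (snd k)) - f (Inf (snd k))))"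
            unfolding s_def t_def by (rule sum.reindex_bij_betw[OF n])
          finally show ?thesis .
        qed
        ultimately show ?thesis by simp
      qed
      ultimately have "norm (sum F p) < e"
        using e1' norm_triangle_ineq[of "sum F (p - pN)" "sum F pN"] by (simp only:)
      then show "norm ((\<Sum>(x, k)\<in>p. measure lborel k *\<^sub>R g' x) - (f d - f c)) < e"
        using eq by simp
    qed
  qed
  then show ?thesis
    by (rule has_integral_spike[rotated 2, where S = N])
       (use N in \<open>auto simp: negligible_iff_null_sets g'_def\<close>)
qed

lemma abs_cont_on_lebesgue_integral:
  fixes f :: "real \<Rightarrow> 'a::euclidean_space"
  assumes "abs_cont_on c d f" "c \<le> d"
    and "AE x in lebesgue. x \<in> {c..d} \<longrightarrow> (f has_vector_derivative g x) (at x)"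
    and "set_integrable lebesgue {c..d} g"
  shows "(LINT x:{c..d}|lebesgue. g x) = f d - f c"
  using abs_cont_on_has_integral[OF assms(1-3)] set_lebesgue_integral_eq_integral(2)[OF assms(4)]
  by (simp add: integral_unique)

text \<open>Mean value inequality with derivatives almost everywhere. Both derivatives are gauge
  integrable by the fundamental theorem above, so neither measurability nor Lebesgue integrability
  of \<open>D\<close> has to be shown.\<close>

lemma abs_cont_on_norm_increment_le:
  fixes f :: "real \<Rightarrow> 'a::banach" and g :: "real \<Rightarrow> real"
  assumes f: "abs_cont_on c d f" and g: "abs_cont_on c d g" and cd: "c \<le> d"
    and der: "AE x in lebesgue. x \<in> {c..d} \<longrightarrow> (\<exists>D G. (f has_vector_derivative D) (at x) \<and>
        (g has_vector_derivative G) (at x) \<and> norm D \<le> G)"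
  shows "norm (f d - f c) \<le> g d - g c"
proof -
  define P where "P x D G \<longleftrightarrow> (f has_vector_derivative D) (at x) \<and>
        (g has_vector_derivative G) (at x) \<and> norm D \<le> G" for x D G
  \<comment> \<open>The default 0 on the exceptional set turns the bound
    \<open>norm D \<le> G\<close> into one that holds at every point.\<close>
  define D where "D x = (if \<exists>D G. P x D G then vector_derivative f (at x) else 0)" for x
  define G where "G x = (if \<exists>D G. P x D G then vector_derivative g (at x) else 0)" for x
  have DG: "norm (D x) \<le> G x" for x
  proof (cases "\<exists>D G. P x D G")
    case True
    then show ?thesis by (auto simp: D_def G_def P_def dest!: vector_derivative_at)
  qed (auto simp: D_def G_def)
  have D: "(D has_integral (f d - f c)) {c..d}"
    by (rule abs_cont_on_has_integral[OF f cd], rule eventually_mono[OF der])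
       (auto simp: D_def P_def vector_derivative_at)
  have G: "(G has_integral (g d - g c)) {c..d}"
    by (rule abs_cont_on_has_integral[OF g cd], rule eventually_mono[OF der])
       (auto simp: G_def P_def vector_derivative_at)
  show ?thesis
    using integral_norm_bound_integral[of D "{c..d}" G] D G DG
    by (auto simp: integral_unique has_integral_integrable)
qed

section \<open>Coefficients of power series\<close>

text \<open>The remainder after \<open>n\<close> terms divided by \<open>x ^ n\<close> is the power
  series shifted by \<open>n\<close>, whose limit at 0 is its constant term. Coefficients thus
  become limits of expressions in values of \<open>f\<close> and earlier coefficients.\<close>

lemma powser_coeff_tendsto:
  fixes c :: "nat \<Rightarrow> 'a::{real_normed_field,banach}"
  assumes sums: "\<And>x. norm x < 1 \<Longrightarrow> (\<lambda>n. c n * x ^ n) sums f x"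
  shows "((\<lambda>x. (f x - (\<Sum>j<n. c j * x ^ j)) / x ^ n) \<longlongrightarrow> c n) (at 0)"
proof -
  have "(\<lambda>m. c (m + n) * x ^ m) sums ((f x - (\<Sum>j<n. c j * x ^ j)) / x ^ n)"
    if x: "x \<noteq> 0" "norm x < 1" for x
  proof -
    have "(\<lambda>m. c (m + n) * x ^ (m + n)) sums (f x - (\<Sum>j<n. c j * x ^ j))"
      by (rule sums_split_initial_segment[OF sums[OF x(2)]])
    from sums_divide[OF this, of "x ^ n"] show ?thesis
      using x by (simp add: power_add)
  qed
  from powser_limit_0_strong[of 1 "\<lambda>m. c (m + n)", OF zero_less_one this]
  show ?thesis by simp
qed

lemma powser_coeff_LIMSEQ:
  fixes c :: "nat \<Rightarrow> 'a::{real_normed_field,banach}"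
  assumes sums: "\<And>x. norm x < 1 \<Longrightarrow> (\<lambda>n. c n * x ^ n) sums f x"
  \<comment> \<open>The points \<open>1/(k+2)\<close> are real, nonzero and inside the unit disc
    from \<open>k = 0\<close> on.\<close>
  defines "z \<equiv> \<lambda>k. of_real (inverse (real (Suc (Suc k))))"
  shows "(\<lambda>k. (f (z k) - (\<Sum>j<n. c j * z k ^ j)) / z k ^ n) \<longlonglongrightarrow> c n"
proof -
  have "(\<lambda>k. inverse (real (Suc (Suc k)))) \<longlonglongrightarrow> 0" by (rule LIMSEQ_Suc[OF LIMSEQ_inverse_real_of_nat])
  then have "z \<longlonglongrightarrow> of_real 0" unfolding z_def by (rule tendsto_of_real)
  moreover have "z k \<noteq> 0" for k
    by (auto simp: z_def simp del: of_nat_Suc of_real_inverse)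
  ultimately have "filterlim z (at 0) sequentially"
    by (simp add: filterlim_at)
  from filterlim_compose[OF powser_coeff_tendsto[OF sums] this] show ?thesis by simp
qed

lemma powser_zero_imp_coeff_zero:
  fixes c :: "nat \<Rightarrow> 'a::{real_normed_field,banach}"
  assumes "\<And>x. norm x < 1 \<Longrightarrow> (\<lambda>n. c n * x ^ n) sums 0"
  shows "c n = 0"
proof (induction n rule: less_induct)
  case (less n)
  then have "(\<Sum>j<n. c j * x ^ j) = 0" for x by simp
  then have "(\<lambda>k::nat. 0) \<longlonglongrightarrow> c n"
    using powser_coeff_LIMSEQ[of c "\<lambda>_. 0" n] assms by simp
  then show ?case using LIMSEQ_unique tendsto_const by blast
qed

text \<open>By induction each coefficient is a pointwise limit of combinations of \<open>f\<close>
  at fixed points and of earlier coefficients.\<close>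

lemma powser_coeff_measurable:
  fixes c :: "nat \<Rightarrow> 'b \<Rightarrow> real"
  assumes "\<And>x t. \<bar>x\<bar> < 1 \<Longrightarrow> t \<in> space M \<Longrightarrow> (\<lambda>n. c n t * x ^ n) sums f x t"
    and [measurable]: "\<And>x. \<bar>x\<bar> < 1 \<Longrightarrow> f x \<in> borel_measurable M"
  shows "c n \<in> borel_measurable M"
proof (induction n rule: less_induct)
  case (less n)
  define z :: "nat \<Rightarrow> real" where "z k = of_real (inverse (real (Suc (Suc k))))" for k
  show ?case
  proof (rule borel_measurable_LIMSEQ_real)
    show "(\<lambda>k. (f (z k) t - (\<Sum>j<n. c j t * z k ^ j)) / z k ^ n) \<longlonglongrightarrow> c n t" if "t \<in> space M" for t
      unfolding z_def by (rule powser_coeff_LIMSEQ) (use assms(1) that in simp)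
    fix k
    have [measurable]: "f (z k) \<in> borel_measurable M"
      by (rule assms(2)) (simp add: z_def field_simps)
    have [measurable]: "(\<lambda>t. \<Sum>j<n. c j t * z k ^ j) \<in> borel_measurable M"
      by (intro borel_measurable_sum borel_measurable_times borel_measurable_const less) simp
    show "(\<lambda>t. (f (z k) t - (\<Sum>j<n. c j t * z k ^ j)) / z k ^ n) \<in> borel_measurable M"
      by measurable
  qed
qed

text \<open>The same extraction of coefficients, now inside the closed set of reals; it evaluates
  \<open>f\<close> only at real points.\<close>

lemma powser_coeff_Reals:
  fixes c :: "nat \<Rightarrow> complex"
  assumes sums: "\<And>x. norm x < 1 \<Longrightarrow> (\<lambda>n. c n * x ^ n) sums f x"
    and real: "\<And>x::real. f (of_real x) \<in> \<real>"
  shows "c n \<in> \<real>"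
proof (induction n rule: less_induct)
  case (less n)
  show ?case
  proof (rule Lim_in_closed_set[OF closed_complex_Reals _ sequentially_bot powser_coeff_LIMSEQ[of c f n, OF sums]])
    show "\<forall>\<^sub>F k in sequentially. (f (of_real (inverse (real (Suc (Suc k))))) - (\<Sum>j<n. c j * of_real (inverse (real (Suc (Suc k)))) ^ j))
        / of_real (inverse (real (Suc (Suc k)))) ^ n \<in> \<real>"
      by (intro always_eventually allI Reals_divide Reals_diff Reals_power Reals_of_real real sum_in_Reals Reals_mult less)
         simp
  qed
qed

text \<open>Uniqueness of power series identifies \<open>c n\<close> with the Taylor coefficient, to
  which Cauchy's inequality on the unit circle applies. Radius 1 makes the bound independent of
  \<open>n\<close>.\<close>

lemma entire_powser_coeff_bound:
  fixes c :: "nat \<Rightarrow> complex"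
  assumes hol: "f holomorphic_on UNIV"
    and sums: "\<And>z. (\<lambda>n. c n * (z - z0) ^ n) sums f z"
    and B: "\<And>z. norm (z - z0) = 1 \<Longrightarrow> norm (f z) \<le> B"
  shows "norm (c n) \<le> B"
proof -
  have "(deriv ^^ n) f z0 / fact n - c n = 0"
  proof (rule powser_zero_imp_coeff_zero[of "\<lambda>n. (deriv ^^ n) f z0 / fact n - c n"])
    fix x :: complex assume x: "norm x < 1"
    have "(\<lambda>n. (deriv ^^ n) f z0 / fact n * (z0 + x - z0) ^ n) sums f (z0 + x)"
      by (rule holomorphic_power_series[where r = 1])
         (use hol x in \<open>auto intro: holomorphic_on_subset simp: dist_norm\<close>)
    from sums_diff[OF this sums[of "z0 + x"]]
    show "(\<lambda>n. ((deriv ^^ n) f z0 / fact n - c n) * x ^ n) sums 0"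
      by (simp add: algebra_simps)
  qed
  moreover have "norm ((deriv ^^ n) f z0) \<le> fact n * B / 1 ^ n"
    by (rule Cauchy_inequality)
       (use hol B in \<open>auto intro: holomorphic_on_subset holomorphic_on_imp_continuous_on simp: norm_minus_commute\<close>)
  ultimately have "fact n * norm (c n) \<le> fact n * B"
    by (simp add: field_simps norm_mult)
  then show ?thesis by simp
qed

text \<open>Termwise integration: the majorant \<open>G\<close> does not depend on \<open>n\<close>,
  so the geometric series in \<open>\<bar>x\<bar>\<close> makes the norms summable.\<close>

lemma set_integral_powser_sums:
  fixes g :: "nat \<Rightarrow> 'b \<Rightarrow> real"
  assumes g: "\<And>n. set_integrable M A (g n)" and G: "set_integrable M A G"
    and gG: "\<And>n t. t \<in> A \<Longrightarrow> \<bar>g n t\<bar> \<le> G t" and x: "\<bar>x\<bar> < 1"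
    and sums: "\<And>t. t \<in> A \<Longrightarrow> (\<lambda>n. g n t * x ^ n) sums h t"
  shows "(\<lambda>n. (LINT t:A|M. g n t) * x ^ n) sums (LINT t:A|M. h t)"
proof -
  define F where "F n t = indicator A t *\<^sub>R (g n t * x ^ n)" for n t
  have F: "integrable M (F n)" for n
    using g[of n] unfolding F_def set_integrable_def
    by (simp flip: mult.assoc)
  have bd: "norm (F n t) \<le> \<bar>x\<bar> ^ n * (indicator A t *\<^sub>R G t)" for n t
    using gG[of t n] by (auto simp: F_def indicator_def abs_mult power_abs mult.commute mult_right_mono)
  have G': "integrable M (\<lambda>t. indicator A t *\<^sub>R G t)" using G by (simp add: set_integrable_def)
  have sg: "summable (\<lambda>n. \<bar>x\<bar> ^ n * K)" for K :: real
    using x by (intro summable_mult2 summable_geometric) simp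
  have "(\<lambda>n. integral\<^sup>L M (F n)) sums (\<integral>t. (\<Sum>n. F n t) \<partial>M)"
  proof (rule sums_integral[OF F])
    show "AE t in M. summable (\<lambda>n. norm (F n t))"
      by (intro AE_I2 summable_comparison_test'[OF sg]) (use bd in simp)
    show "summable (\<lambda>n. \<integral>t. norm (F n t) \<partial>M)"
    proof (rule summable_comparison_test'[OF sg])
      fix n
      have "norm (\<integral>t. norm (F n t) \<partial>M) = (\<integral>t. norm (F n t) \<partial>M)"
        by (simp add: integral_nonneg_AE)
      also have "\<dots> \<le> (\<integral>t. \<bar>x\<bar> ^ n * (indicator A t *\<^sub>R G t) \<partial>M)"
        using F G' bd by (intro integral_mono integrable_norm integrable_mult_right) auto
      also have "\<dots> = \<bar>x\<bar> ^ n * (\<integral>t. indicator A t *\<^sub>R G t \<partial>M)" by simp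
      finally show "norm (\<integral>t. norm (F n t) \<partial>M) \<le> \<bar>x\<bar> ^ n * (\<integral>t. indicator A t *\<^sub>R G t \<partial>M)" .
    qed
  qed
  moreover have "integral\<^sup>L M (F n) = (LINT t:A|M. g n t) * x ^ n" for n
    unfolding F_def set_lebesgue_integral_def
    by (simp flip: mult.assoc)
  moreover have "(\<Sum>n. F n t) = indicator A t *\<^sub>R h t" for t
    using sums[of t] by (auto simp: F_def indicator_def sums_iff)
  ultimately show ?thesis by (simp add: set_lebesgue_integral_def)
qed

section \<open>The left endpoint\<close>

text \<open>Puts finite and infinite left endpoints into one form. The distinction between the two
  is confined to the basic facts of this section.\<close>

lemma eventually_at_left_end:
  assumes "a < ereal c"
  shows "eventually P (at_left_end a) \<longleftrightarrow>
    (\<exists>d. a < ereal d \<and> d \<le> c \<and> (\<forall>x. a < ereal x \<and> x \<le> d \<longrightarrow> P x))"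
proof (cases a)
  case (real a')
  then have *: "eventually P (at_left_end a) \<longleftrightarrow> (\<exists>b>a'. \<forall>y>a'. y < b \<longrightarrow> P y)"
    by (simp add: at_left_end_def eventually_at_right_field)
  have c: "a' < c" using assms real by simp
  show ?thesis
  proof
    assume "eventually P (at_left_end a)"
    then obtain b where b: "b > a'" "\<forall>y>a'. y < b \<longrightarrow> P y" using * by blast
    then show "\<exists>d. a < ereal d \<and> d \<le> c \<and> (\<forall>x. a < ereal x \<and> x \<le> d \<longrightarrow> P x)"
      \<comment> \<open>The midpoint turns the strict bound \<open>y < b\<close> into the closed one
        \<open>x \<le> d\<close>.\<close>
      using c real by (intro exI[of _ "min c ((a' + b) / 2)"]) (auto simp: min_def)
  next
    assume "\<exists>d. a < ereal d \<and> d \<le> c \<and> (\<forall>x. a < ereal x \<and> x \<le> d \<longrightarrow> P x)"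
    then show "eventually P (at_left_end a)"
      unfolding * using real by (auto intro: less_imp_le)
  qed
next
  case MInf
  then have "eventually P (at_left_end a) \<longleftrightarrow> (\<exists>N. \<forall>n\<le>N. P n)"
    by (simp add: at_left_end_def eventually_at_bot_linorder)
  also have "\<dots> \<longleftrightarrow> (\<exists>d. a < ereal d \<and> d \<le> c \<and> (\<forall>x. a < ereal x \<and> x \<le> d \<longrightarrow> P x))"
  proof safe
    fix N assume "\<forall>n\<le>N. P n"
    then show "\<exists>d. a < ereal d \<and> d \<le> c \<and> (\<forall>x. a < ereal x \<and> x \<le> d \<longrightarrow> P x)"
      using MInf by (intro exI[of _ "min c N"]) auto
  qed (use MInf in auto)
  finally show ?thesis .
qed (use assms in auto)

lemma at_left_end_neq_bot:
  assumes "a < ereal c"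
  shows "at_left_end a \<noteq> bot"
  using assms by (cases a) (auto simp: at_left_end_def)

text \<open>A sequence tending to \<open>a\<close>, along which dominated convergence can be
  applied; staying below \<open>c\<close> keeps it where integrability is known.\<close>

lemma at_left_end_sequence:
  assumes "a < ereal c"
  obtains X where "\<And>n::nat. a < ereal (X n)" "\<And>n. X n \<le> c" "\<And>t. a < ereal t \<Longrightarrow> \<forall>\<^sub>F n in sequentially. X n < t"
proof (cases a)
  case (real a')
  define X where "X n = a' + (c - a') * inverse (real (Suc n))" for n
  have c: "a' < c" using assms real by simp
  show ?thesis
  proof
    show "a < ereal (X n)" for n using c real by (simp add: X_def)
    have "(c - a') * inverse (real (Suc n)) \<le> (c - a') * 1" for n
      using c by (intro mult_left_mono) (auto simp: field_simps)
    then show "X n \<le> c" for n unfolding X_def by (smt (verit))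
    have "X \<longlonglongrightarrow> a' + (c - a') * 0"
      unfolding X_def by (intro tendsto_intros LIMSEQ_inverse_real_of_nat)
    then show "\<forall>\<^sub>F n in sequentially. X n < t" if "a < ereal t" for t
      using that real by (intro order_tendstoD(2)) auto
  qed
next
  case MInf
  have "\<forall>\<^sub>F n in sequentially. c - real n < t" for t
    using filterlim_real_sequentially[unfolded filterlim_at_top_dense, rule_format, of "c - t"]
    by (rule eventually_mono) simp
  then show ?thesis using MInf by (intro that[of "\<lambda>n. c - real n"]) auto
qed (use assms in auto)

text \<open>The half-open interval \<open>(a, x]\<close> for finite or infinite \<open>a\<close>,
  written exactly like the domain of integration in \<open>phiC_coeff\<close>.\<close>

definition left_ray :: "ereal \<Rightarrow> real \<Rightarrow> real set" where
  "left_ray a x = {t. a < ereal t \<and> t \<le> x}"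

lemma left_ray_iff [simp]: "t \<in> left_ray a x \<longleftrightarrow> a < ereal t \<and> t \<le> x"
  by (simp add: left_ray_def)

lemma left_ray_borel [measurable]: "left_ray a x \<in> sets borel"
proof (cases a)
  case (real a')
  then have "left_ray a x = {a'<..x}" by auto
  then show ?thesis by simp
next
  case PInf
  then have "left_ray a x = {}" by auto
  then show ?thesis by simp
next
  case MInf
  then have "left_ray a x = {..x}" by auto
  then show ?thesis by simp
qed

lemma left_ray_lebesgue [measurable, simp]: "left_ray a x \<in> sets lebesgue"
  using left_ray_borel by (metis sets_completionI_sets sets_lborel)

lemma ereal_less_mono: "a < ereal x \<Longrightarrow> x \<le> y \<Longrightarrow> a < ereal y"
  by (erule less_le_trans) simp

text \<open>Dominated convergence gives the limit of the integrals of \<open>\<bar>g\<bar>\<close>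
  along a sequence; their monotonicity in the endpoint extends it to the whole filter.\<close>

lemma tendsto_left_ray_integral:
  fixes g :: "real \<Rightarrow> real"
  assumes a: "a < ereal c" and g: "set_integrable lebesgue (left_ray a c) g"
  shows "((\<lambda>x. LINT t:left_ray a x|lebesgue. g t) \<longlongrightarrow> 0) (at_left_end a)"
proof (rule tendstoI)
  fix e :: real assume e: "e > 0"
  obtain X where X: "\<And>n::nat. a < ereal (X n)" "\<And>n. X n \<le> c"
      "\<And>t. a < ereal t \<Longrightarrow> \<forall>\<^sub>F n in sequentially. X n < t"
    using at_left_end_sequence[OF a] by blast
  have sub: "set_integrable lebesgue (left_ray a x) g" if "x \<le> c" for x
    using g by (rule set_integrable_subset) (use that in auto)
  have "(\<lambda>n. LINT t|lebesgue. indicator (left_ray a (X n)) t *\<^sub>R \<bar>g t\<bar>) \<longlonglongrightarrow> integral\<^sup>L lebesgue (\<lambda>t::real. 0::real)"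
  proof (rule integral_dominated_convergence[where f = "\<lambda>_. 0" and w = "\<lambda>t. indicator (left_ray a c) t *\<^sub>R \<bar>g t\<bar>"])
    show "integrable lebesgue (\<lambda>t. indicator (left_ray a c) t *\<^sub>R \<bar>g t\<bar>)"
      using set_integrable_abs[OF g] by (simp add: set_integrable_def)
    show "(\<lambda>t. indicator (left_ray a (X n)) t *\<^sub>R \<bar>g t\<bar>) \<in> borel_measurable lebesgue" for n
      using set_integrable_abs[OF sub[OF X(2)[of n]]] by (simp add: set_integrable_def)
    show "AE t in lebesgue. (\<lambda>n. indicator (left_ray a (X n)) t *\<^sub>R \<bar>g t\<bar>) \<longlonglongrightarrow> 0"
    proof (rule AE_I2)
      fix t
      have "\<forall>\<^sub>F n in sequentially. indicator (left_ray a (X n)) t *\<^sub>R \<bar>g t\<bar> = 0"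
      proof (cases "a < ereal t")
        case True
        from X(3)[OF True] show ?thesis by eventually_elim (auto simp: indicator_def)
      qed (auto simp: indicator_def)
      then show "(\<lambda>n. indicator (left_ray a (X n)) t *\<^sub>R \<bar>g t\<bar>) \<longlonglongrightarrow> 0"
        by (rule tendsto_eventually)
    qed
    show "AE t in lebesgue. norm (indicator (left_ray a (X n)) t *\<^sub>R \<bar>g t\<bar>)
        \<le> indicator (left_ray a c) t *\<^sub>R \<bar>g t\<bar>" for n
      using X(2)[of n] by (intro AE_I2) (auto simp: indicator_def)
  qed auto
  then have "\<forall>\<^sub>F n in sequentially. (LINT t:left_ray a (X n)|lebesgue. \<bar>g t\<bar>) < e"
    using e by (intro order_tendstoD(2)) (auto simp: set_lebesgue_integral_def)
  then obtain n where n: "(LINT t:left_ray a (X n)|lebesgue. \<bar>g t\<bar>) < e"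
    by (meson eventually_happens trivial_limit_sequentially)
  show "\<forall>\<^sub>F x in at_left_end a. dist (LINT t:left_ray a x|lebesgue. g t) 0 < e"
    unfolding eventually_at_left_end[OF a]
  proof (intro exI[of _ "X n"] conjI X allI impI)
    fix x assume x: "a < ereal x \<and> x \<le> X n"
    have xc: "x \<le> c" using x X(2)[of n] by linarith
    have "\<bar>LINT t:left_ray a x|lebesgue. g t\<bar> \<le> (LINT t:left_ray a x|lebesgue. \<bar>g t\<bar>)"
      using set_integral_norm_bound[OF sub[OF xc]] by simp
    also have "\<dots> \<le> (LINT t:left_ray a (X n)|lebesgue. \<bar>g t\<bar>)"
      unfolding set_lebesgue_integral_def
      by (rule integral_mono)
         (use x set_integrable_abs[OF sub[OF xc]] set_integrable_abs[OF sub[OF X(2)[of n]]] in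
          \<open>auto simp: set_integrable_def indicator_def\<close>)
    finally show "dist (LINT t:left_ray a x|lebesgue. g t) 0 < e"
      using n by simp
  qed
qed

lemma left_ray_integral_split:
  fixes g :: "real \<Rightarrow> real"
  assumes g: "set_integrable lebesgue (left_ray a y) g" and x: "a < ereal x" "x \<le> y"
  shows "set_integrable lebesgue {x..y} g"
    and "(LINT t:left_ray a y|lebesgue. g t) = (LINT t:left_ray a x|lebesgue. g t) + (LINT t:{x..y}|lebesgue. g t)"
proof -
  have sub: "{x..y} \<subseteq> left_ray a y" using x by (auto intro: ereal_less_mono)
  show i: "set_integrable lebesgue {x..y} g"
    by (rule set_integrable_subset[OF g _ sub]) simp
  have i': "set_integrable lebesgue (left_ray a x) g"
    by (rule set_integrable_subset[OF g]) (use x in auto)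
  have eq: "left_ray a y = left_ray a x \<union> {x..y}" using x sub by auto
  have "AE t in lebesgue. \<not> (t \<in> left_ray a x \<and> t \<in> {x..y})"
  proof (rule AE_I')
    show "{x} \<in> null_sets lebesgue" by (simp flip: negligible_iff_null_sets)
  qed auto
  from set_integral_Un_AE[OF this _ _ i' i]
  show "(LINT t:left_ray a y|lebesgue. g t) = (LINT t:left_ray a x|lebesgue. g t) + (LINT t:{x..y}|lebesgue. g t)"
    using eq by simp
qed

section \<open>Solutions near the left endpoint\<close>

lemma set_integral_pos_AE:
  fixes g :: "'a \<Rightarrow> real"
  assumes g: "set_integrable M A g" and A: "A \<in> sets M" "A \<notin> null_sets M"
    and pos: "AE t in M. t \<in> A \<longrightarrow> 0 < g t"
  shows "0 < (LINT t:A|M. g t)"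
proof -
  let ?f = "\<lambda>t. indicator A t *\<^sub>R g t"
  have i: "integrable M ?f" using g by (simp add: set_integrable_def)
  have nn: "AE t in M. 0 \<le> ?f t"
    using pos by eventually_elim (auto simp: indicator_def)
  have "integral\<^sup>L M ?f \<noteq> 0"
  proof
    assume "integral\<^sup>L M ?f = 0"
    then have "AE t in M. ?f t = 0" using integral_nonneg_eq_0_iff_AE[OF i nn] by simp
    then have "AE t in M. t \<notin> A"
      using pos by eventually_elim (auto simp: indicator_def)
    then show False using A by (simp add: AE_iff_null_sets)
  qed
  then show ?thesis
    using integral_nonneg_AE[OF nn] by (simp add: set_lebesgue_integral_def)
qed

lemma set_integral_mono_AE_on:
  fixes f g :: "'a \<Rightarrow> real"
  assumes "set_integrable M A f" "set_integrable M A g" "AE t in M. t \<in> A \<longrightarrow> f t \<le> g t"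
  shows "(LINT t:A|M. f t) \<le> (LINT t:A|M. g t)"
  unfolding set_lebesgue_integral_def
proof (rule integral_mono_AE)
  show "AE t in M. indicator A t *\<^sub>R f t \<le> indicator A t *\<^sub>R g t"
    using assms(3) by eventually_elim (auto simp: indicator_def)
qed (use assms in \<open>auto simp: set_integrable_def\<close>)

lemma set_integrable_continuous_mult:
  fixes f g :: "real \<Rightarrow> real"
  assumes "continuous_on {x..y} f" "set_integrable lebesgue {x..y} g"
  shows "set_integrable lebesgue {x..y} (\<lambda>t. f t * g t)"
proof (rule absolutely_integrable_bounded_measurable_product_real)
  show "bounded (f ` {x..y})"
    by (intro compact_imp_bounded compact_continuous_image assms) simp
  show "f \<in> borel_measurable (lebesgue_on {x..y})"
    by (rule continuous_imp_measurable_on_sets_lebesgue[OF assms(1)]) simp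
qed (use assms in auto)

lemma has_vector_derivative_divide:
  fixes f g :: "real \<Rightarrow> 'a::real_normed_field"
  assumes "(f has_vector_derivative f') (at x)" "(g has_vector_derivative g') (at x)" "g x \<noteq> 0"
  shows "((\<lambda>x. f x / g x) has_vector_derivative (f' * g x - f x * g') / (g x)\<^sup>2) (at x)"
proof -
  have "((\<lambda>x. f x / g x) has_derivative
      (\<lambda>h. ((h *\<^sub>R f') * g x - f x * (h *\<^sub>R g')) / (g x * g x))) (at x)"
    using assms unfolding has_vector_derivative_def by (intro has_derivative_divide') auto
  moreover have "((h *\<^sub>R f') * g x - f x * (h *\<^sub>R g')) / (g x * g x)
      = h *\<^sub>R ((f' * g x - f x * g') / (g x)\<^sup>2)" for h
    by (simp add: power2_eq_square scaleR_diff_right[symmetric] scaleR_conv_of_real algebra_simps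
        diff_divide_distrib)
  ultimately show ?thesis by (simp add: has_vector_derivative_def)
qed

locale SL_left =
  fixes a b :: ereal and p q r :: "real \<Rightarrow> real" and lam :: real
    and u u1 v v1 :: "real \<Rightarrow> real" and c :: real
  assumes setting: "SL_setting a b p q r"
    and u_sol: "SL_sol a b p q r lam u u1" and v_sol: "SL_sol a b p q r lam v v1"
    and W_vu: "\<And>x. x \<in> SL_int a b \<Longrightarrow> v x * u1 x - v1 x * u x = 1"
    and c: "c \<in> SL_int a b"
    and u_nz: "\<And>x. a < ereal x \<Longrightarrow> x \<le> c \<Longrightarrow> u x \<noteq> 0"
begin

abbreviation F :: "real filter" where "F \<equiv> at_left_end a"

abbreviation J :: "real set" where "J \<equiv> left_ray a c"

definition s :: "real \<Rightarrow> real" where "s x = v x / u x"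

definition \<sigma> :: "real \<Rightarrow> real" where "\<sigma> x = 1 / (p x * (u x)\<^sup>2)"

lemma a_less_c: "a < ereal c"
  using c by (simp add: SL_int_def)

lemma F_neq_bot [simp]: "F \<noteq> bot"
  by (rule at_left_end_neq_bot[OF a_less_c])

lemma J_subset_SL_int: "J \<subseteq> SL_int a b"
  using c by (auto simp: SL_int_def intro: le_less_trans[of _ "ereal c"])

lemma interval_subset_J: "x \<in> J \<Longrightarrow> y \<le> c \<Longrightarrow> {x..y} \<subseteq> J"
  by (auto intro: ereal_less_mono)

lemma eventually_F: "eventually P F \<longleftrightarrow> (\<exists>d\<in>J. \<forall>x\<in>J. x \<le> d \<longrightarrow> P x)"
  unfolding eventually_at_left_end[OF a_less_c] Bex_def Ball_def left_ray_iff
  by (meson order_trans)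

lemma eventually_F_J: "eventually (\<lambda>x. x \<in> J) F"
  unfolding eventually_F using a_less_c by auto

lemma sol_abs_cont:
  assumes "SL_sol a b p q r z f f1" "x \<in> J" "x \<le> y" "y \<le> c"
  shows "abs_cont_on x y f" "abs_cont_on x y f1"
  using assms interval_subset_J[OF assms(2,4)] J_subset_SL_int
  unfolding SL_sol_def AC_loc_def by blast+

lemma sol_AE:
  fixes f :: "real \<Rightarrow> 'a::real_normed_field"
  assumes "SL_sol a b p q r z f f1"
  shows "AE x in lebesgue. x \<in> J \<longrightarrow> 0 < p x \<and> 0 < r x \<and>
    (f has_vector_derivative (1 / p x) *\<^sub>R f1 x) (at x) \<and>
    (f1 has_vector_derivative (q x *\<^sub>R f x - r x *\<^sub>R (z * f x))) (at x)"
proof -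
  have 1: "AE x in lebesgue. x \<in> SL_int a b \<longrightarrow> 0 < r x" "AE x in lebesgue. x \<in> SL_int a b \<longrightarrow> 0 < p x"
    using setting by (auto simp: SL_setting_def)
  have 2: "AE x in lebesgue. x \<in> SL_int a b \<longrightarrow> (\<exists>D. (f has_vector_derivative D) (at x) \<and> f1 x = p x *\<^sub>R D)"
      "AE x in lebesgue. x \<in> SL_int a b \<longrightarrow>
        (\<exists>D. (f1 has_vector_derivative D) (at x) \<and> (1 / r x) *\<^sub>R (- D + q x *\<^sub>R f x) = z * f x)"
    using assms by (auto simp: SL_sol_def)
  from 1 2 show ?thesis
  proof eventually_elim
    case (elim x)
    show ?case
    proof
      assume "x \<in> J"
      then have x: "x \<in> SL_int a b" using J_subset_SL_int by blast
      then have pr: "0 < p x" "0 < r x" using elim by auto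
      obtain D where D: "(f has_vector_derivative D) (at x)" "f1 x = p x *\<^sub>R D" using elim x by blast
      obtain E where E: "(f1 has_vector_derivative E) (at x)" "(1 / r x) *\<^sub>R (- E + q x *\<^sub>R f x) = z * f x"
        using elim x by blast
      have "r x *\<^sub>R ((1 / r x) *\<^sub>R (- E + q x *\<^sub>R f x)) = r x *\<^sub>R (z * f x)" using E(2) by simp
      then have "E = q x *\<^sub>R f x - r x *\<^sub>R (z * f x)" using pr by (simp add: algebra_simps)
      then show "0 < p x \<and> 0 < r x \<and> (f has_vector_derivative (1 / p x) *\<^sub>R f1 x) (at x) \<and>
          (f1 has_vector_derivative (q x *\<^sub>R f x - r x *\<^sub>R (z * f x))) (at x)"
        using D E pr by simp
    qed
  qed
qed

text \<open>Only \<open>f1 = p f'\<close> and \<open>g1 = p g'\<close> enter, so the two spectral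
  parameters may differ. This serves both \<open>f/u\<close> with \<open>f\<close> at
  \<open>lam + z\<close>, and \<open>theta/phi\<close> at one complex \<open>z\<close>.\<close>

lemma sol_quotient_AE:
  fixes f g :: "real \<Rightarrow> 'a::real_normed_field"
  assumes "SL_sol a b p q r z f f1" "SL_sol a b p q r z' g g1"
  shows "AE x in lebesgue. x \<in> J \<and> g x \<noteq> 0 \<longrightarrow>
    ((\<lambda>x. f x / g x) has_vector_derivative
      - ((1 / p x) *\<^sub>R ((f x * g1 x - f1 x * g x) / (g x)\<^sup>2))) (at x)"
  using sol_AE[OF assms(1)] sol_AE[OF assms(2)]
proof eventually_elim
  case (elim x)
  show ?case
  proof
    assume x: "x \<in> J \<and> g x \<noteq> 0"
    then have "((\<lambda>x. f x / g x) has_vector_derivative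
        (((1 / p x) *\<^sub>R f1 x) * g x - f x * ((1 / p x) *\<^sub>R g1 x)) / (g x)\<^sup>2) (at x)"
      using elim by (intro has_vector_derivative_divide) auto
    moreover have "(((1 / p x) *\<^sub>R f1 x) * g x - f x * ((1 / p x) *\<^sub>R g1 x)) / (g x)\<^sup>2
        = - ((1 / p x) *\<^sub>R ((f x * g1 x - f1 x * g x) / (g x)\<^sup>2))"
      by (simp add: scaleR_conv_of_real algebra_simps diff_divide_distrib)
    ultimately show "((\<lambda>x. f x / g x) has_vector_derivative
        - ((1 / p x) *\<^sub>R ((f x * g1 x - f1 x * g x) / (g x)\<^sup>2))) (at x)" by simp
  qed
qed

lemma s_AE: "AE x in lebesgue. x \<in> J \<longrightarrow> (s has_vector_derivative - \<sigma> x) (at x) \<and> 0 < \<sigma> x"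
  using sol_quotient_AE[OF v_sol u_sol] sol_AE[OF u_sol]
proof eventually_elim
  case (elim x)
  show ?case
  proof
    assume x: "x \<in> J"
    then have "v x * u1 x - v1 x * u x = 1" "u x \<noteq> 0"
      using W_vu J_subset_SL_int u_nz by auto
    then show "(s has_vector_derivative - \<sigma> x) (at x) \<and> 0 < \<sigma> x"
      using elim x by (simp add: s_def[abs_def] \<sigma>_def)
  qed
qed

lemma s_abs_cont:
  assumes "x \<in> J" "x \<le> y" "y \<le> c"
  shows "abs_cont_on x y s"
  unfolding s_def[abs_def]
  by (intro abs_cont_on_divide sol_abs_cont[OF v_sol] sol_abs_cont[OF u_sol] assms)
     (use u_nz interval_subset_J[OF assms(1,3)] in auto)

lemma \<sigma>_integrable:
  assumes "x \<in> J" "x \<le> y" "y \<le> c"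
  shows "set_integrable lebesgue {x..y} \<sigma>"
proof -
  have sub: "{x..y} \<subseteq> J" by (rule interval_subset_J[OF assms(1,3)])
  then have "set_integrable lebesgue {x..y} (\<lambda>x. 1 / p x)"
    using setting J_subset_SL_int by (auto simp: SL_setting_def L1_loc_def)
  moreover have "continuous_on {x..y} (\<lambda>t. 1 / (u t)\<^sup>2)"
    using abs_cont_on_imp_continuous_on[OF sol_abs_cont(1)[OF u_sol assms]] sub u_nz
    by (intro continuous_intros) auto
  ultimately have "set_integrable lebesgue {x..y} (\<lambda>t. 1 / (u t)\<^sup>2 * (1 / p t))"
    by (intro set_integrable_continuous_mult)
  then show ?thesis by (simp add: \<sigma>_def[abs_def] mult.commute)
qed

lemma s_diff:
  assumes "x \<in> J" "x \<le> y" "y \<le> c"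
  shows "(LINT t:{x..y}|lebesgue. \<sigma> t) = s x - s y"
proof -
  have "(LINT t:{x..y}|lebesgue. - \<sigma> t) = s y - s x"
  proof (rule abs_cont_on_lebesgue_integral[OF s_abs_cont[OF assms] assms(2)])
    show "AE t in lebesgue. t \<in> {x..y} \<longrightarrow> (s has_vector_derivative - \<sigma> t) (at t)"
      using s_AE by eventually_elim (use interval_subset_J[OF assms(1,3)] in blast)
    show "set_integrable lebesgue {x..y} (\<lambda>t. - \<sigma> t)"
      using \<sigma>_integrable[OF assms] by (simp add: set_integrable_def)
  qed
  then show ?thesis by (simp add: set_lebesgue_integral_def)
qed

lemma interval_not_null: "x < y \<Longrightarrow> {x..y::real} \<notin> null_sets lebesgue"
  by (simp add: null_sets_def)

lemma s_strict_antimono: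
  assumes "x \<in> J" "x < y" "y \<le> c"
  shows "s y < s x"
proof -
  have "0 < (LINT t:{x..y}|lebesgue. \<sigma> t)"
  proof (rule set_integral_pos_AE[OF \<sigma>_integrable _ interval_not_null])
    show "AE t in lebesgue. t \<in> {x..y} \<longrightarrow> 0 < \<sigma> t"
      using s_AE by eventually_elim (use interval_subset_J[OF assms(1,3)] in blast)
  qed (use assms in auto)
  then show ?thesis using s_diff assms by simp
qed

lemma s_antimono: "x \<in> J \<Longrightarrow> x \<le> y \<Longrightarrow> y \<le> c \<Longrightarrow> s y \<le> s x"
  using s_strict_antimono[of x y] by (cases "x = y") auto

text \<open>\<open>lim\<close> alone admits divergence to minus infinity, and zeros of
  \<open>Z\<close> since \<open>1/0 = 0\<close>. If \<open>Z\<close> does not tend to plus infinity,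
  monotonicity bounds it from both sides, so small \<open>1/Z\<close> forces \<open>Z = 0\<close> on
  a whole ray, against strictness.\<close>

lemma strict_antimono_at_top:
  fixes Z :: "real \<Rightarrow> real"
  assumes anti: "\<And>x y. x \<in> J \<Longrightarrow> x < y \<Longrightarrow> y \<le> d0 \<Longrightarrow> Z y < Z x" and d0: "d0 \<in> J"
    and lim: "((\<lambda>x. 1 / Z x) \<longlongrightarrow> 0) F"
  shows "filterlim Z at_top F"
proof (rule ccontr)
  have anti': "Z y \<le> Z x" if "x \<in> J" "x \<le> y" "y \<le> d0" for x y
    using anti[of x y] that by (cases "x = y") auto
  assume "\<not> filterlim Z at_top F"
  then obtain B where B: "\<not> eventually (\<lambda>x. B \<le> Z x) F" by (auto simp: filterlim_at_top)
  have bd: "Z x \<le> B" if "x \<in> J" "x \<le> d0" for x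
  proof (rule ccontr)
    assume "\<not> Z x \<le> B"
    then have "eventually (\<lambda>x. B \<le> Z x) F"
      unfolding eventually_F using that anti' by (intro bexI[of _ x]) force+
    with B show False by simp
  qed
  \<comment> \<open>Smaller than \<open>1/|Z x|\<close> for every nonzero value of \<open>Z\<close>
    between \<open>Z d0\<close> and \<open>B\<close>.\<close>
  define e where "e = 1 / (\<bar>B\<bar> + \<bar>Z d0\<bar> + 1)"
  have e: "e > 0" by (simp add: e_def)
  have "eventually (\<lambda>x. \<bar>1 / Z x\<bar> < e) F"
    using tendstoD[OF lim e] by simp
  then obtain d where d: "d \<in> J" "\<And>x. x \<in> J \<Longrightarrow> x \<le> d \<Longrightarrow> \<bar>1 / Z x\<bar> < e"
    unfolding eventually_F by blast
  have z: "Z x = 0" if "x \<in> J" "x \<le> d" "x \<le> d0" for x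
  proof (rule ccontr)
    assume nz: "Z x \<noteq> 0"
    have "Z d0 \<le> Z x" "Z x \<le> B" using that anti'[of x d0] bd by auto
    then have "\<bar>Z x\<bar> < \<bar>B\<bar> + \<bar>Z d0\<bar> + 1" by linarith
    moreover have "1 / \<bar>Z x\<bar> < e" using d(2)[OF that(1,2)] by simp
    then have "\<bar>B\<bar> + \<bar>Z d0\<bar> + 1 < \<bar>Z x\<bar>"
      using nz by (simp add: e_def divide_less_eq less_divide_eq split: if_splits)
    ultimately show False by linarith
  qed
  define d1 where "d1 = min d d0"
  have d1: "d1 \<in> J" using d d0 by (simp add: d1_def min_def)
  obtain d' where d': "d' \<in> J" "d' < d1"
    using d1 ereal_dense2[of a "ereal d1"] by auto
  then show False using anti[of d' d1] z[of d'] z[of d1] d1 by (simp add: d1_def)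
qed

lemma s_at_top:
  assumes "((\<lambda>x. u x / v x) \<longlongrightarrow> 0) F"
  shows "filterlim s at_top F"
  by (rule strict_antimono_at_top[of c]) (use s_strict_antimono a_less_c assms in \<open>auto simp: s_def\<close>)

text \<open>L'Hospital's rule for \<open>f/s\<close> with vector values. After subtracting
  \<open>s e\<close>, the increments of the remainder are at most \<open>\<epsilon>/2\<close> times
  those of \<open>s\<close>, and the divergence of \<open>s\<close> absorbs the value at the base
  point \<open>d\<close>.\<close>

lemma lhopital:
  fixes f m :: "real \<Rightarrow> 'a::banach"
  assumes s_top: "filterlim s at_top F"
    and ac: "\<And>x. x \<in> J \<Longrightarrow> abs_cont_on x c f"
    and der: "AE x in lebesgue. x \<in> J \<longrightarrow> (f has_vector_derivative (- \<sigma> x) *\<^sub>R m x) (at x)"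
    and lim: "(m \<longlongrightarrow> e) F"
  shows "((\<lambda>x. inverse (s x) *\<^sub>R f x) \<longlongrightarrow> e) F"
proof (rule tendstoI)
  fix \<epsilon> :: real assume \<epsilon>: "\<epsilon> > 0"
  define g where "g x = f x - s x *\<^sub>R e" for x
  have "eventually (\<lambda>x. dist (m x) e < \<epsilon> / 2) F"
    using tendstoD[OF lim, of "\<epsilon> / 2"] \<epsilon> by simp
  then obtain d where d: "d \<in> J" "\<And>x. x \<in> J \<Longrightarrow> x \<le> d \<Longrightarrow> dist (m x) e < \<epsilon> / 2"
    unfolding eventually_F by blast
  have dc: "d \<le> c" using d by simp
  have gd: "norm (g d - g x) \<le> \<epsilon> / 2 * (s x - s d)" if x: "x \<in> J" "x \<le> d" for x
  proof -
    have "norm (g d - g x) \<le> (- (\<epsilon> / 2)) * s d - (- (\<epsilon> / 2)) * s x"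
    proof (rule abs_cont_on_norm_increment_le)
      show "abs_cont_on x d g"
        unfolding g_def
        by (intro abs_cont_on_diff abs_cont_on_bounded_linear[OF bounded_linear_scaleR_left]
            abs_cont_on_subset[OF ac[OF x(1)]] s_abs_cont x dc order_refl)
      show "abs_cont_on x d (\<lambda>x. (- (\<epsilon> / 2)) * s x)"
        by (intro abs_cont_on_bounded_linear[OF bounded_linear_mult_right] s_abs_cont x dc)
      show "AE t in lebesgue. t \<in> {x..d} \<longrightarrow> (\<exists>D G. (g has_vector_derivative D) (at t) \<and>
          ((\<lambda>x. - (\<epsilon> / 2) * s x) has_vector_derivative G) (at t) \<and> norm D \<le> G)"
        using s_AE der
      proof eventually_elim
        case (elim t)
        show ?case
        proof
          assume t: "t \<in> {x..d}"
          then have tJ: "t \<in> J" using interval_subset_J[OF x(1) dc] by blast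
          have "(g has_vector_derivative ((- \<sigma> t) *\<^sub>R m t - (- \<sigma> t) *\<^sub>R e)) (at t)"
            unfolding g_def using elim tJ
            by (intro has_vector_derivative_diff
                bounded_linear.has_vector_derivative[OF bounded_linear_scaleR_left]) auto
          moreover have "((\<lambda>x. - (\<epsilon> / 2) * s x) has_vector_derivative (- (\<epsilon> / 2) * (- \<sigma> t))) (at t)"
            using elim tJ by (intro has_vector_derivative_mult_right) auto
          moreover have "norm ((- \<sigma> t) *\<^sub>R m t - (- \<sigma> t) *\<^sub>R e) \<le> - (\<epsilon> / 2) * (- \<sigma> t)"
          proof -
            have "norm ((- \<sigma> t) *\<^sub>R m t - (- \<sigma> t) *\<^sub>R e) = \<sigma> t * dist (m t) e"
              using elim tJ by (simp add: dist_norm norm_minus_commute flip: scaleR_diff_right)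
            also have "\<dots> \<le> \<sigma> t * (\<epsilon> / 2)"
              using elim tJ d(2)[of t] t by (intro mult_left_mono) auto
            finally show ?thesis by (simp add: mult.commute)
          qed
          ultimately show "\<exists>D G. (g has_vector_derivative D) (at t) \<and>
            ((\<lambda>x. - (\<epsilon> / 2) * s x) has_vector_derivative G) (at t) \<and> norm D \<le> G" by blast
        qed
      qed
    qed (use x in auto)
    then show ?thesis by (simp add: algebra_simps)
  qed
  \<comment> \<open>The threshold makes \<open>s x\<close> positive and
    \<open>\<epsilon>/2 * s x\<close> larger than all terms that stem from \<open>d\<close>.\<close>
  have "eventually (\<lambda>x. max 1 ((norm (g d) + \<epsilon> / 2 * \<bar>s d\<bar>) * 2 / \<epsilon> + 1) \<le> s x) F"
    using s_top unfolding filterlim_at_top by blast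
  moreover have "eventually (\<lambda>x. x \<in> J \<and> x \<le> d) F"
    unfolding eventually_F using d by auto
  ultimately show "eventually (\<lambda>x. dist (inverse (s x) *\<^sub>R f x) e < \<epsilon>) F"
  proof eventually_elim
    case (elim x)
    have s1: "s x > 0" and s2: "(norm (g d) + \<epsilon> / 2 * \<bar>s d\<bar>) * 2 / \<epsilon> < s x" using elim by auto
    have s3: "norm (g d) + \<epsilon> / 2 * \<bar>s d\<bar> < \<epsilon> / 2 * s x"
      using s2 \<epsilon> by (simp add: field_simps)
    have "norm (g x) \<le> norm (g d) + norm (g d - g x)"
      by (metis norm_minus_commute norm_triangle_sub)
    also have "\<dots> \<le> norm (g d) + \<epsilon> / 2 * (s x - s d)" using gd[of x] elim by auto
    also have "\<dots> \<le> norm (g d) + \<epsilon> / 2 * \<bar>s d\<bar> + \<epsilon> / 2 * s x"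
      using \<epsilon> by (auto simp: right_diff_distrib abs_if field_simps)
    also have "\<dots> < \<epsilon> * s x" using s3 by simp
    finally have "norm (g x) < \<epsilon> * s x" .
    moreover have "inverse (s x) *\<^sub>R f x - e = inverse (s x) *\<^sub>R g x"
      using s1 by (simp add: g_def algebra_simps)
    ultimately show ?case using s1 by (simp add: dist_norm divide_simps)
  qed
qed

end

lemma (in SL_left) sol_continuous_on_J:
  assumes "SL_sol a b p q r z f f1"
  shows "continuous_on J f" "continuous_on J f1"
proof -
  have "continuous_on J g" if g: "\<And>x. x \<in> J \<Longrightarrow> abs_cont_on x c g" for g :: "real \<Rightarrow> 'a"
    unfolding continuous_on_eq_continuous_within
  proof
    fix x assume x: "x \<in> J"
    obtain x' where x': "a < ereal x'" "x' < x"
      using x ereal_dense2[of a "ereal x"] by auto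
    have mono: "a < ereal t" if "x' < t" for t
      using x'(1) that by (rule ereal_less_mono[OF _ less_imp_le])
    have "continuous_on {x'..c} g"
      by (intro abs_cont_on_imp_continuous_on g) (use x x' in auto)
    then have "continuous (at x within {x'..c}) g"
      using x x' by (auto simp: continuous_on_eq_continuous_within)
    moreover have "at x within {x'..c} = at x within J"
      using mono by (intro at_within_nhd[of _ "{x'<..}"]) (use x x' in auto)
    ultimately show "continuous (at x within J) g" by simp
  qed
  then show "continuous_on J f" "continuous_on J f1"
    using sol_abs_cont[OF assms] by auto
qed

text \<open>\<open>c\<close> is now so close to \<open>a\<close> that \<open>s \<ge> 1\<close>,
  hence \<open>|u| \<le> |v|\<close>, and that the series of Construction (C) is dominated by a
  geometric one with ratio at most 1/4 on the closed unit disc around \<open>lam\<close>.\<close>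

locale SL_end = SL_left +
  assumes s_ge_1: "\<And>x. a < ereal x \<Longrightarrow> x \<le> c \<Longrightarrow> 1 \<le> s x"
    and s_top: "filterlim s at_top F"
    and uvr_integrable: "set_integrable lebesgue J (\<lambda>x. u x * v x * r x)"
    and uvr_small: "(LINT x:J|lebesgue. \<bar>u x * v x * r x\<bar>) \<le> 1 / 4"
begin

lemma v_eq: "x \<in> J \<Longrightarrow> v x = s x * u x"
  using u_nz by (simp add: s_def)

lemma u_le_v: "x \<in> J \<Longrightarrow> \<bar>u x\<bar> \<le> \<bar>v x\<bar>"
  using s_ge_1[of x] mult_right_mono[of 1 "s x" "\<bar>u x\<bar>"] by (simp add: v_eq abs_mult)

lemma sol_measurable:
  fixes f :: "real \<Rightarrow> real"
  assumes "SL_sol a b p q r z f f1"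
  shows "f \<in> borel_measurable (lebesgue_on J)"
  by (rule continuous_imp_measurable_on_sets_lebesgue[OF sol_continuous_on_J(1)[OF assms]]) simp

lemma r_measurable: "r \<in> borel_measurable (lebesgue_on J)"
proof -
  have "(\<lambda>x. indicator (SL_int a b) x *\<^sub>R r x) \<in> borel_measurable lebesgue"
    using setting by (simp add: SL_setting_def set_borel_measurable_def)
  then have "(\<lambda>x. indicator (SL_int a b) x *\<^sub>R r x) \<in> borel_measurable (lebesgue_on J)"
    by (rule measurable_restrict_space1)
  then show ?thesis
    by (rule measurable_cong[THEN iffD1, rotated]) (use J_subset_SL_int in \<open>auto simp: indicator_def\<close>)
qed

lemma set_integrable_dominated:
  assumes "g \<in> borel_measurable (lebesgue_on J)" and "\<And>t. t \<in> J \<Longrightarrow> \<bar>g t\<bar> \<le> K * \<bar>u t * v t * r t\<bar>"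
  shows "set_integrable lebesgue J g"
proof -
  have "set_integrable lebesgue J (\<lambda>t. K * \<bar>u t * v t * r t\<bar>)"
    by (intro set_integrable_mult_right set_integrable_abs uvr_integrable)
  then have "integrable (lebesgue_on J) (\<lambda>t. K * \<bar>u t * v t * r t\<bar>)"
    unfolding set_integrable_def by (subst integrable_restrict_space) auto
  then have "integrable (lebesgue_on J) g"
  proof (rule Bochner_Integration.integrable_bound)
    show "AE t in lebesgue_on J. norm (g t) \<le> norm (K * \<bar>u t * v t * r t\<bar>)"
      using assms(2) by (intro AE_I2) (force intro: order_trans[OF _ abs_ge_self])
  qed (rule assms)
  then show ?thesis
    unfolding set_integrable_def by (subst (asm) integrable_restrict_space) auto
qed

lemma set_integrable_left_ray:
  assumes "set_integrable lebesgue J g" "x \<le> c"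
  shows "set_integrable lebesgue (left_ray a x) (g :: real \<Rightarrow> real)"
  using assms(1) by (rule set_integrable_subset) (use assms in auto)

text \<open>The gain per iteration in Construction (C): \<open>phi_n\<close> is bounded by
  \<open>M ^ n * |u|\<close>.\<close>

definition M :: "real \<Rightarrow> real" where
  "M x = (LINT t:left_ray a x|lebesgue. \<bar>u t * v t * r t\<bar>)"

text \<open>\<open>g\<close> need not be integrable, because otherwise its integral is 0 by
  convention. The iterates of Construction (C) can thus be estimated before anything is known about
  their measurability.\<close>

lemma left_ray_integral_bound:
  assumes "\<And>t. t \<in> left_ray a x \<Longrightarrow> \<bar>g t\<bar> \<le> K * \<bar>u t * v t * r t\<bar>" "x \<le> c" "K \<ge> 0"
  shows "\<bar>LINT t:left_ray a x|lebesgue. g t\<bar> \<le> K * M x"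
proof -
  have i: "set_integrable lebesgue (left_ray a x) (\<lambda>t. K * \<bar>u t * v t * r t\<bar>)"
    by (intro set_integrable_mult_right set_integrable_abs set_integrable_left_ray[OF uvr_integrable] assms)
  have "\<bar>LINT t:left_ray a x|lebesgue. g t\<bar> \<le> (LINT t:left_ray a x|lebesgue. K * \<bar>u t * v t * r t\<bar>)"
  proof (cases "integrable lebesgue (\<lambda>t. indicator (left_ray a x) t *\<^sub>R g t)")
    case True
    then show ?thesis
      using i assms unfolding set_lebesgue_integral_def set_integrable_def
      by (intro integral_abs_bound_integral) (auto simp: indicator_def)
  next
    case False
    moreover have "0 \<le> (LINT t:left_ray a x|lebesgue. K * \<bar>u t * v t * r t\<bar>)"
      using assms(3) unfolding set_lebesgue_integral_def by (intro integral_nonneg_AE) (auto simp: indicator_def)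
    ultimately show ?thesis
      by (simp add: set_lebesgue_integral_def not_integrable_integral_eq)
  qed
  then show ?thesis by (simp add: M_def)
qed

lemma M_mono:
  assumes "x \<le> y" "y \<le> c"
  shows "M x \<le> M y"
  using set_integrable_left_ray[OF set_integrable_abs[OF uvr_integrable], of x]
    set_integrable_left_ray[OF set_integrable_abs[OF uvr_integrable], of y] assms
  unfolding M_def set_lebesgue_integral_def
  by (intro integral_mono) (auto simp: set_integrable_def indicator_def)

lemma M_le: "x \<le> c \<Longrightarrow> M x \<le> 1 / 4"
  using M_mono[of x c] uvr_small by (simp add: M_def)

lemma M_nonneg: "0 \<le> M x"
  unfolding M_def set_lebesgue_integral_def by (rule integral_nonneg_AE) (auto simp: indicator_def)

lemma M_tendsto: "(M \<longlongrightarrow> 0) F"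
  unfolding M_def[abs_def]
  by (rule tendsto_left_ray_integral[OF a_less_c set_integrable_abs[OF uvr_integrable]])

lemma continuous_on_left_ray_integral:
  fixes g :: "real \<Rightarrow> real"
  assumes g: "set_integrable lebesgue J g" and x: "x \<in> J" and y: "y \<le> c"
  shows "continuous_on {x..y} (\<lambda>t. LINT t':left_ray a t|lebesgue. g t')"
proof -
  have xy: "{x..y} \<subseteq> J" by (rule interval_subset_J[OF x y])
  have gi: "set_integrable lebesgue {x..y} g"
    by (rule set_integrable_subset[OF g _ xy]) simp
  have "continuous_on {x..y} (\<lambda>t. (LINT t':left_ray a x|lebesgue. g t') + integral {x..t} g)"
    by (intro continuous_intros indefinite_integral_continuous_1 set_lebesgue_integral_eq_integral(1)[OF gi])
  then show ?thesis
  proof (rule continuous_on_eq)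
    fix t assume t: "t \<in> {x..y}"
    then have "t \<le> c" using y by simp
    note g' = set_integrable_left_ray[OF g this]
    have "(LINT t':left_ray a t|lebesgue. g t') = (LINT t':left_ray a x|lebesgue. g t') + (LINT t':{x..t}|lebesgue. g t')"
      by (rule left_ray_integral_split(2)[OF g']) (use x t in auto)
    moreover have "(LINT t':{x..t}|lebesgue. g t') = integral {x..t} g"
      by (rule set_lebesgue_integral_eq_integral(2)[OF left_ray_integral_split(1)[OF g']]) (use x t in auto)
    ultimately show "(LINT t':left_ray a x|lebesgue. g t') + integral {x..t} g = (LINT t':left_ray a t|lebesgue. g t')"
      by simp
  qed
qed

text \<open>The coefficients of \<open>W(f, u)\<close> in \<open>z\<close> when \<open>f = (\<Sum>n. \<psi>\<^sub>n z\<^sup>n)\<close> and the limit of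
  \<open>W(f, u)\<close> at the endpoint is \<open>e\<close> for every \<open>z\<close>.\<close>

definition coeff_wronskian :: "real \<Rightarrow> (nat \<Rightarrow> real \<Rightarrow> real) \<Rightarrow> nat \<Rightarrow> real \<Rightarrow> real" where
  "coeff_wronskian e \<psi> n x =
     (case n of 0 \<Rightarrow> e | Suc m \<Rightarrow> LINT t:left_ray a x|lebesgue. \<psi> m t * u t * r t)"

section \<open>The recursion for the coefficients of a real solution family\<close>

context
  fixes f f1 :: "real \<Rightarrow> real \<Rightarrow> real" and \<psi> :: "nat \<Rightarrow> real \<Rightarrow> real" and C e :: real
  assumes sol: "\<And>z. \<bar>z\<bar> < 1 \<Longrightarrow> SL_sol a b p q r (lam + z) (f z) (f1 z)"
    and series: "\<And>z x. \<bar>z\<bar> < 1 \<Longrightarrow> x \<in> J \<Longrightarrow> (\<lambda>n. \<psi> n x * z ^ n) sums f z x"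
    and bound: "\<And>n x. x \<in> J \<Longrightarrow> \<bar>\<psi> n x\<bar> \<le> C * \<bar>v x\<bar>"
    and lim: "\<And>z. \<bar>z\<bar> < 1 \<Longrightarrow> ((\<lambda>x. f z x / v x) \<longlongrightarrow> e) F"
begin

lemma C_nonneg: "0 \<le> C"
proof -
  have "0 \<le> C * \<bar>v c\<bar>" using bound[of c 0] a_less_c by fastforce
  moreover have "0 < \<bar>v c\<bar>" using u_le_v[of c] u_nz[of c] a_less_c by auto
  ultimately show ?thesis by (simp add: zero_le_mult_iff)
qed

lemma coeff_measurable: "\<psi> n \<in> borel_measurable (lebesgue_on J)"
  by (rule powser_coeff_measurable[where f = f]) (use series sol_measurable[OF sol] in auto)

lemma coeff_bound': "t \<in> J \<Longrightarrow> \<bar>\<psi> n t * u t * r t\<bar> \<le> C * \<bar>u t * v t * r t\<bar>"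
  using mult_right_mono[OF bound[of t n], of "\<bar>u t * r t\<bar>"] by (simp add: abs_mult ac_simps)

lemma coeff_integrable: "set_integrable lebesgue J (\<lambda>t. \<psi> n t * u t * r t)"
proof (rule set_integrable_dominated)
  note [measurable] = coeff_measurable r_measurable sol_measurable[OF u_sol]
  show "(\<lambda>t. \<psi> n t * u t * r t) \<in> borel_measurable (lebesgue_on J)" by measurable
qed (rule coeff_bound')

text \<open>Uniformity in \<open>n\<close> is the point: the bound is the majorant for termwise
  integration against \<open>\<sigma>\<close>.\<close>

lemma coeff_wronskian_bound:
  assumes "x \<le> c"
  shows "\<bar>coeff_wronskian e \<psi> n x\<bar> \<le> \<bar>e\<bar> + C"
proof (cases n)
  case (Suc m)
  have "\<bar>LINT t:left_ray a x|lebesgue. \<psi> m t * u t * r t\<bar>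
      \<le> C * M x"
    by (rule left_ray_integral_bound) (use coeff_bound' assms C_nonneg in auto)
  also have "\<dots> \<le> C * 1"
    using M_le[OF assms] C_nonneg by (intro mult_left_mono) auto
  finally show ?thesis using Suc by (simp add: coeff_wronskian_def)
qed (use C_nonneg in \<open>simp add: coeff_wronskian_def\<close>)

lemma coeff_wronskian_continuous:
  assumes "x \<in> J" "y \<le> c"
  shows "continuous_on {x..y} (coeff_wronskian e \<psi> n)"
proof (cases n)
  case (Suc m)
  then show ?thesis
    using continuous_on_left_ray_integral[OF coeff_integrable[of m] assms]
    by (simp add: coeff_wronskian_def[abs_def])
qed (simp add: coeff_wronskian_def[abs_def])

lemma coeff_wronskian_\<sigma>_integrable:
  assumes "x \<in> J" "x \<le> y" "y \<le> c"
  shows "set_integrable lebesgue {x..y} (\<lambda>t. coeff_wronskian e \<psi> n t * \<sigma> t)"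
  by (intro set_integrable_continuous_mult coeff_wronskian_continuous \<sigma>_integrable assms)

lemma solution_integrable:
  assumes z: "\<bar>z\<bar> < 1"
  shows "set_integrable lebesgue J (\<lambda>t. f z t * u t * r t)"
proof (rule set_integrable_dominated)
  note [measurable] = r_measurable sol_measurable[OF u_sol] sol_measurable[OF sol[OF z]]
  show "(\<lambda>t. f z t * u t * r t) \<in> borel_measurable (lebesgue_on J)" by measurable
  fix t assume t: "t \<in> J"
  have "(\<lambda>n. C * \<bar>v t\<bar> * \<bar>z\<bar> ^ n) sums (C * \<bar>v t\<bar> * (1 / (1 - \<bar>z\<bar>)))"
    by (intro sums_mult geometric_sums) (use z in simp)
  then have "norm (f z t) \<le> C * \<bar>v t\<bar> * (1 / (1 - \<bar>z\<bar>))"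
    by (rule norm_sums_le[OF series[OF z t]])
       (use bound[OF t] in \<open>auto simp: abs_mult power_abs intro!: mult_right_mono\<close>)
  then have "\<bar>f z t\<bar> * \<bar>u t * r t\<bar> \<le> C * \<bar>v t\<bar> * (1 / (1 - \<bar>z\<bar>)) * \<bar>u t * r t\<bar>"
    by (intro mult_right_mono) auto
  then show "\<bar>f z t * u t * r t\<bar> \<le> C / (1 - \<bar>z\<bar>) * \<bar>u t * v t * r t\<bar>"
    by (simp add: abs_mult ac_simps)
qed

lemma wronskian_abs_cont:
  assumes z: "\<bar>z\<bar> < 1" and "x \<in> J" "x \<le> y" "y \<le> c"
  shows "abs_cont_on x y (\<lambda>x. f z x * u1 x - f1 z x * u x)"
  by (intro abs_cont_on_diff abs_cont_on_mult sol_abs_cont[OF u_sol] sol_abs_cont[OF sol[OF z]] assms)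

lemma quotient_AE:
  assumes z: "\<bar>z\<bar> < 1"
  shows "AE x in lebesgue. x \<in> J \<longrightarrow> ((\<lambda>x. f z x / u x) has_vector_derivative
    (- \<sigma> x) *\<^sub>R (f z x * u1 x - f1 z x * u x)) (at x)"
  using sol_quotient_AE[OF sol[OF z] u_sol]
  by eventually_elim (use u_nz in \<open>auto simp: \<sigma>_def\<close>)

text \<open>The equation determines \<open>w - z A\<close> only up to a constant \<open>wa\<close>.
  Since \<open>A\<close> vanishes at \<open>a\<close>, \<open>w\<close> tends to \<open>wa\<close>;
  l'Hospital's rule then makes \<open>wa\<close> the limit of \<open>f/v\<close>, which is
  \<open>e\<close>.\<close>

lemma wronskian_eq:
  assumes z: "\<bar>z\<bar> < 1" and x: "x \<in> J"
  shows "f z x * u1 x - f1 z x * u x = e + z * (LINT t:left_ray a x|lebesgue. f z t * u t * r t)"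
proof -
  define w where "w x = f z x * u1 x - f1 z x * u x" for x
  define A where "A x = (LINT t:left_ray a x|lebesgue. f z t * u t * r t)" for x
  note fi = solution_integrable[OF z]
  have diff: "w y - w x = z * (A y - A x)" if xy: "x \<in> J" "x \<le> y" "y \<le> c" for x y
  proof -
    note fi' = set_integrable_left_ray[OF fi xy(3)]
    have "(LINT t:{x..y}|lebesgue. z * (f z t * u t * r t)) = w y - w x"
    proof (rule abs_cont_on_lebesgue_integral)
      show "abs_cont_on x y w" unfolding w_def by (rule wronskian_abs_cont[OF z xy])
      show "set_integrable lebesgue {x..y} (\<lambda>t. z * (f z t * u t * r t))"
        by (intro set_integrable_mult_right left_ray_integral_split(1)[OF fi']) (use xy in auto)
      show "AE t in lebesgue. t \<in> {x..y} \<longrightarrow> (w has_vector_derivative z * (f z t * u t * r t)) (at t)"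
        using sol_AE[OF u_sol] sol_AE[OF sol[OF z]]
      proof eventually_elim
        case (elim t)
        show ?case
        proof
          assume "t \<in> {x..y}"
          then have t: "t \<in> J" using interval_subset_J[OF xy(1,3)] by blast
          \<comment> \<open>The terms with \<open>1/p\<close> and with \<open>q\<close> cancel, and
            of the two spectral terms only the difference \<open>z\<close> survives.\<close>
          have "(w has_vector_derivative
              (f z t * (q t *\<^sub>R u t - r t *\<^sub>R (lam * u t)) + ((1 / p t) *\<^sub>R f1 z t) * u1 t) -
              (f1 z t * ((1 / p t) *\<^sub>R u1 t) + (q t *\<^sub>R f z t - r t *\<^sub>R ((lam + z) * f z t)) * u t)) (at t)"
            unfolding w_def using elim t
            by (intro has_vector_derivative_diff has_vector_derivative_mult) auto
          then show "(w has_vector_derivative z * (f z t * u t * r t)) (at t)"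
            by (rule has_vector_derivative_eq_rhs) (simp add: algebra_simps)
        qed
      qed
    qed (use xy in auto)
    moreover have "A y = A x + (LINT t:{x..y}|lebesgue. f z t * u t * r t)"
      unfolding A_def by (rule left_ray_integral_split(2)[OF fi']) (use xy in auto)
    ultimately show ?thesis by simp
  qed
  define wa where "wa = w c - z * A c"
  have w: "w x = wa + z * A x" if "x \<in> J" for x
    using diff[of x c] that by (simp add: wa_def algebra_simps)
  have "(A \<longlongrightarrow> 0) F"
    unfolding A_def by (rule tendsto_left_ray_integral[OF a_less_c fi])
  then have "((\<lambda>x. wa + z * A x) \<longlongrightarrow> wa + z * 0) F"
    by (intro tendsto_intros)
  moreover have "\<forall>\<^sub>F x in F. wa + z * A x = w x"
    using eventually_F_J by eventually_elim (use w in simp)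
  ultimately have "(w \<longlongrightarrow> wa) F"
    using Lim_transform_eventually by force
  then have "((\<lambda>x. inverse (s x) *\<^sub>R (f z x / u x)) \<longlongrightarrow> wa) F"
  proof (rule lhopital[OF s_top, rotated 2])
    show "AE x in lebesgue. x \<in> J \<longrightarrow> ((\<lambda>x. f z x / u x) has_vector_derivative (- \<sigma> x) *\<^sub>R w x) (at x)"
      unfolding w_def by (rule quotient_AE[OF z])
    show "abs_cont_on x c (\<lambda>x. f z x / u x)" if "x \<in> J" for x
      by (intro abs_cont_on_divide sol_abs_cont[OF u_sol] sol_abs_cont[OF sol[OF z]])
         (use that u_nz interval_subset_J[OF that, of c] in auto)
  qed
  then have "((\<lambda>x. f z x / v x) \<longlongrightarrow> wa) F"
  proof (rule Lim_transform_eventually)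
    show "\<forall>\<^sub>F x in F. inverse (s x) *\<^sub>R (f z x / u x) = f z x / v x"
      using eventually_F_J by eventually_elim (use u_nz in \<open>auto simp: s_def divide_simps\<close>)
  qed
  then have "wa = e" using lim[OF z] tendsto_unique[OF F_neq_bot] by blast
  then show ?thesis using w[OF x] by (simp add: w_def A_def)
qed

text \<open>Both sides are the coefficients of one identity in real \<open>z\<close>, the integrated
  derivative of \<open>f/u\<close>, and the coefficients of a power series are unique. Termwise
  integration is used twice: from \<open>a\<close> inside the Wronskian, and then over
  \<open>[x, y]\<close>.\<close>

lemma coeff_increment:
  assumes xy: "x \<in> J" "x \<le> y" "y \<le> c"
  shows "\<psi> n x / u x - \<psi> n y / u y = (LINT t:{x..y}|lebesgue. coeff_wronskian e \<psi> n t * \<sigma> t)"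
proof -
  have sub: "{x..y} \<subseteq> J" by (rule interval_subset_J[OF xy(1,3)])
  have yJ: "y \<in> J" using sub xy by auto
  have "\<psi> n x / u x - \<psi> n y / u y - (LINT t:{x..y}|lebesgue. coeff_wronskian e \<psi> n t * \<sigma> t) = 0"
  proof (rule powser_zero_imp_coeff_zero[of "\<lambda>n. \<psi> n x / u x - \<psi> n y / u y -
        (LINT t:{x..y}|lebesgue. coeff_wronskian e \<psi> n t * \<sigma> t)"])
    fix z :: real assume "norm z < 1"
    then have z: "\<bar>z\<bar> < 1" by simp
    define w where "w x = f z x * u1 x - f1 z x * u x" for x
    have ws: "(\<lambda>n. coeff_wronskian e \<psi> n t * z ^ n) sums w t" if t: "t \<in> J" for t
    proof -
      have tc: "t \<le> c" using t by simp
      have "(\<lambda>n. (LINT t':left_ray a t|lebesgue. \<psi> n t' * u t' * r t') * z ^ n)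
          sums (LINT t':left_ray a t|lebesgue. f z t' * u t' * r t')"
      proof (rule set_integral_powser_sums[where G = "\<lambda>t. C * \<bar>u t * v t * r t\<bar>"])
        show "(\<lambda>n. \<psi> n t' * u t' * r t' * z ^ n) sums (f z t' * u t' * r t')" if "t' \<in> left_ray a t" for t'
          using sums_mult2[OF series[OF z, of t'], of "u t' * r t'"] that tc by (simp add: ac_simps)
        show "\<bar>\<psi> n t' * u t' * r t'\<bar> \<le> C * \<bar>u t' * v t' * r t'\<bar>" if "t' \<in> left_ray a t" for n t'
          by (rule coeff_bound') (use that tc in auto)
        show "set_integrable lebesgue (left_ray a t) (\<lambda>t. \<psi> n t * u t * r t)" for n
          by (rule set_integrable_left_ray[OF coeff_integrable tc])
        show "set_integrable lebesgue (left_ray a t) (\<lambda>t. C * \<bar>u t * v t * r t\<bar>)"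
          by (intro set_integrable_left_ray[OF _ tc] set_integrable_mult_right set_integrable_abs uvr_integrable)
      qed (rule z)
      then have "(\<lambda>n. z * ((LINT t':left_ray a t|lebesgue. \<psi> n t' * u t' * r t') * z ^ n))
          sums (z * (LINT t':left_ray a t|lebesgue. f z t' * u t' * r t'))"
        by (rule sums_mult)
      \<comment> \<open>The factor \<open>z\<close> in \<open>W(f, u)' = z r f u\<close> shifts the
        index: \<open>\<psi> n\<close> feeds the Wronskian coefficient of order
        \<open>n + 1\<close>, and order zero holds the constant \<open>e\<close>.\<close>
      then have "(\<lambda>n. coeff_wronskian e \<psi> (Suc n) t * z ^ Suc n)
          sums (z * (LINT t':left_ray a t|lebesgue. f z t' * u t' * r t'))"
        by (simp add: coeff_wronskian_def mult.left_commute)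
      then have "(\<lambda>n. coeff_wronskian e \<psi> n t * z ^ n)
          sums (z * (LINT t':left_ray a t|lebesgue. f z t' * u t' * r t') + coeff_wronskian e \<psi> 0 t * z ^ 0)"
        by (rule sums_Suc)
      then show ?thesis
        using wronskian_eq[OF z t] by (simp add: w_def coeff_wronskian_def add.commute)
    qed
    have "(\<lambda>n. (LINT t:{x..y}|lebesgue. coeff_wronskian e \<psi> n t * \<sigma> t) * z ^ n)
        sums (LINT t:{x..y}|lebesgue. w t * \<sigma> t)"
    proof (rule set_integral_powser_sums[where G = "\<lambda>t. (\<bar>e\<bar> + C) * \<bar>\<sigma> t\<bar>"])
      show "\<bar>coeff_wronskian e \<psi> n t * \<sigma> t\<bar> \<le> (\<bar>e\<bar> + C) * \<bar>\<sigma> t\<bar>" if "t \<in> {x..y}" for n t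
        using coeff_wronskian_bound[of t n] that xy by (auto simp: abs_mult intro!: mult_right_mono)
      show "(\<lambda>n. coeff_wronskian e \<psi> n t * \<sigma> t * z ^ n) sums (w t * \<sigma> t)" if "t \<in> {x..y}" for t
        using sums_mult2[OF ws, of t "\<sigma> t"] that sub by (auto simp: ac_simps)
      show "set_integrable lebesgue {x..y} (\<lambda>t. coeff_wronskian e \<psi> n t * \<sigma> t)" for n
        by (rule coeff_wronskian_\<sigma>_integrable[OF xy])
      show "set_integrable lebesgue {x..y} (\<lambda>t. (\<bar>e\<bar> + C) * \<bar>\<sigma> t\<bar>)"
        by (intro set_integrable_mult_right set_integrable_abs \<sigma>_integrable xy)
    qed (rule z)
    moreover have "(LINT t:{x..y}|lebesgue. (- \<sigma> t) *\<^sub>R w t) = f z y / u y - f z x / u x"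
    proof (rule abs_cont_on_lebesgue_integral[OF _ xy(2)])
      show "abs_cont_on x y (\<lambda>x. f z x / u x)"
        by (intro abs_cont_on_divide sol_abs_cont[OF u_sol] sol_abs_cont[OF sol[OF z]] xy)
           (use u_nz sub in auto)
      show "AE t in lebesgue. t \<in> {x..y} \<longrightarrow> ((\<lambda>x. f z x / u x) has_vector_derivative (- \<sigma> t) *\<^sub>R w t) (at t)"
        using quotient_AE[OF z] unfolding w_def by eventually_elim (use sub in blast)
      have "set_integrable lebesgue {x..y} (\<lambda>t. w t * \<sigma> t)"
        unfolding w_def
        by (intro set_integrable_continuous_mult \<sigma>_integrable xy abs_cont_on_imp_continuous_on
            wronskian_abs_cont z)
      then show "set_integrable lebesgue {x..y} (\<lambda>t. (- \<sigma> t) *\<^sub>R w t)"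
        by (simp add: set_integrable_def mult.commute)
    qed
    then have "(LINT t:{x..y}|lebesgue. w t * \<sigma> t) = f z x / u x - f z y / u y"
      by (simp add: set_lebesgue_integral_def mult.commute)
    moreover have "(\<lambda>n. (\<psi> n x / u x - \<psi> n y / u y) * z ^ n) sums (f z x / u x - f z y / u y)"
      using sums_diff[OF sums_divide[OF series[OF z xy(1)], of "u x"] sums_divide[OF series[OF z yJ], of "u y"]]
      by (simp add: left_diff_distrib)
    ultimately have "(\<lambda>n. (\<psi> n x / u x - \<psi> n y / u y) * z ^ n -
        (LINT t:{x..y}|lebesgue. coeff_wronskian e \<psi> n t * \<sigma> t) * z ^ n)
        sums (f z x / u x - f z y / u y - (f z x / u x - f z y / u y))"
      by (intro sums_diff) simp_all
    then show "(\<lambda>n. (\<psi> n x / u x - \<psi> n y / u y -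
        (LINT t:{x..y}|lebesgue. coeff_wronskian e \<psi> n t * \<sigma> t)) * z ^ n) sums 0"
      by (simp only: left_diff_distrib diff_self)
  qed
  then show ?thesis by simp
qed

end

end

section \<open>Construction (C) and the second solution\<close>

text \<open>For real \<open>z\<close> the equation has real coefficients, so the real-linear map
  \<open>y \<mapsto> Re (k * y)\<close> sends solutions to solutions. This passes from the complex
  families to real ones.\<close>

lemma SL_sol_Re_mult:
  fixes k :: complex
  assumes "SL_sol a b p q r (complex_of_real z) f f1"
  shows "SL_sol a b p q r z (\<lambda>x. Re (k * f x)) (\<lambda>x. Re (k * f1 x))"
proof -
  have T: "bounded_linear (\<lambda>y. Re (k * y))"
    by (rule bounded_linear_compose[OF bounded_linear_Re bounded_linear_mult_right])
  note A = assms[unfolded SL_sol_def]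
  show ?thesis
    unfolding SL_sol_def
  proof (intro conjI)
    show "AC_loc (SL_int a b) (\<lambda>x. Re (k * f x))" "AC_loc (SL_int a b) (\<lambda>x. Re (k * f1 x))"
      using A abs_cont_on_bounded_linear[OF T] unfolding AC_loc_def by blast+
    have "AE x in lebesgue. x \<in> SL_int a b \<longrightarrow> (\<exists>D. (f has_vector_derivative D) (at x) \<and> f1 x = p x *\<^sub>R D)"
      using A by blast
    then show "AE x in lebesgue. x \<in> SL_int a b \<longrightarrow>
        (\<exists>D. ((\<lambda>x. Re (k * f x)) has_vector_derivative D) (at x) \<and> Re (k * f1 x) = p x *\<^sub>R D)"
    proof eventually_elim
      case (elim x)
      show ?case
      proof
        assume "x \<in> SL_int a b"
        then obtain D where D: "(f has_vector_derivative D) (at x)" "f1 x = p x *\<^sub>R D" using elim by blast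
        then have "Re (k * f1 x) = p x *\<^sub>R Re (k * D)" by simp
        then show "\<exists>D. ((\<lambda>x. Re (k * f x)) has_vector_derivative D) (at x) \<and> Re (k * f1 x) = p x *\<^sub>R D"
          using bounded_linear.has_vector_derivative[OF T D(1)] by blast
      qed
    qed
    have "AE x in lebesgue. x \<in> SL_int a b \<longrightarrow> (\<exists>D. (f1 has_vector_derivative D) (at x) \<and>
        (1 / r x) *\<^sub>R (- D + q x *\<^sub>R f x) = of_real z * f x)"
      using A by blast
    then show "AE x in lebesgue. x \<in> SL_int a b \<longrightarrow>
        (\<exists>D. ((\<lambda>x. Re (k * f1 x)) has_vector_derivative D) (at x) \<and>
          (1 / r x) *\<^sub>R (- D + q x *\<^sub>R Re (k * f x)) = z * Re (k * f x))"
    proof eventually_elim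
      case (elim x)
      show ?case
      proof
        assume "x \<in> SL_int a b"
        then obtain D where D: "(f1 has_vector_derivative D) (at x)"
          "(1 / r x) *\<^sub>R (- D + q x *\<^sub>R f x) = of_real z * f x" using elim by blast
        have "(1 / r x) *\<^sub>R (- Re (k * D) + q x *\<^sub>R Re (k * f x))
            = Re (k * ((1 / r x) *\<^sub>R (- D + q x *\<^sub>R f x)))"
          by (simp add: scaleR_conv_of_real algebra_simps diff_divide_distrib add_divide_distrib)
        also have "\<dots> = z * Re (k * f x)"
          unfolding D(2) by (simp add: algebra_simps)
        finally show "\<exists>D. ((\<lambda>x. Re (k * f1 x)) has_vector_derivative D) (at x) \<and>
            (1 / r x) *\<^sub>R (- D + q x *\<^sub>R Re (k * f x)) = z * Re (k * f x)"
          using bounded_linear.has_vector_derivative[OF T D(1)] by blast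
      qed
    qed
  qed
qed

lemma Re_mult_powser_sums:
  fixes k y :: complex
  assumes "(\<lambda>n. w n * complex_of_real z ^ n) sums y"
  shows "(\<lambda>n. Re (k * w n) * z ^ n) sums Re (k * y)"
  using sums_Re[OF sums_mult[OF assms, of k]]
  by (simp flip: of_real_power mult.assoc)

context SL_end
begin

abbreviation \<phi> :: "nat \<Rightarrow> real \<Rightarrow> real" where "\<phi> \<equiv> phiC_coeff a r u v"

text \<open>The kernel equals \<open>u t * u x * (s x - s t)\<close>, and
  \<open>0 \<le> s x \<le> s t\<close> bounds it by \<open>|u x| * |v t|\<close>. Together with the
  factor \<open>|u t|\<close> from the induction hypothesis, each iteration contributes one integral
  of \<open>|u v r|\<close>.\<close>

lemma phi_coeff_bound: "x \<in> J \<Longrightarrow> \<bar>\<phi> n x\<bar> \<le> M x ^ n * \<bar>u x\<bar>"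
proof (induction n arbitrary: x)
  case (Suc n)
  then have x: "a < ereal x" "x \<le> c" by auto
  have "\<bar>(u t * v x - v t * u x) * \<phi> n t * r t\<bar> \<le> (M x ^ n * \<bar>u x\<bar>) * \<bar>u t * v t * r t\<bar>"
    if t: "t \<in> left_ray a x" for t
  proof -
    have tJ: "t \<in> J" using t x by auto
    have st: "0 \<le> s x" "s x \<le> s t" using s_ge_1[of x] s_antimono[of t x] tJ x t by auto
    have "u t * v x - v t * u x = u t * u x * (s x - s t)"
      using v_eq[OF tJ] v_eq[OF Suc.prems] by (simp add: algebra_simps)
    then have "\<bar>u t * v x - v t * u x\<bar> = \<bar>u t * u x\<bar> * (s t - s x)"
      using st by (simp add: abs_mult)
    also have "\<dots> \<le> \<bar>u t * u x\<bar> * s t" using st by (intro mult_left_mono) auto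
    also have "\<dots> = \<bar>u x\<bar> * \<bar>v t\<bar>" using st v_eq[OF tJ] by (simp add: abs_mult)
    finally have 1: "\<bar>u t * v x - v t * u x\<bar> \<le> \<bar>u x\<bar> * \<bar>v t\<bar>" .
    have "\<bar>\<phi> n t\<bar> \<le> M t ^ n * \<bar>u t\<bar>" by (rule Suc.IH[OF tJ])
    also have "\<dots> \<le> M x ^ n * \<bar>u t\<bar>"
      using t x by (intro mult_right_mono power_mono M_mono M_nonneg) auto
    finally have 2: "\<bar>\<phi> n t\<bar> \<le> M x ^ n * \<bar>u t\<bar>" .
    have "\<bar>u t * v x - v t * u x\<bar> * \<bar>\<phi> n t\<bar> * \<bar>r t\<bar> \<le> (\<bar>u x\<bar> * \<bar>v t\<bar>) * (M x ^ n * \<bar>u t\<bar>) * \<bar>r t\<bar>"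
      by (intro mult_right_mono mult_mono 1 2) auto
    then show ?thesis by (simp add: abs_mult ac_simps)
  qed
  then have "\<bar>LINT t:left_ray a x|lebesgue. (u t * v x - v t * u x) * \<phi> n t * r t\<bar> \<le> (M x ^ n * \<bar>u x\<bar>) * M x"
    by (rule left_ray_integral_bound) (use x M_nonneg in auto)
  then show ?case by (simp add: left_ray_def ac_simps)
qed simp

lemma phi_coeff_quotient_tendsto:
  assumes "n > 0"
  shows "((\<lambda>x. \<phi> n x / u x) \<longlongrightarrow> 0) F"
proof (rule Lim_null_comparison)
  show "\<forall>\<^sub>F x in F. norm (\<phi> n x / u x) \<le> M x ^ n"
    using eventually_F_J
  proof eventually_elim
    case (elim x)
    then show ?case using phi_coeff_bound[of x n] u_nz[of x] by (simp add: divide_le_eq)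
  qed
  show "((\<lambda>x. M x ^ n) \<longlongrightarrow> 0) F"
    using tendsto_power[OF M_tendsto, of n] unfolding zero_power[OF assms] .
qed

section \<open>Construction (C) on the closed unit disc around \<open>lam\<close>\<close>

context
  fixes z :: complex
  assumes z: "norm (z - of_real lam) \<le> 1"
begin

lemma phi_term_bound:
  assumes "x \<in> J"
  shows "norm (of_real (\<phi> n x) * (z - of_real lam) ^ n) \<le> \<bar>u x\<bar> * M x ^ n"
proof -
  have "norm (z - of_real lam) ^ n \<le> 1" using z by (simp add: power_le_one)
  then have "\<bar>\<phi> n x\<bar> * norm (z - of_real lam) ^ n \<le> (M x ^ n * \<bar>u x\<bar>) * 1"
    by (intro mult_mono phi_coeff_bound assms mult_nonneg_nonneg zero_le_power M_nonneg) auto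
  then show ?thesis by (simp add: norm_mult norm_power mult.commute)
qed

lemma phiC_sums:
  assumes "x \<in> J"
  shows "(\<lambda>n. of_real (\<phi> n x) * (z - of_real lam) ^ n) sums phiC a r u v lam z x"
  unfolding phiC_def
proof (rule summable_sums, rule summable_comparison_test')
  show "summable (\<lambda>n. \<bar>u x\<bar> * M x ^ n)"
    using M_le[of x] M_nonneg[of x] assms by (intro summable_mult summable_geometric) auto
  show "norm (of_real (\<phi> n x) * (z - of_real lam) ^ n) \<le> \<bar>u x\<bar> * M x ^ n" for n
    by (rule phi_term_bound[OF assms])
qed

lemma phiC_near_u:
  assumes x: "x \<in> J"
  shows "norm (phiC a r u v lam z x / of_real (u x) - 1) \<le> 2 * M x"
proof -
  have Mx: "0 \<le> M x" "M x \<le> 1 / 4" using M_nonneg M_le x by auto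
  have "(\<lambda>n. of_real (\<phi> (Suc n) x) * (z - of_real lam) ^ Suc n) sums (phiC a r u v lam z x - of_real (u x))"
    by (subst sums_Suc_iff) (use phiC_sums[OF x] in simp)
  moreover have "(\<lambda>n. \<bar>u x\<bar> * M x * M x ^ n) sums (\<bar>u x\<bar> * M x * (1 / (1 - M x)))"
    using Mx by (intro sums_mult geometric_sums) auto
  ultimately have "norm (phiC a r u v lam z x - of_real (u x)) \<le> \<bar>u x\<bar> * M x * (1 / (1 - M x))"
  proof (rule norm_sums_le)
    show "norm (of_real (\<phi> (Suc n) x) * (z - of_real lam) ^ Suc n) \<le> \<bar>u x\<bar> * M x * M x ^ n" for n
      using phi_term_bound[OF x, of "Suc n"] by (simp only: power_Suc mult.assoc)
  qed
  \<comment> \<open>\<open>1 / (1 - M x)\<close> is at most 4/3 because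
    \<open>M x \<le> 1/4\<close>; 2 is a convenient bound.\<close>
  also have "\<dots> \<le> \<bar>u x\<bar> * M x * 2"
    using Mx by (intro mult_left_mono mult_nonneg_nonneg) (auto simp: field_simps)
  finally have "norm (phiC a r u v lam z x - of_real (u x)) / \<bar>u x\<bar> \<le> 2 * M x"
    using u_nz[of x] x by (simp add: divide_le_eq ac_simps)
  moreover have "phiC a r u v lam z x / of_real (u x) - 1 = (phiC a r u v lam z x - of_real (u x)) / of_real (u x)"
    using u_nz[of x] x by (simp add: field_simps)
  ultimately show ?thesis by (simp add: norm_divide)
qed

lemma phiC_quotient_tendsto: "((\<lambda>x. phiC a r u v lam z x / of_real (u x)) \<longlongrightarrow> 1) F"
proof (rule LIM_zero_cancel, rule Lim_null_comparison)
  show "\<forall>\<^sub>F x in F. norm (phiC a r u v lam z x / of_real (u x) - 1) \<le> 2 * M x"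
    using eventually_F_J by eventually_elim (rule phiC_near_u)
  show "((\<lambda>x. 2 * M x) \<longlongrightarrow> 0) F"
    using tendsto_mult[OF tendsto_const[of 2] M_tendsto] by simp
qed

text \<open>From \<open>2 * M x \<le> 1/2\<close>. The lower bound excludes zeros for nonreal
  \<open>z\<close> too, so quotients by \<open>phi(z, .)\<close> make sense on all of
  \<open>J\<close>.\<close>

lemma phiC_bounds:
  assumes x: "x \<in> J"
  shows "\<bar>u x\<bar> / 2 \<le> norm (phiC a r u v lam z x)" "norm (phiC a r u v lam z x) \<le> 2 * \<bar>u x\<bar>"
proof -
  let ?h = "phiC a r u v lam z x / of_real (u x)"
  have h: "norm (?h - 1) \<le> 1 / 2" using phiC_near_u[OF x] M_le[of x] x by force
  have "1 / 2 \<le> norm ?h" "norm ?h \<le> 2"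
    using h norm_triangle_ineq2[of 1 ?h] norm_triangle_ineq2[of ?h 1] by (auto simp: norm_minus_commute)
  moreover have "norm (phiC a r u v lam z x) = norm ?h * \<bar>u x\<bar>"
    using u_nz[of x] x by (simp add: norm_divide)
  ultimately show "\<bar>u x\<bar> / 2 \<le> norm (phiC a r u v lam z x)" "norm (phiC a r u v lam z x) \<le> 2 * \<bar>u x\<bar>"
    using mult_right_mono[of "1 / 2" "norm ?h" "\<bar>u x\<bar>"] mult_right_mono[of "norm ?h" 2 "\<bar>u x\<bar>"] by auto
qed

section \<open>The second solution at a fixed spectral parameter\<close>

context
  fixes \<kappa> :: complex and f f1 g g1 :: "real \<Rightarrow> complex"
  assumes \<kappa>: "\<kappa> \<noteq> 0"
    and f_eq: "\<And>x. x \<in> SL_int a b \<Longrightarrow> f x = \<kappa> * phiC a r u v lam z x"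
    and f_sol: "SL_sol a b p q r z f f1" and g_sol: "SL_sol a b p q r z g g1"
    and W: "\<And>x. x \<in> SL_int a b \<Longrightarrow> g x * f1 x - g1 x * f x = 1"
begin

lemma f_nz: "x \<in> J \<Longrightarrow> f x \<noteq> 0"
  using f_eq[of x] phiC_bounds(1)[of x] u_nz[of x] \<kappa> J_subset_SL_int by auto

lemma ratio_abs_cont: "x \<in> J \<Longrightarrow> abs_cont_on x c (\<lambda>x. g x / f x)"
  by (intro abs_cont_on_divide sol_abs_cont[OF f_sol] sol_abs_cont[OF g_sol])
     (use f_nz interval_subset_J[of x c] in auto)

text \<open>\<open>1/(p f^2)\<close> is written as \<open>\<sigma>\<close> times
  \<open>(u/f)^2\<close>, which makes \<open>g/f\<close> comparable with \<open>s\<close>.\<close>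

lemma ratio_AE: "AE x in lebesgue. x \<in> J \<longrightarrow>
    ((\<lambda>x. g x / f x) has_vector_derivative (- \<sigma> x) *\<^sub>R (of_real (u x) / f x)\<^sup>2) (at x)"
  using sol_quotient_AE[OF g_sol f_sol]
proof eventually_elim
  case (elim x)
  show ?case
  proof
    assume x: "x \<in> J"
    then have "((\<lambda>x. g x / f x) has_vector_derivative - ((1 / p x) *\<^sub>R (1 / (f x)\<^sup>2))) (at x)"
      using elim f_nz W[of x] J_subset_SL_int by auto
    moreover have "- ((1 / p x) *\<^sub>R (1 / (f x)\<^sup>2)) = (- \<sigma> x) *\<^sub>R (of_real (u x) / f x)\<^sup>2"
      using u_nz[of x] x by (simp add: \<sigma>_def scaleR_conv_of_real power_divide)
    ultimately show "((\<lambda>x. g x / f x) has_vector_derivative (- \<sigma> x) *\<^sub>R (of_real (u x) / f x)\<^sup>2) (at x)"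
      by simp
  qed
qed

text \<open>Since \<open>f/u\<close> tends to \<open>\<kappa>\<close>, l'Hospital's rule gives the
  limit \<open>\<kappa>^(-2)\<close> for \<open>g/(f s)\<close>. Multiplying by \<open>f/u\<close>
  and by \<open>\<kappa>\<close> leaves 1.\<close>

lemma second_solution_tendsto: "((\<lambda>x. \<kappa> * g x / of_real (v x)) \<longlongrightarrow> 1) F"
proof -
  have h: "((\<lambda>x. f x / of_real (u x)) \<longlongrightarrow> \<kappa>) F"
  proof (rule Lim_transform_eventually)
    show "((\<lambda>x. \<kappa> * (phiC a r u v lam z x / of_real (u x))) \<longlongrightarrow> \<kappa>) F"
      using tendsto_mult[OF tendsto_const[of \<kappa>] phiC_quotient_tendsto] by simp
    show "\<forall>\<^sub>F x in F. \<kappa> * (phiC a r u v lam z x / of_real (u x)) = f x / of_real (u x)"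
      using eventually_F_J by eventually_elim (use f_eq J_subset_SL_int in auto)
  qed
  have "((\<lambda>x. (inverse (f x / of_real (u x)))\<^sup>2) \<longlongrightarrow> (inverse \<kappa>)\<^sup>2) F"
    by (intro tendsto_intros h \<kappa>)
  then have "((\<lambda>x. (of_real (u x) / f x)\<^sup>2) \<longlongrightarrow> (inverse \<kappa>)\<^sup>2) F" by simp
  from lhopital[OF s_top ratio_abs_cont ratio_AE this]
  have "((\<lambda>x. inverse (s x) *\<^sub>R (g x / f x)) \<longlongrightarrow> (inverse \<kappa>)\<^sup>2) F" by blast
  moreover have one: "\<kappa> * (\<kappa> * (inverse \<kappa>)\<^sup>2) = 1"
    using \<kappa> by (simp add: power2_eq_square field_simps)
  ultimately
  have "((\<lambda>x. \<kappa> * (f x / of_real (u x) * (inverse (s x) *\<^sub>R (g x / f x)))) \<longlongrightarrow> 1) F"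
    unfolding one[symmetric] by (intro tendsto_mult tendsto_const h)
  then show ?thesis
  proof (rule Lim_transform_eventually)
    show "\<forall>\<^sub>F x in F. \<kappa> * (f x / of_real (u x) * (inverse (s x) *\<^sub>R (g x / f x))) = \<kappa> * g x / of_real (v x)"
      using eventually_F_J
    proof eventually_elim
      case (elim x)
      then show ?case
        using f_nz[OF elim] u_nz[of x] v_eq[OF elim] by (simp add: scaleR_conv_of_real divide_simps)
    qed
  qed
qed

text \<open>The limit above is not uniform in the spectral parameter, but Cauchy's estimate needs
  uniformity on the circle. Here the parameter enters the bound only through
  \<open>g c\<close>.\<close>

lemma second_solution_bound:
  assumes x: "x \<in> J"
  shows "norm (g x) \<le> (4 * norm (g c) / \<bar>u c\<bar> + 8 / norm \<kappa>) * \<bar>v x\<bar>"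
proof -
  \<comment> \<open>Bounds \<open>(|u|/|f|)^2\<close>, because \<open>|f|\<close> is at least
    \<open>|\<kappa>| |u| / 2\<close>.\<close>
  define K where "K = 4 / (norm \<kappa>)\<^sup>2"
  have K: "K > 0" using \<kappa> by (simp add: K_def)
  have xc: "x \<le> c" and cJ: "c \<in> J" using x a_less_c by auto
  have f2: "norm (f t) \<ge> norm \<kappa> * (\<bar>u t\<bar> / 2)" "norm (f t) \<le> norm \<kappa> * (2 * \<bar>u t\<bar>)" if "t \<in> J" for t
  proof -
    have "norm (f t) = norm \<kappa> * norm (phiC a r u v lam z t)"
      using f_eq that J_subset_SL_int by (metis norm_mult subsetD)
    then show "norm (f t) \<ge> norm \<kappa> * (\<bar>u t\<bar> / 2)" "norm (f t) \<le> norm \<kappa> * (2 * \<bar>u t\<bar>)"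
      using mult_left_mono[OF phiC_bounds(1)[OF that], of "norm \<kappa>"]
        mult_left_mono[OF phiC_bounds(2)[OF that], of "norm \<kappa>"] by simp_all
  qed
  have "norm (g c / f c - g x / f x) \<le> (- K) * s c - (- K) * s x"
  proof (rule abs_cont_on_norm_increment_le[OF ratio_abs_cont[OF x] _ xc])
    show "abs_cont_on x c (\<lambda>x. - K * s x)"
      by (intro abs_cont_on_bounded_linear[OF bounded_linear_mult_right] s_abs_cont x xc order_refl)
    show "AE t in lebesgue. t \<in> {x..c} \<longrightarrow> (\<exists>D G. ((\<lambda>x. g x / f x) has_vector_derivative D) (at t) \<and>
        ((\<lambda>x. - K * s x) has_vector_derivative G) (at t) \<and> norm D \<le> G)"
      using ratio_AE s_AE
    proof eventually_elim
      case (elim t)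
      show ?case
      proof
        assume "t \<in> {x..c}"
        then have t: "t \<in> J" using interval_subset_J[OF x, of c] by auto
        have "\<bar>u t\<bar> / norm (f t) \<le> 2 / norm \<kappa>"
          using f2(1)[OF t] \<kappa> f_nz[OF t] by (simp add: field_simps)
        then have "(\<bar>u t\<bar> / norm (f t))\<^sup>2 \<le> (2 / norm \<kappa>)\<^sup>2"
          by (intro power_mono) auto
        then have "\<sigma> t * (\<bar>u t\<bar> / norm (f t))\<^sup>2 \<le> \<sigma> t * K"
          using elim t by (intro mult_left_mono) (auto simp: K_def power_divide)
        then have "norm ((- \<sigma> t) *\<^sub>R (of_real (u t) / f t)\<^sup>2) \<le> - K * - \<sigma> t"
          using elim t by (simp add: norm_power norm_divide mult.commute)
        moreover have "((\<lambda>x. - K * s x) has_vector_derivative - K * - \<sigma> t) (at t)"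
          using elim t by (intro has_vector_derivative_mult_right) auto
        ultimately show "\<exists>D G. ((\<lambda>x. g x / f x) has_vector_derivative D) (at t) \<and>
            ((\<lambda>x. - K * s x) has_vector_derivative G) (at t) \<and> norm D \<le> G"
          using elim t by blast
      qed
    qed
  qed
  then have "norm (g x / f x) \<le> norm (g c / f c) + K * (s x - s c)"
    using norm_triangle_ineq2[of "g x / f x" "g c / f c"] by (simp add: norm_minus_commute algebra_simps)
  \<comment> \<open>\<open>s x \<ge> 1\<close> absorbs the term at \<open>c\<close> into a multiple
    of \<open>s x\<close>, and \<open>s x * |u x|\<close> is \<open>|v x|\<close>.\<close>
  also have "\<dots> \<le> (2 * norm (g c) / (norm \<kappa> * \<bar>u c\<bar>)) * s x + K * s x"
  proof (rule add_mono)
    have "norm (g c / f c) \<le> 2 * norm (g c) / (norm \<kappa> * \<bar>u c\<bar>)"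
    proof -
      have "norm (g c) / norm (f c) \<le> norm (g c) / (norm \<kappa> * (\<bar>u c\<bar> / 2))"
        using f2(1)[OF cJ] \<kappa> u_nz[of c] a_less_c f_nz[OF cJ] by (intro divide_left_mono) auto
      then show ?thesis by (simp add: norm_divide mult.commute)
    qed
    also have "\<dots> \<le> (2 * norm (g c) / (norm \<kappa> * \<bar>u c\<bar>)) * s x"
      using s_ge_1[of x] x mult_left_mono[of 1 "s x" "2 * norm (g c) / (norm \<kappa> * \<bar>u c\<bar>)"] by simp
    finally show "norm (g c / f c) \<le> \<dots>" .
    show "K * (s x - s c) \<le> K * s x"
      using K s_ge_1[of c] a_less_c by (intro mult_left_mono) auto
  qed
  finally have 1: "norm (g x / f x) \<le> (2 * norm (g c) / (norm \<kappa> * \<bar>u c\<bar>) + K) * s x"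
    by (simp add: algebra_simps)
  have "norm (g x) = norm (g x / f x) * norm (f x)"
    using f_nz[OF x] by (simp add: norm_divide)
  also have "\<dots> \<le> ((2 * norm (g c) / (norm \<kappa> * \<bar>u c\<bar>) + K) * s x) * (norm \<kappa> * (2 * \<bar>u x\<bar>))"
    using s_ge_1[of x] x K by (intro mult_mono 1 f2 x) auto
  also have "\<dots> = (4 * norm (g c) / \<bar>u c\<bar> + 8 / norm \<kappa>) * \<bar>v x\<bar>"
    using s_ge_1[of x] x v_eq[OF x] \<kappa> u_nz[of c] a_less_c
    by (simp add: K_def abs_mult field_simps power2_eq_square)
  finally show ?thesis .
qed

end

end

end

section \<open>Order relations between the coefficients\<close>

context SL_end
begin

text \<open>For \<open>X = \<psi>/u\<close> the integrand \<open>\<psi> u r\<close> of the Wronskian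
  becomes \<open>X * \<mu>\<close>, with a weight that is positive almost everywhere.\<close>

definition \<mu> :: "real \<Rightarrow> real" where "\<mu> t = (u t)\<^sup>2 * r t"

text \<open>The integrated form of \<open>Z' = - W \<sigma>\<close>. Integrability is included so
  that the integral is never the default value 0.\<close>

definition primitive_rep :: "(real \<Rightarrow> real) \<Rightarrow> (real \<Rightarrow> real) \<Rightarrow> bool" where
  "primitive_rep W Z \<longleftrightarrow> (\<forall>x y. x \<in> J \<longrightarrow> x \<le> y \<longrightarrow> y \<le> c \<longrightarrow>
     set_integrable lebesgue {x..y} (\<lambda>t. W t * \<sigma> t) \<and> Z x - Z y = (LINT t:{x..y}|lebesgue. W t * \<sigma> t))"

definition moment :: "(real \<Rightarrow> real) \<Rightarrow> real \<Rightarrow> real" where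
  "moment X x = (LINT t:left_ray a x|lebesgue. X t * \<mu> t)"

definition moment_integrable :: "(real \<Rightarrow> real) \<Rightarrow> bool" where
  "moment_integrable X \<longleftrightarrow> set_integrable lebesgue J (\<lambda>t. X t * \<mu> t)"

lemma \<mu>_AE: "AE t in lebesgue. t \<in> J \<longrightarrow> 0 < \<mu> t"
  using sol_AE[OF u_sol] by eventually_elim (use u_nz in \<open>auto simp: \<mu>_def\<close>)

lemma eventually_F_below:
  assumes "eventually P F"
  obtains d where "d \<in> J" "\<And>x. x \<in> J \<Longrightarrow> x \<le> d \<Longrightarrow> P x"
  using assms unfolding eventually_F by blast

text \<open>\<open>X2\<close> stands without absolute value so that the bound integrates to a
  multiple of its own moment. \<open>K\<close> may be negative, which covers a negative
  \<open>X2\<close>.\<close>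

lemma moment_abs_le:
  assumes "moment_integrable X1" "moment_integrable X2" "d \<in> J"
    and le: "\<And>t. t \<in> J \<Longrightarrow> t \<le> d \<Longrightarrow> \<bar>X1 t\<bar> \<le> K * X2 t" and x: "x \<le> d"
  shows "\<bar>moment X1 x\<bar> \<le> K * moment X2 x"
proof -
  have xc: "x \<le> c" using assms by simp
  have i: "set_integrable lebesgue (left_ray a x) (\<lambda>t. X1 t * \<mu> t)"
      "set_integrable lebesgue (left_ray a x) (\<lambda>t. X2 t * \<mu> t)"
    using assms(1,2) xc by (auto simp: moment_integrable_def intro: set_integrable_left_ray)
  have i': "set_integrable lebesgue (left_ray a x) (\<lambda>t. K' * (X2 t * \<mu> t))" for K' :: real
    by (intro set_integrable_mult_right i)
  have "(LINT t:left_ray a x|lebesgue. X1 t * \<mu> t) \<le> (LINT t:left_ray a x|lebesgue. K * (X2 t * \<mu> t))"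
  proof (rule set_integral_mono_AE_on[OF i(1) i'])
    show "AE t in lebesgue. t \<in> left_ray a x \<longrightarrow> X1 t * \<mu> t \<le> K * (X2 t * \<mu> t)"
      using \<mu>_AE
    proof eventually_elim
      case (elim t)
      then show ?case
        using le[of t] x xc mult_right_mono[of "X1 t" "K * X2 t" "\<mu> t"] by (auto simp: mult.assoc)
    qed
  qed
  moreover have "(LINT t:left_ray a x|lebesgue. - K * (X2 t * \<mu> t)) \<le> (LINT t:left_ray a x|lebesgue. X1 t * \<mu> t)"
  proof (rule set_integral_mono_AE_on[OF i' i(1)])
    show "AE t in lebesgue. t \<in> left_ray a x \<longrightarrow> - K * (X2 t * \<mu> t) \<le> X1 t * \<mu> t"
      using \<mu>_AE
    proof eventually_elim
      case (elim t)
      then show ?case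
        using le[of t] x xc mult_right_mono[of "- (K * X2 t)" "X1 t" "\<mu> t"] by (auto simp: mult.assoc)
    qed
  qed
  ultimately show ?thesis unfolding moment_def set_integral_mult_right by (simp add: abs_le_iff)
qed

lemma primitive_rep_abs_le:
  assumes "primitive_rep W1 Z1" "primitive_rep W2 Z2" "d \<in> J"
    and le: "\<And>t. t \<in> J \<Longrightarrow> t \<le> d \<Longrightarrow> \<bar>W1 t\<bar> \<le> K * W2 t" and xy: "x \<in> J" "x \<le> y" "y \<le> d"
  shows "\<bar>Z1 x - Z1 y\<bar> \<le> K * (Z2 x - Z2 y)"
proof -
  have yc: "y \<le> c" using assms by simp
  have sub: "{x..y} \<subseteq> J" by (rule interval_subset_J[OF xy(1) yc])
  have i: "set_integrable lebesgue {x..y} (\<lambda>t. W1 t * \<sigma> t)" "set_integrable lebesgue {x..y} (\<lambda>t. W2 t * \<sigma> t)"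
    and eq: "Z1 x - Z1 y = (LINT t:{x..y}|lebesgue. W1 t * \<sigma> t)" "Z2 x - Z2 y = (LINT t:{x..y}|lebesgue. W2 t * \<sigma> t)"
    using assms(1,2) xy yc by (auto simp: primitive_rep_def)
  have i': "set_integrable lebesgue {x..y} (\<lambda>t. K' * (W2 t * \<sigma> t))" for K' :: real
    by (intro set_integrable_mult_right i)
  have "(LINT t:{x..y}|lebesgue. W1 t * \<sigma> t) \<le> (LINT t:{x..y}|lebesgue. K * (W2 t * \<sigma> t))"
  proof (rule set_integral_mono_AE_on[OF i(1) i'])
    show "AE t in lebesgue. t \<in> {x..y} \<longrightarrow> W1 t * \<sigma> t \<le> K * (W2 t * \<sigma> t)"
      using s_AE
    proof eventually_elim
      case (elim t)
      then show ?case
        using le[of t] xy sub mult_right_mono[of "W1 t" "K * W2 t" "\<sigma> t"] by (auto simp: mult.assoc)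
    qed
  qed
  moreover have "(LINT t:{x..y}|lebesgue. - K * (W2 t * \<sigma> t)) \<le> (LINT t:{x..y}|lebesgue. W1 t * \<sigma> t)"
  proof (rule set_integral_mono_AE_on[OF i' i(1)])
    show "AE t in lebesgue. t \<in> {x..y} \<longrightarrow> - K * (W2 t * \<sigma> t) \<le> W1 t * \<sigma> t"
      using s_AE
    proof eventually_elim
      case (elim t)
      then show ?case
        using le[of t] xy sub mult_right_mono[of "- (K * W2 t)" "W1 t" "\<sigma> t"] by (auto simp: mult.assoc)
    qed
  qed
  ultimately show ?thesis unfolding eq set_integral_mult_right by (simp add: abs_le_iff)
qed

text \<open>A weak inequality is enough here, since it survives integration; the sign
  \<open>k\<close> stays unspecified because it changes along the recursion.\<close>

definition eventually_signed :: "(real \<Rightarrow> real) \<Rightarrow> bool" where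
  "eventually_signed X \<longleftrightarrow> (\<exists>k. \<bar>k\<bar> = 1 \<and> eventually (\<lambda>x. 0 \<le> k * X x) F)"

text \<open>Order relations are kept in the form \<open>o[F]\<close>, which unlike \<open>X1 x / X2 x \<rightarrow> 0\<close> is
  not affected by \<open>x / 0 = 0\<close> at zeros of \<open>X2\<close>.\<close>

lemma moment_smallo:
  assumes X1: "moment_integrable X1" and X2: "moment_integrable X2"
    and small: "X1 \<in> o[F](X2)" and k: "\<bar>k\<bar> = 1" "eventually (\<lambda>x. 0 \<le> k * X2 x) F"
  shows "moment X1 \<in> o[F](moment X2)" and "eventually (\<lambda>x. 0 \<le> k * moment X2 x) F"
proof -
  \<comment> \<open>With \<open>k * moment X2\<close> in place of its absolute value, one estimate
    yields both conclusions: the sign is the case \<open>e = 1\<close>, as the left side is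
    nonnegative.\<close>
  have *: "eventually (\<lambda>x. \<bar>moment X1 x\<bar> \<le> e * (k * moment X2 x)) F" if e: "e > 0" for e
  proof -
    have "eventually (\<lambda>x. norm (X1 x) \<le> e * norm (X2 x)) F"
      using landau_o.smallD[OF small e] .
    with k(2) have "eventually (\<lambda>x. \<bar>X1 x\<bar> \<le> (e * k) * X2 x) F"
    proof eventually_elim
      case (elim x)
      have "\<bar>X2 x\<bar> = k * X2 x" using elim(1) k(1) by (metis abs_mult abs_of_nonneg mult_1)
      then show ?case using elim by (simp add: mult.assoc)
    qed
    then obtain d where d: "d \<in> J" "\<And>x. x \<in> J \<Longrightarrow> x \<le> d \<Longrightarrow> \<bar>X1 x\<bar> \<le> (e * k) * X2 x"
      by (rule eventually_F_below) (rule that)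
    then have "\<bar>moment X1 x\<bar> \<le> (e * k) * moment X2 x" if "x \<le> d" for x
      using moment_abs_le[OF X1 X2 d(1) d(2) that] by blast
    then show ?thesis unfolding eventually_F using d(1) by (intro bexI[of _ d]) (auto simp: mult.assoc)
  qed
  show "eventually (\<lambda>x. 0 \<le> k * moment X2 x) F"
    using *[of 1] by (auto elim!: eventually_mono)
  show "moment X1 \<in> o[F](moment X2)"
  proof (rule landau_o.smallI)
    fix e :: real assume e: "e > 0"
    from *[OF e] show "eventually (\<lambda>x. norm (moment X1 x) \<le> e * norm (moment X2 x)) F"
    proof eventually_elim
      case (elim x)
      have "k * moment X2 x \<le> \<bar>moment X2 x\<bar>"
        using k(1) by (metis abs_ge_self abs_mult mult_1)
      then have "e * (k * moment X2 x) \<le> e * \<bar>moment X2 x\<bar>" using e by simp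
      then show ?case using elim by simp
    qed
  qed
qed

text \<open>Letting \<open>x\<close> tend to \<open>a\<close> in the increments over
  \<open>[x, y]\<close> expresses \<open>- Z2 y\<close> as an integral of \<open>W2 \<sigma>\<close>
  from \<open>a\<close>. This allows a comparison without boundary terms and explains why the sign
  flips to \<open>- k\<close>.\<close>

lemma primitive_rep_smallo_decay:
  assumes Z1: "primitive_rep W1 Z1" "(Z1 \<longlongrightarrow> 0) F" and Z2: "primitive_rep W2 Z2" "(Z2 \<longlongrightarrow> 0) F"
    and small: "W1 \<in> o[F](W2)" and k: "\<bar>k\<bar> = 1" "eventually (\<lambda>x. 0 \<le> k * W2 x) F"
  shows "Z1 \<in> o[F](Z2)" and "eventually (\<lambda>x. 0 \<le> - k * Z2 x) F"
proof -
  have *: "eventually (\<lambda>x. \<bar>Z1 x\<bar> \<le> e * (- k * Z2 x)) F" if e: "e > 0" for e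
  proof -
    have "eventually (\<lambda>x. norm (W1 x) \<le> e * norm (W2 x)) F"
      using landau_o.smallD[OF small e] .
    with k(2) have "eventually (\<lambda>x. \<bar>W1 x\<bar> \<le> (e * k) * W2 x) F"
    proof eventually_elim
      case (elim x)
      have "\<bar>W2 x\<bar> = k * W2 x" using elim(1) k(1) by (metis abs_mult abs_of_nonneg mult_1)
      then show ?case using elim by (simp add: mult.assoc)
    qed
    then obtain d where d: "d \<in> J" "\<And>x. x \<in> J \<Longrightarrow> x \<le> d \<Longrightarrow> \<bar>W1 x\<bar> \<le> (e * k) * W2 x"
      by (rule eventually_F_below) (rule that)
    have "\<bar>Z1 y\<bar> \<le> e * (- k * Z2 y)" if y: "y \<in> J" "y \<le> d" for y
    proof -
      have "\<bar>0 - Z1 y\<bar> \<le> (e * k) * (0 - Z2 y)"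
      proof (rule tendsto_le[OF F_neq_bot])
        show "((\<lambda>x. (e * k) * (Z2 x - Z2 y)) \<longlongrightarrow> (e * k) * (0 - Z2 y)) F"
          by (intro tendsto_intros Z2)
        show "((\<lambda>x. \<bar>Z1 x - Z1 y\<bar>) \<longlongrightarrow> \<bar>0 - Z1 y\<bar>) F"
          by (intro tendsto_intros Z1)
        show "\<forall>\<^sub>F x in F. \<bar>Z1 x - Z1 y\<bar> \<le> (e * k) * (Z2 x - Z2 y)"
          unfolding eventually_F
          using primitive_rep_abs_le[OF Z1(1) Z2(1) d] y by (intro bexI[of _ y]) auto
      qed
      then show ?thesis by simp
    qed
    then show ?thesis unfolding eventually_F using d(1) by blast
  qed
  show "eventually (\<lambda>x. 0 \<le> - k * Z2 x) F"
    using *[of 1] by (auto elim!: eventually_mono)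
  show "Z1 \<in> o[F](Z2)"
  proof (rule landau_o.smallI)
    fix e :: real assume e: "e > 0"
    from *[OF e] show "eventually (\<lambda>x. norm (Z1 x) \<le> e * norm (Z2 x)) F"
    proof eventually_elim
      case (elim x)
      have "- k * Z2 x \<le> \<bar>Z2 x\<bar>"
        using k(1) by (metis abs_ge_self abs_minus_cancel abs_mult mult_1)
      then have "e * (- k * Z2 x) \<le> e * \<bar>Z2 x\<bar>" using e by (intro mult_left_mono) auto
      then show ?case using elim by simp
    qed
  qed
qed

text \<open>No limit at \<open>a\<close> is available for \<open>Z2\<close>, so the comparison
  starts from a base point \<open>d\<close>; the values at \<open>d\<close> are negligible against
  \<open>Z2\<close>.\<close>

lemma primitive_rep_smallo_blowup:
  assumes Z1: "primitive_rep W1 Z1" and Z2: "primitive_rep W2 Z2" "filterlim Z2 at_top F"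
    and small: "W1 \<in> o[F](W2)" and pos: "eventually (\<lambda>x. 0 \<le> W2 x) F"
  shows "Z1 \<in> o[F](Z2)"
proof (rule landau_o.smallI)
  fix e :: real assume e: "e > 0"
  have "eventually (\<lambda>x. norm (W1 x) \<le> (e / 2) * norm (W2 x)) F"
    using landau_o.smallD[OF small half_gt_zero[OF e]] .
  with pos have "eventually (\<lambda>x. \<bar>W1 x\<bar> \<le> (e / 2) * W2 x) F"
    by eventually_elim simp
  then obtain d where d: "d \<in> J" "\<And>x. x \<in> J \<Longrightarrow> x \<le> d \<Longrightarrow> \<bar>W1 x\<bar> \<le> (e / 2) * W2 x"
    by (rule eventually_F_below) (rule that)
  \<comment> \<open>Half of \<open>e\<close> pays for the integral, the other half for the terms at
    \<open>d\<close>.\<close>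
  have "eventually (\<lambda>x. max 0 ((\<bar>Z1 d\<bar> + e / 2 * \<bar>Z2 d\<bar>) * 2 / e) \<le> Z2 x) F"
    using Z2(2) unfolding filterlim_at_top by blast
  moreover have "eventually (\<lambda>x. x \<in> J \<and> x \<le> d) F"
    unfolding eventually_F using d by auto
  ultimately show "eventually (\<lambda>x. norm (Z1 x) \<le> e * norm (Z2 x)) F"
  proof eventually_elim
    case (elim x)
    then have s0: "Z2 x \<ge> 0" "(\<bar>Z1 d\<bar> + e / 2 * \<bar>Z2 d\<bar>) * 2 / e \<le> Z2 x" by auto
    have s1: "\<bar>Z1 d\<bar> + e / 2 * \<bar>Z2 d\<bar> \<le> e / 2 * Z2 x" using s0 e by (simp add: field_simps)
    have "\<bar>Z1 x - Z1 d\<bar> \<le> e / 2 * (Z2 x - Z2 d)"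
      using primitive_rep_abs_le[OF Z1 Z2(1) d] elim by auto
    then have "\<bar>Z1 x\<bar> \<le> \<bar>Z1 d\<bar> + e / 2 * (Z2 x - Z2 d)" by linarith
    also have "\<dots> \<le> \<bar>Z1 d\<bar> + e / 2 * \<bar>Z2 d\<bar> + e / 2 * Z2 x"
      using e mult_left_mono[of "- Z2 d" "\<bar>Z2 d\<bar>" "e / 2"] abs_ge_minus_self[of "Z2 d"]
      by (simp add: algebra_simps)
    also have "\<dots> \<le> e * Z2 x" using s1 by simp
    finally show ?case using s0 by simp
  qed
qed

lemma left_ray_not_null: "x \<in> J \<Longrightarrow> left_ray a x \<notin> null_sets lebesgue"
proof
  assume x: "x \<in> J" and n: "left_ray a x \<in> null_sets lebesgue"
  obtain x' where x': "a < ereal x'" "x' < x" using x ereal_dense2[of a "ereal x"] by auto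
  have "{x'..x} \<subseteq> left_ray a x" using x' by (auto intro: ereal_less_mono)
  then have "{x'..x} \<in> null_sets lebesgue" using n
    by (metis negligible_iff_null_sets negligible_subset)
  then show False using interval_not_null[OF x'(2)] by simp
qed

text \<open>The regularization index provides only \<open>1/Z \<rightarrow> 0\<close>. Positivity of
  \<open>X\<close> near \<open>a\<close> makes the moment positive and \<open>Z\<close> strictly
  decreasing, which settles the sign of the divergence.\<close>

lemma primitive_rep_at_top:
  assumes X: "moment_integrable X" "eventually (\<lambda>x. 0 < X x) F"
    and Z: "primitive_rep W Z" "\<And>x. x \<in> J \<Longrightarrow> W x = moment X x" and lim: "((\<lambda>x. 1 / Z x) \<longlongrightarrow> 0) F"
  shows "filterlim Z at_top F"
proof -
  obtain d where d: "d \<in> J" "\<And>x. x \<in> J \<Longrightarrow> x \<le> d \<Longrightarrow> 0 < X x"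
    using X(2) by (rule eventually_F_below) (rule that)
  have W: "0 < W x" if x: "x \<in> J" "x \<le> d" for x
  proof -
    have xc: "x \<le> c" using x by simp
    have "0 < (LINT t:left_ray a x|lebesgue. X t * \<mu> t)"
    proof (rule set_integral_pos_AE[OF _ _ left_ray_not_null[OF x(1)]])
      show "AE t in lebesgue. t \<in> left_ray a x \<longrightarrow> 0 < X t * \<mu> t"
        using \<mu>_AE by eventually_elim (use d x in auto)
      show "set_integrable lebesgue (left_ray a x) (\<lambda>t. X t * \<mu> t)"
        by (rule set_integrable_left_ray[OF X(1)[unfolded moment_integrable_def] xc])
    qed simp
    then show ?thesis using Z(2)[OF x(1)] by (simp add: moment_def)
  qed
  show ?thesis
  proof (rule strict_antimono_at_top[OF _ d(1) lim])
    fix x y assume xy: "x \<in> J" "x < y" "y \<le> d"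
    have yc: "y \<le> c" using xy d by simp
    have "0 < (LINT t:{x..y}|lebesgue. W t * \<sigma> t)"
    proof (rule set_integral_pos_AE[OF _ _ interval_not_null[OF xy(2)]])
      show "AE t in lebesgue. t \<in> {x..y} \<longrightarrow> 0 < W t * \<sigma> t"
        using s_AE
      proof eventually_elim
        case (elim t)
        then show ?case using W[of t] xy interval_subset_J[OF xy(1) yc] by (auto simp: subset_iff)
      qed
      show "set_integrable lebesgue {x..y} (\<lambda>t. W t * \<sigma> t)"
        using Z(1) xy yc by (auto simp: primitive_rep_def)
    qed simp
    also have "\<dots> = Z x - Z y" using Z(1) xy yc by (auto simp: primitive_rep_def)
    finally show "Z y < Z x" by simp
  qed
qed

text \<open>\<open>e\<close> is the limit of \<open>W(f, u)\<close> at \<open>a\<close>: 0 for the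
  family built from \<open>phi\<close>, 1 for the one built from \<open>theta\<close>.\<close>

definition coeff_system :: "real \<Rightarrow> (nat \<Rightarrow> real \<Rightarrow> real) \<Rightarrow> bool" where
  "coeff_system e X \<longleftrightarrow> (\<forall>n. moment_integrable (X n)) \<and> primitive_rep (\<lambda>_. e) (X 0) \<and>
     (\<forall>n. primitive_rep (moment (X n)) (X (Suc n)))"

text \<open>With Wronskian 1 the zeroth function differs from \<open>s\<close> by a
  constant.\<close>

lemma coeff_system_0_at_top:
  assumes "coeff_system 1 Y"
  shows "filterlim (Y 0) at_top F"
proof -
  have eq: "Y 0 x = (Y 0 c - s c) + s x" if "x \<in> J" for x
  proof -
    have "Y 0 x - Y 0 c = (LINT t:{x..c}|lebesgue. 1 * \<sigma> t)"
      using assms that by (auto simp: coeff_system_def primitive_rep_def)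
    then show ?thesis using s_diff[of x c] that by simp
  qed
  have "\<forall>\<^sub>F x in F. (Y 0 c - s c) + s x = Y 0 x"
    using eventually_F_J by eventually_elim (use eq in simp)
  moreover have "filterlim (\<lambda>x. (Y 0 c - s c) + s x) at_top F"
    by (rule filterlim_tendsto_add_at_top[OF tendsto_const s_top])
  ultimately show ?thesis by (simp cong: filterlim_cong)
qed

text \<open>The two systems and the two indices are independent, so that \<open>H\<close> and
  \<open>Y\<close> can be compared with themselves and with each other in either order.\<close>

lemma coeff_system_smallo_decay:
  assumes "coeff_system e1 X1" "coeff_system e2 X2"
    and lim: "(X1 (Suc m) \<longlongrightarrow> 0) F" "(X2 (Suc n) \<longlongrightarrow> 0) F"
    and small: "X1 m \<in> o[F](X2 n)" and sg: "eventually_signed (X2 n)"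
  shows "X1 (Suc m) \<in> o[F](X2 (Suc n))" "eventually_signed (X2 (Suc n))"
proof -
  note X = assms(1,2)[unfolded coeff_system_def]
  obtain k where k: "\<bar>k\<bar> = 1" "eventually (\<lambda>x. 0 \<le> k * X2 n x) F"
    using sg by (auto simp: eventually_signed_def)
  have m: "moment (X1 m) \<in> o[F](moment (X2 n))" "eventually (\<lambda>x. 0 \<le> k * moment (X2 n) x) F"
    using moment_smallo[of "X1 m" "X2 n" k] X small k by auto
  have d: "X1 (Suc m) \<in> o[F](X2 (Suc n))" "eventually (\<lambda>x. 0 \<le> - k * X2 (Suc n) x) F"
    using primitive_rep_smallo_decay[OF _ lim(1) _ lim(2) m(1) k(1) m(2)] X by auto
  show "X1 (Suc m) \<in> o[F](X2 (Suc n))" by (rule d)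
  show "eventually_signed (X2 (Suc n))"
    unfolding eventually_signed_def using d(2) k(1) by (intro exI[of _ "- k"]) auto
qed

lemma coeff_system_quotients:
  assumes sol: "\<And>z. \<bar>z\<bar> < 1 \<Longrightarrow> SL_sol a b p q r (lam + z) (f z) (f1 z)"
    and series: "\<And>z x. \<bar>z\<bar> < 1 \<Longrightarrow> x \<in> J \<Longrightarrow> (\<lambda>n. \<psi> n x * z ^ n) sums f z x"
    and bound: "\<And>n x. x \<in> J \<Longrightarrow> \<bar>\<psi> n x\<bar> \<le> C * \<bar>v x\<bar>"
    and lim: "\<And>z. \<bar>z\<bar> < 1 \<Longrightarrow> ((\<lambda>x. f z x / v x) \<longlongrightarrow> e) F"
  shows "coeff_system e (\<lambda>n x. \<psi> n x / u x)"
proof -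
  note asm = assms
  have eq: "\<psi> n t * u t * r t = \<psi> n t / u t * \<mu> t" if "t \<in> J" for n t
    using u_nz[of t] that by (simp add: \<mu>_def power2_eq_square)
  have W0: "coeff_wronskian e \<psi> 0 t = e" for t by (simp add: coeff_wronskian_def)
  have WS: "coeff_wronskian e \<psi> (Suc n) t = moment (\<lambda>x. \<psi> n x / u x) t" if "t \<in> J" for n t
  proof -
    have "(LINT t':left_ray a t|lebesgue. \<psi> n t' * u t' * r t') = (LINT t':left_ray a t|lebesgue. \<psi> n t' / u t' * \<mu> t')"
      by (rule set_lebesgue_integral_cong) (use that eq in auto)
    then show ?thesis by (simp add: coeff_wronskian_def moment_def)
  qed
  have rep: "primitive_rep (coeff_wronskian e \<psi> n) (\<lambda>x. \<psi> n x / u x)" for n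
    unfolding primitive_rep_def
    using coeff_wronskian_\<sigma>_integrable[OF asm] coeff_increment[OF asm] by blast
  \<comment> \<open>The Wronskian coefficient and the moment of \<open>\<psi>/u\<close> are
    identified only on \<open>J\<close>, where \<open>u\<close> has no zeros.\<close>
  have rep_cong: "primitive_rep W' Z" if "primitive_rep W Z" and WW: "\<And>t. t \<in> J \<Longrightarrow> W t = W' t" for W W' Z
    unfolding primitive_rep_def
  proof (intro allI impI conjI)
    fix x y assume xy: "x \<in> J" "x \<le> y" "y \<le> c"
    have "W t * \<sigma> t = W' t * \<sigma> t" if "t \<in> {x..y}" for t
      using WW[of t] interval_subset_J[OF xy(1,3)] that by auto
    then have i: "set_integrable lebesgue {x..y} (\<lambda>t. W t * \<sigma> t) = set_integrable lebesgue {x..y} (\<lambda>t. W' t * \<sigma> t)"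
      and I: "(LINT t:{x..y}|lebesgue. W t * \<sigma> t) = (LINT t:{x..y}|lebesgue. W' t * \<sigma> t)"
      by (intro set_integrable_cong refl set_lebesgue_integral_cong; simp)+
    show "set_integrable lebesgue {x..y} (\<lambda>t. W' t * \<sigma> t)" "Z x - Z y = (LINT t:{x..y}|lebesgue. W' t * \<sigma> t)"
      using that(1) xy i I by (auto simp: primitive_rep_def)
  qed
  have "moment_integrable (\<lambda>x. \<psi> n x / u x)" for n
    unfolding moment_integrable_def using coeff_integrable[OF asm]
    by (subst set_integrable_cong[OF refl refl eq[symmetric]]) auto
  moreover have "primitive_rep (\<lambda>_. e) (\<lambda>x. \<psi> 0 x / u x)"
    by (rule rep_cong[OF rep]) (simp add: W0)
  moreover have "primitive_rep (moment (\<lambda>x. \<psi> n x / u x)) (\<lambda>x. \<psi> (Suc n) x / u x)" for n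
    by (rule rep_cong[OF rep]) (simp add: WS)
  ultimately show ?thesis by (simp add: coeff_system_def)
qed

section \<open>Order relations for abstract systems \<open>H\<close> and \<open>Y\<close> with index
  \<open>L\<close>\<close>

context
  fixes H Y :: "nat \<Rightarrow> real \<Rightarrow> real" and L :: enat
  assumes H: "coeff_system 0 H" and Y: "coeff_system 1 Y"
    and H0: "\<And>x. x \<in> J \<Longrightarrow> H 0 x = 1" and H_lim: "\<And>n. (H (Suc n) \<longlongrightarrow> 0) F"
    and Y_le: "\<And>n. enat n \<le> L \<Longrightarrow> ((\<lambda>x. 1 / Y n x) \<longlongrightarrow> 0) F"
    and Y_gt: "\<And>n. L < enat n \<Longrightarrow> (Y n \<longlongrightarrow> 0) F"
begin

lemma eventually_H0: "eventually (\<lambda>x. H 0 x = 1) F"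
  using eventually_F_J by eventually_elim (rule H0)

lemma tendsto_0_imp_smallo_H0:
  assumes "(f \<longlongrightarrow> 0) F"
  shows "f \<in> o[F](H 0)"
proof -
  have "f \<in> o[F](\<lambda>_. 1)" using assms by (intro smalloI_tendsto) auto
  then show ?thesis
    by (rule landau_o.small.cong_ex[THEN iffD1, rotated 2])
       (use eventually_H0 in \<open>auto elim: eventually_mono\<close>)
qed

text \<open>The sign belongs to the induction because the decay step requires a dominating function
  of one sign.\<close>

lemma H_smallo_signed: "H (Suc k) \<in> o[F](H k) \<and> eventually_signed (H k)"
proof (induction k)
  case 0
  have "eventually_signed (H 0)"
    unfolding eventually_signed_def using eventually_H0
    by (intro exI[of _ 1]) (auto elim: eventually_mono)
  then show ?case using tendsto_0_imp_smallo_H0[OF H_lim] by simp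
next
  case (Suc k)
  then show ?case using coeff_system_smallo_decay[OF H H H_lim H_lim] by blast
qed

text \<open>Divergence of \<open>Y n\<close> gives its positivity near \<open>a\<close>, which is
  what fixes the sign of the divergence of \<open>Y (Suc n)\<close>.\<close>

lemma Y_at_top: "enat n \<le> L \<Longrightarrow> filterlim (Y n) at_top F"
proof (induction n)
  case 0
  show ?case by (rule coeff_system_0_at_top[OF Y])
next
  case (Suc n)
  have "enat n \<le> L" using Suc.prems by (metis Suc_leD enat_ord_simps(1) le_cases order_trans)
  then have "eventually (\<lambda>x. 0 < Y n x) F"
    using Suc.IH by (auto simp: filterlim_at_top_dense)
  then show ?case
    using primitive_rep_at_top[of "Y n" "moment (Y n)" "Y (Suc n)"] Y Y_le[OF Suc.prems]
    by (auto simp: coeff_system_def)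
qed

lemma Y_eventually_pos: "enat n \<le> L \<Longrightarrow> eventually (\<lambda>x. 0 < Y n x) F"
  using Y_at_top by (auto simp: filterlim_at_top_dense)

lemma Y_eventually_nonneg: "enat n \<le> L \<Longrightarrow> eventually (\<lambda>x. 0 \<le> Y n x) F"
  by (rule eventually_mono[OF Y_eventually_pos]) auto

lemma Y_pos_signed: "enat n \<le> L \<Longrightarrow> eventually_signed (Y n)"
  unfolding eventually_signed_def using Y_eventually_nonneg by (intro exI[of _ 1]) auto

text \<open>The relation passes to the moments and then, by divergence of the dominating function,
  to the next coefficients. Positivity of \<open>Y n\<close> supplies the sign.\<close>

lemma Y_smallo_below: "enat (Suc n) \<le> L \<Longrightarrow> Y (Suc n) \<in> o[F](Y n)"
proof (induction n)
  case 0
  have top: "filterlim (Y 0) at_top F" using Y_at_top[of 0] 0 by (simp add: zero_enat_def[symmetric])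
  \<comment> \<open>The base case compares Wronskians: that of \<open>Y 0\<close> is the constant 1,
    that of \<open>Y 1\<close> is an integral from \<open>a\<close> and tends to 0.\<close>
  have "(moment (Y 0) \<longlongrightarrow> 0) F"
    unfolding moment_def[abs_def]
    by (rule tendsto_left_ray_integral[OF a_less_c]) (use Y in \<open>auto simp: coeff_system_def moment_integrable_def\<close>)
  then have "moment (Y 0) \<in> o[F](\<lambda>_. 1)" by (intro smalloI_tendsto) auto
  then show ?case
    using primitive_rep_smallo_blowup[OF _ _ top, of "moment (Y 0)" "Y (Suc 0)" "\<lambda>_. 1"] Y
    by (auto simp: coeff_system_def)
next
  case (Suc n)
  have le: "enat (Suc n) \<le> L" "enat n \<le> L"
    using Suc.prems by (metis Suc_leD enat_ord_simps(1) order_trans order_refl)+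
  have m: "moment (Y (Suc n)) \<in> o[F](moment (Y n))" "eventually (\<lambda>x. 0 \<le> 1 * moment (Y n) x) F"
    using moment_smallo[of "Y (Suc n)" "Y n" 1] Y Suc.IH[OF le(1)] Y_eventually_nonneg[OF le(2)]
    by (auto simp: coeff_system_def)
  show ?case
    using primitive_rep_smallo_blowup[OF _ _ Y_at_top[OF le(1)] m(1)] Y m(2) by (auto simp: coeff_system_def)
qed

text \<open>From the index on the two sequences interlace: \<open>Y l\<close>, \<open>H 0\<close>,
  \<open>Y (l + 1)\<close>, \<open>H 1\<close>, and so on, each dominating the next. The start is
  that \<open>Y l\<close> diverges, \<open>H 0\<close> is 1 and \<open>Y (l + 1)\<close> vanishes at
  \<open>a\<close>; afterwards all functions of the next order decay, so every relation moves up by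
  one.\<close>

lemma Y_smallo_above:
  assumes L: "L = enat l"
  shows "Y (Suc (l + k)) \<in> o[F](Y (l + k)) \<and> eventually_signed (Y (l + k)) \<and>
    H k \<in> o[F](Y (l + k)) \<and> Y (Suc (l + k)) \<in> o[F](H k)"
proof (induction k)
  case 0
  have top: "filterlim (Y l) at_top F" using Y_at_top L by simp
  have lim: "(Y (Suc l) \<longlongrightarrow> 0) F" using Y_gt L by simp
  have "((\<lambda>x. 1 / Y l x) \<longlongrightarrow> 0) F" using Y_le L by simp
  moreover have "eventually (\<lambda>x. Y l x \<noteq> 0) F"
    using Y_eventually_pos[of l] L by (auto elim: eventually_mono)
  ultimately have one: "(\<lambda>_. 1) \<in> o[F](Y l)" by (intro smalloI_tendsto) auto
  then have H: "H 0 \<in> o[F](Y l)"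
    by (rule landau_o.small.in_cong[THEN iffD1, rotated])
       (use eventually_H0 in \<open>auto elim: eventually_mono\<close>)
  have Y: "Y (Suc l) \<in> o[F](H 0)" by (rule tendsto_0_imp_smallo_H0[OF lim])
  show ?case using H Y landau_o.small_trans[OF Y H] Y_pos_signed[of l] L by simp
next
  case (Suc k)
  have lim: "(Y (Suc (l + k)) \<longlongrightarrow> 0) F" "(Y (Suc (Suc (l + k))) \<longlongrightarrow> 0) F" using Y_gt L by simp_all
  have sg: "eventually_signed (Y (l + k))" "eventually_signed (H k)" using Suc H_smallo_signed by auto
  show ?case
    using coeff_system_smallo_decay[OF Y Y lim(2,1) _ sg(1)] coeff_system_smallo_decay[OF H Y H_lim lim(1) _ sg(1)]
      coeff_system_smallo_decay[OF Y H lim(2) H_lim _ sg(2)] Suc by simp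
qed

lemma Y_smallo: "Y (Suc n) \<in> o[F](Y n)"
proof (cases "enat (Suc n) \<le> L")
  case False
  then obtain l where l: "L = enat l" "l \<le> n" by (cases L) auto
  then show ?thesis using Y_smallo_above[OF l(1), of "n - l"] by simp
qed (rule Y_smallo_below)

end

end

section \<open>The regularization index\<close>

text \<open>A \<open>LEAST\<close> is informative only if some \<open>l\<close> qualifies. The limit
  for \<open>n = 0\<close> guarantees this: the first index at which the limit fails is then a
  successor, and its predecessor qualifies.\<close>

lemma reg_index_tendsto:
  assumes "((\<lambda>x. ph0 x / th 0 x) \<longlongrightarrow> 0) F" and "enat n \<le> reg_index F ph0 th"
  shows "((\<lambda>x. ph0 x / th n x) \<longlongrightarrow> 0) F"
proof -
  define P where "P n \<longleftrightarrow> ((\<lambda>x. ph0 x / th n x) \<longlongrightarrow> 0) F" for n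
  define Q where "Q l \<longleftrightarrow> (\<forall>n\<le>l. P n) \<and> \<not> P (Suc l)" for l
  have reg: "reg_index F ph0 th = (if \<forall>n. P n then \<infinity> else enat (LEAST l. Q l))"
    unfolding reg_index_def P_def Q_def by (rule refl)
  have "P n"
  proof (cases "\<forall>n. P n")
    case False
    define n0 where "n0 = (LEAST n. \<not> P n)"
    have "\<exists>n. \<not> P n" using False by blast
    then have n0: "\<not> P n0" unfolding n0_def by (rule LeastI_ex)
    have less: "P n" if "n < n0" for n
      using not_less_Least[of n "\<lambda>n. \<not> P n"] that unfolding n0_def by blast
    have "P 0" using assms(1) unfolding P_def .
    with n0 obtain l where l: "n0 = Suc l" by (cases n0) auto
    have "Q l" unfolding Q_def using n0 less l by (metis le_imp_less_Suc)
    then have "Q (LEAST l. Q l)" by (rule LeastI)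
    then have "\<forall>n\<le>(LEAST l. Q l). P n" unfolding Q_def[of "LEAST l. Q l"] by (rule conjunct1)
    moreover have "n \<le> (LEAST l. Q l)"
      using assms(2) unfolding reg if_not_P[OF False] enat_ord_simps(1) .
    ultimately show ?thesis by blast
  qed blast
  then show ?thesis unfolding P_def .
qed

context SL_end
begin

section \<open>The naturally normalized system as an instance of the abstract recursion\<close>

context
  fixes \<kappa> :: complex and phi phi1 theta theta1 :: "complex \<Rightarrow> real \<Rightarrow> complex"
    and phn thn :: "nat \<Rightarrow> real \<Rightarrow> complex"
  assumes \<kappa>: "\<kappa> \<noteq> 0"
    and phi: "\<And>z x. x \<in> SL_int a b \<Longrightarrow> phi z x = \<kappa> * phiC a r u v lam z x"
    and phn: "\<And>n x. x \<in> SL_int a b \<Longrightarrow> phn n x = \<kappa> * complex_of_real (\<phi> n x)"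
    and phi_sol: "\<And>z. SL_sol a b p q r z (phi z) (phi1 z)"
    and theta_sol: "\<And>z. SL_sol a b p q r z (theta z) (theta1 z)"
    and theta_entire: "\<And>x. x \<in> SL_int a b \<Longrightarrow> (\<lambda>z. theta z x) holomorphic_on UNIV"
    and theta_real: "\<And>t x. x \<in> SL_int a b \<Longrightarrow> theta (complex_of_real t) x \<in> \<real>"
    and theta_series: "\<And>z x. x \<in> SL_int a b \<Longrightarrow> (\<lambda>n. thn n x * (z - complex_of_real lam) ^ n) sums theta z x"
    and W: "\<And>z x. x \<in> SL_int a b \<Longrightarrow> theta z x * phi1 z x - theta1 z x * phi z x = 1"
    and nat_norm: "\<And>n. reg_index F (phn 0) thn < enat n \<Longrightarrow> ((\<lambda>x. thn n x / phn 0 x) \<longlongrightarrow> 0) F"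
begin

lemma J_SL: "x \<in> J \<Longrightarrow> x \<in> SL_int a b"
  using J_subset_SL_int by blast

definition H :: "nat \<Rightarrow> real \<Rightarrow> real" where "H n x = \<phi> n x / u x"

text \<open>\<open>Re\<close> gives a real function at once; \<open>thn_real\<close> shows later
  that nothing is lost.\<close>

definition Y :: "nat \<Rightarrow> real \<Rightarrow> real" where "Y n x = Re (\<kappa> * thn n x) / u x"

text \<open>The real family is the real part of \<open>phi/\<kappa>\<close>. Its quotient by
  \<open>v\<close> is that by \<open>u\<close> times \<open>1/s\<close>, so it tends to 0; the
  majorant constant is 1 because \<open>M \<le> 1\<close> and \<open>|u| \<le> |v|\<close>.\<close>

lemma H_system: "coeff_system 0 H"
  unfolding H_def[abs_def]
proof (rule coeff_system_quotients)
  fix z :: real assume z: "\<bar>z\<bar> < 1"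
  let ?z = "complex_of_real (lam + z)"
  have nz: "norm (?z - of_real lam) \<le> 1" using z by simp
  show "SL_sol a b p q r (lam + z) (\<lambda>x. Re (inverse \<kappa> * phi ?z x)) (\<lambda>x. Re (inverse \<kappa> * phi1 ?z x))"
    by (rule SL_sol_Re_mult[OF phi_sol])
  have eq: "Re (inverse \<kappa> * phi ?z x) = Re (phiC a r u v lam ?z x)" if "x \<in> J" for x
  proof -
    have "inverse \<kappa> * phi ?z x = phiC a r u v lam ?z x"
      unfolding phi[OF J_SL[OF that]] by (metis \<kappa> left_inverse mult.assoc mult_1)
    then show ?thesis by (rule arg_cong)
  qed
  show "(\<lambda>n. \<phi> n x * z ^ n) sums Re (inverse \<kappa> * phi ?z x)" if x: "x \<in> J" for x
    unfolding eq[OF x]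
    using Re_mult_powser_sums[of "\<lambda>n. of_real (\<phi> n x)" z _ 1] phiC_sums[OF nz x] by simp
  have "((\<lambda>x. Re (phiC a r u v lam ?z x / of_real (u x)) * inverse (s x)) \<longlongrightarrow> Re 1 * 0) F"
    by (rule tendsto_mult[OF tendsto_Re[OF phiC_quotient_tendsto[OF nz]] tendsto_inverse_0_at_top[OF s_top]])
  then have lim: "((\<lambda>x. Re (phiC a r u v lam ?z x / of_real (u x)) * inverse (s x)) \<longlongrightarrow> 0) F"
    by (simp only: mult_zero_right)
  have "\<forall>\<^sub>F x in F. Re (phiC a r u v lam ?z x / of_real (u x)) * inverse (s x)
      = Re (inverse \<kappa> * phi ?z x) / v x"
    using eventually_F_J
  proof eventually_elim
    case (elim x)
    show ?case
      unfolding eq[OF elim] v_eq[OF elim] Re_divide_of_real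
      by (simp only: divide_inverse inverse_mult_distrib ac_simps)
  qed
  from Lim_transform_eventually[OF lim this]
  show "((\<lambda>x. Re (inverse \<kappa> * phi ?z x) / v x) \<longlongrightarrow> 0) F" .
next
  fix n x assume x: "x \<in> J"
  have "M x ^ n \<le> 1" using M_nonneg[of x] M_le[of x] x by (intro power_le_one) auto
  then have "M x ^ n * \<bar>u x\<bar> \<le> 1 * \<bar>v x\<bar>"
    by (intro mult_mono u_le_v x) auto
  then show "\<bar>\<phi> n x\<bar> \<le> 1 * \<bar>v x\<bar>" using phi_coeff_bound[OF x, of n] by linarith
qed

text \<open>Compactness of the unit circle bounds \<open>theta\<close> at the single point
  \<open>c\<close>, \<open>second_solution_bound\<close> carries this to every \<open>x\<close> in
  \<open>J\<close> with the factor \<open>|v x|\<close>, and Cauchy's estimate gives the same bound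
  for every coefficient.\<close>

lemma thn_bound: "\<exists>C. \<forall>n. \<forall>x\<in>J. norm (thn n x) \<le> C * \<bar>v x\<bar>"
proof -
  have cJ: "c \<in> J" using a_less_c by simp
  have "continuous_on (sphere (of_real lam) 1) (\<lambda>z. theta z c)"
    using theta_entire[OF J_SL[OF cJ]]
    by (meson continuous_on_subset holomorphic_on_imp_continuous_on subset_UNIV)
  then have "bounded ((\<lambda>z. theta z c) ` sphere (of_real lam) 1)"
    by (intro compact_imp_bounded compact_continuous_image) auto
  then obtain B where B: "\<And>z. z \<in> sphere (of_real lam) 1 \<Longrightarrow> norm (theta z c) \<le> B"
    unfolding bounded_iff by blast
  define C where "C = 4 * B / \<bar>u c\<bar> + 8 / norm \<kappa>"
  have "norm (thn n x) \<le> C * \<bar>v x\<bar>" if x: "x \<in> J" for n x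
  proof (rule entire_powser_coeff_bound[OF theta_entire[OF J_SL[OF x]] theta_series[OF J_SL[OF x]]])
    fix z :: complex assume z: "norm (z - of_real lam) = 1"
    have "norm (theta z x) \<le> (4 * norm (theta z c) / \<bar>u c\<bar> + 8 / norm \<kappa>) * \<bar>v x\<bar>"
      by (rule second_solution_bound[where f = "phi z" and ?f1.0 = "phi1 z" and ?g1.0 = "theta1 z" and z = z,
          OF _ \<kappa> phi phi_sol theta_sol W x]) (simp add: z)
    also have "\<dots> \<le> C * \<bar>v x\<bar>"
      unfolding C_def using B[of z] z
      by (intro mult_right_mono add_mono divide_right_mono mult_left_mono) (auto simp: dist_norm norm_minus_commute)
    finally show "norm (theta z x) \<le> C * \<bar>v x\<bar>" .
  qed
  then show ?thesis by blast
qed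

lemma theta_tendsto:
  assumes "norm (z - of_real lam) \<le> 1"
  shows "((\<lambda>x. \<kappa> * theta z x / of_real (v x)) \<longlongrightarrow> 1) F"
  by (rule second_solution_tendsto[where f = "phi z" and ?f1.0 = "phi1 z" and ?g1.0 = "theta1 z" and z = z,
      OF assms \<kappa> phi phi_sol theta_sol W])

text \<open>\<open>\<kappa>\<close> is assumed only to be a nonzero complex number, but the real
  quotient \<open>theta/v\<close> at \<open>lam\<close> tends to its inverse.\<close>

lemma \<kappa>_real: "\<kappa> \<in> \<real>"
proof -
  have "((\<lambda>x. inverse \<kappa> * (\<kappa> * theta (of_real lam) x / of_real (v x))) \<longlongrightarrow> inverse \<kappa> * 1) F"
    by (rule tendsto_mult[OF tendsto_const theta_tendsto]) simp
  then have lim: "((\<lambda>x. theta (of_real lam) x / of_real (v x)) \<longlongrightarrow> inverse \<kappa>) F"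
    unfolding mult_1_right times_divide_eq_right[symmetric] by (simp only: mult.assoc[symmetric] left_inverse[OF \<kappa>] mult_1)
  have "\<forall>\<^sub>F x in F. theta (of_real lam) x / of_real (v x) \<in> \<real>"
    using eventually_F_J by eventually_elim (intro Reals_divide theta_real J_SL Reals_of_real)
  from Lim_in_closed_set[OF closed_complex_Reals this F_neq_bot lim]
  have "inverse \<kappa> \<in> \<real>" .
  then show ?thesis using Reals_inverse[of "inverse \<kappa>"] by simp
qed

lemma thn_real:
  assumes "x \<in> J"
  shows "of_real (Re (\<kappa> * thn n x)) = \<kappa> * thn n x"
proof -
  have "thn n x \<in> \<real>"
  proof (rule powser_coeff_Reals[where f = "\<lambda>z. theta (of_real lam + z) x"])
    show "(\<lambda>n. thn n x * z ^ n) sums theta (of_real lam + z) x" for z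
      using theta_series[OF J_SL[OF assms], of "of_real lam + z"] by simp
    show "theta (of_real lam + of_real t) x \<in> \<real>" for t
      using theta_real[OF J_SL[OF assms], of "lam + t"] by simp
  qed
  with \<kappa>_real show ?thesis by (intro of_real_Re Reals_mult)
qed

lemma Y_system: "coeff_system 1 Y"
proof -
  obtain C where C: "\<And>n x. x \<in> J \<Longrightarrow> norm (thn n x) \<le> C * \<bar>v x\<bar>" using thn_bound by blast
  show ?thesis
    unfolding Y_def[abs_def]
  proof (rule coeff_system_quotients)
    fix z :: real assume z: "\<bar>z\<bar> < 1"
    let ?z = "complex_of_real (lam + z)"
    have nz: "norm (?z - of_real lam) \<le> 1" using z by simp
    show "SL_sol a b p q r (lam + z) (\<lambda>x. Re (\<kappa> * theta ?z x)) (\<lambda>x. Re (\<kappa> * theta1 ?z x))"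
      by (rule SL_sol_Re_mult[OF theta_sol])
    show "(\<lambda>n. Re (\<kappa> * thn n x) * z ^ n) sums Re (\<kappa> * theta ?z x)" if x: "x \<in> J" for x
      using Re_mult_powser_sums[of "\<lambda>n. thn n x" z _ \<kappa>] theta_series[OF J_SL[OF x], of ?z] by simp
    have "((\<lambda>x. Re (\<kappa> * theta ?z x / of_real (v x))) \<longlongrightarrow> Re 1) F"
      by (rule tendsto_Re[OF theta_tendsto[OF nz]])
    then show "((\<lambda>x. Re (\<kappa> * theta ?z x) / v x) \<longlongrightarrow> 1) F" by simp
  next
    fix n x assume x: "x \<in> J"
    have "\<bar>Re (\<kappa> * thn n x)\<bar> \<le> norm (\<kappa> * thn n x)" by (rule abs_Re_le_cmod)
    also have "\<dots> \<le> norm \<kappa> * (C * \<bar>v x\<bar>)"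
      unfolding norm_mult by (intro mult_left_mono C x) simp
    finally show "\<bar>Re (\<kappa> * thn n x)\<bar> \<le> (norm \<kappa> * C) * \<bar>v x\<bar>" by (simp add: mult.assoc)
  qed
qed

lemma phn_eq: "x \<in> J \<Longrightarrow> phn n x = \<kappa> * of_real (u x) * of_real (H n x)"
  using phn[OF J_SL] u_nz[of x] by (simp add: H_def)

lemma thn_eq:
  assumes x: "x \<in> J"
  shows "thn n x = inverse \<kappa> * of_real (u x) * of_real (Y n x)"
proof -
  have "of_real (u x) * complex_of_real (Y n x) = \<kappa> * thn n x"
    using u_nz[of x] x thn_real[OF x, of n] by (simp add: Y_def)
  then have "inverse \<kappa> * (of_real (u x) * complex_of_real (Y n x)) = inverse \<kappa> * (\<kappa> * thn n x)" by simp
  then show ?thesis using \<kappa> by (simp add: mult.assoc)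
qed

text \<open>The common factor \<open>u\<close> has no zeros on \<open>J\<close> and cancels; where
  \<open>h\<close> vanishes both quotients are 0, so they still agree.\<close>

lemma ratio_tendsto_zero_iff:
  fixes A B :: "real \<Rightarrow> complex" and g h :: "real \<Rightarrow> real"
  assumes k: "k \<noteq> 0" "k' \<noteq> 0"
    and A: "\<And>x. x \<in> J \<Longrightarrow> A x = k * of_real (u x) * of_real (g x)"
    and B: "\<And>x. x \<in> J \<Longrightarrow> B x = k' * of_real (u x) * of_real (h x)"
  shows "((\<lambda>x. A x / B x) \<longlongrightarrow> 0) F \<longleftrightarrow> ((\<lambda>x. g x / h x) \<longlongrightarrow> 0) F"
proof -
  have eq: "A x / B x = (k / k') * of_real (g x / h x)" if x: "x \<in> J" for x
  proof -
    have "A x / B x = (of_real (u x) * (k * of_real (g x))) / (of_real (u x) * (k' * of_real (h x)))"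
      unfolding A[OF x] B[OF x] by (simp only: ac_simps)
    also have "\<dots> = (k * of_real (g x)) / (k' * of_real (h x))"
      using u_nz[of x] x by (intro mult_divide_mult_cancel_left) auto
    finally show ?thesis by simp
  qed
  have "\<forall>\<^sub>F x in F. A x / B x = (k / k') * of_real (g x / h x)"
    using eventually_F_J by eventually_elim (rule eq)
  then have "((\<lambda>x. A x / B x) \<longlongrightarrow> 0) F \<longleftrightarrow> ((\<lambda>x. (k / k') * of_real (g x / h x)) \<longlongrightarrow> 0) F"
    by (rule tendsto_cong)
  also have "\<dots> \<longleftrightarrow> ((\<lambda>x. complex_of_real (g x / h x)) \<longlongrightarrow> of_real 0) F"
    using tendsto_mult_left_iff[of "k / k'" "\<lambda>x. complex_of_real (g x / h x)" 0 F] k by simp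
  also have "\<dots> \<longleftrightarrow> ((\<lambda>x. g x / h x) \<longlongrightarrow> 0) F"
    by (rule tendsto_of_real_iff)
  finally show ?thesis .
qed

lemma phn_phn: "((\<lambda>x. phn m x / phn n x) \<longlongrightarrow> 0) F \<longleftrightarrow> ((\<lambda>x. H m x / H n x) \<longlongrightarrow> 0) F"
  by (rule ratio_tendsto_zero_iff[OF \<kappa> \<kappa> phn_eq phn_eq])

lemma thn_thn: "((\<lambda>x. thn m x / thn n x) \<longlongrightarrow> 0) F \<longleftrightarrow> ((\<lambda>x. Y m x / Y n x) \<longlongrightarrow> 0) F"
  by (rule ratio_tendsto_zero_iff[OF nonzero_imp_inverse_nonzero nonzero_imp_inverse_nonzero thn_eq thn_eq, OF \<kappa> \<kappa>])

lemma phn_thn: "((\<lambda>x. phn m x / thn n x) \<longlongrightarrow> 0) F \<longleftrightarrow> ((\<lambda>x. H m x / Y n x) \<longlongrightarrow> 0) F"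
  by (rule ratio_tendsto_zero_iff[OF \<kappa> nonzero_imp_inverse_nonzero phn_eq thn_eq, OF \<kappa>])

lemma thn_phn: "((\<lambda>x. thn m x / phn n x) \<longlongrightarrow> 0) F \<longleftrightarrow> ((\<lambda>x. Y m x / H n x) \<longlongrightarrow> 0) F"
  by (rule ratio_tendsto_zero_iff[OF nonzero_imp_inverse_nonzero \<kappa> thn_eq phn_eq, OF \<kappa>])

lemma H_0: "x \<in> J \<Longrightarrow> H 0 x = 1"
  using u_nz by (simp add: H_def)

lemma H_lim: "(H (Suc n) \<longlongrightarrow> 0) F"
  unfolding H_def[abs_def] by (rule phi_coeff_quotient_tendsto) simp

lemma Y_le:
  assumes "enat n \<le> reg_index F (phn 0) thn"
  shows "((\<lambda>x. 1 / Y n x) \<longlongrightarrow> 0) F"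
proof -
  have eq: "((\<lambda>x. H 0 x / Y n x) \<longlongrightarrow> 0) F \<longleftrightarrow> ((\<lambda>x. 1 / Y n x) \<longlongrightarrow> 0) F" for n
    by (rule tendsto_cong) (use eventually_F_J H_0 in \<open>auto elim!: eventually_mono\<close>)
  \<comment> \<open>The case \<open>n = 0\<close> does not come from the index; it comes from
    \<open>Y 0\<close> being \<open>s\<close> up to a constant.\<close>
  have "((\<lambda>x. 1 / Y 0 x) \<longlongrightarrow> 0) F"
    using tendsto_inverse_0_at_top[OF coeff_system_0_at_top[OF Y_system]] by (simp add: inverse_eq_divide)
  then have "((\<lambda>x. phn 0 x / thn 0 x) \<longlongrightarrow> 0) F" using eq phn_thn by simp
  from reg_index_tendsto[OF this assms] show ?thesis using eq phn_thn by simp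
qed

lemma Y_gt:
  assumes "reg_index F (phn 0) thn < enat n"
  shows "(Y n \<longlongrightarrow> 0) F"
proof -
  have "((\<lambda>x. Y n x / H 0 x) \<longlongrightarrow> 0) F" using nat_norm[OF assms] thn_phn by simp
  moreover have "((\<lambda>x. Y n x / H 0 x) \<longlongrightarrow> 0) F \<longleftrightarrow> (Y n \<longlongrightarrow> 0) F"
    by (rule tendsto_cong) (use eventually_F_J H_0 in \<open>auto elim!: eventually_mono\<close>)
  ultimately show ?thesis by simp
qed

lemma naturally_normalized_asymptotics:
  "((\<lambda>x. phn (Suc k) x / phn k x) \<longlongrightarrow> 0) F"
  "((\<lambda>x. thn (Suc k) x / thn k x) \<longlongrightarrow> 0) F"
  "reg_index F (phn 0) thn = enat l \<Longrightarrow> ((\<lambda>x. phn k x / thn (l + k) x) \<longlongrightarrow> 0) F"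
  "reg_index F (phn 0) thn = enat l \<Longrightarrow> ((\<lambda>x. thn (l + k + 1) x / phn k x) \<longlongrightarrow> 0) F"
proof -
  note asm = H_system Y_system H_0 H_lim Y_le Y_gt
  show "((\<lambda>x. phn (Suc k) x / phn k x) \<longlongrightarrow> 0) F"
    unfolding phn_phn using H_smallo_signed[OF asm] by (intro smalloD_tendsto) blast
  show "((\<lambda>x. thn (Suc k) x / thn k x) \<longlongrightarrow> 0) F"
    unfolding thn_thn by (intro smalloD_tendsto Y_smallo[OF asm])
  assume l: "reg_index F (phn 0) thn = enat l"
  show "((\<lambda>x. phn k x / thn (l + k) x) \<longlongrightarrow> 0) F"
    unfolding phn_thn using Y_smallo_above[OF asm l, of k] by (intro smalloD_tendsto) blast
  show "((\<lambda>x. thn (l + k + 1) x / phn k x) \<longlongrightarrow> 0) F"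
    unfolding thn_phn using Y_smallo_above[OF asm l, of k] by (intro smalloD_tendsto) simp
qed

end

end

lemma nontrivial_nonoscillatory_nonzero:
  assumes "nonoscillatory_at_a a b p q r lam" "SL_sol a b p q r lam u u1" "\<exists>x\<in>SL_int a b. u x \<noteq> 0"
    and c0: "c0 \<in> SL_int a b"
  obtains c where "c \<in> SL_int a b" "c \<le> c0" "\<And>x. a < ereal x \<Longrightarrow> x \<le> c \<Longrightarrow> u x \<noteq> 0"
proof -
  obtain c1 where c1: "c1 \<in> SL_int a b" and fin: "finite {x. a < ereal x \<and> x < c1 \<and> u x = 0}"
    using assms(1)[unfolded nonoscillatory_at_a_def, rule_format, of u u1] assms(2,3) by blast
  \<comment> \<open>Inserting \<open>c1\<close> and \<open>c0\<close> makes the set nonempty and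
    keeps any \<open>c < m\<close> left of both.\<close>
  define m where "m = Min (insert c1 (insert c0 {x. a < ereal x \<and> x < c1 \<and> u x = 0}))"
  have fin': "finite (insert c1 (insert c0 {x. a < ereal x \<and> x < c1 \<and> u x = 0}))" using fin by simp
  have m_in: "m \<in> insert c1 (insert c0 {x. a < ereal x \<and> x < c1 \<and> u x = 0})"
    unfolding m_def using fin' by (intro Min_in) auto
  have m_le: "m \<le> x" if "x \<in> insert c1 (insert c0 {x. a < ereal x \<and> x < c1 \<and> u x = 0})" for x
    unfolding m_def using fin' that by (rule Min_le)
  have "a < ereal m" using m_in c1 c0 by (auto simp: SL_int_def)
  then obtain c where c: "a < ereal c" "c < m" using ereal_dense2[of a "ereal m"] by auto
  show ?thesis
  proof
    show cc0: "c \<le> c0" using c m_le[of c0] by simp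
    show "c \<in> SL_int a b"
      using c(1) c0 cc0 by (auto simp: SL_int_def intro: le_less_trans[of _ "ereal c0"])
    fix x assume x: "a < ereal x" "x \<le> c"
    then have "x < m" "x < c1" using c m_le[of c1] by auto
    then show "u x \<noteq> 0" using x m_le[of x] by force
  qed
qed

text \<open>The endpoint is chosen in two stages: at \<open>c1\<close> the function \<open>u\<close>
  is free of zeros, so \<open>s\<close> can be studied on \<open>(a, c1]\<close>; its divergence and
  the integrability of \<open>u v r\<close> then permit moving to a \<open>c\<close> at which
  \<open>s \<ge> 1\<close> and the integral is small.\<close>

lemma SL_end_exists:
  assumes setting: "SL_setting a b p q r"
    and nonosc: "nonoscillatory_at_a a b p q r lam"
    and u_sol: "SL_sol a b p q r lam u u1" and v_sol: "SL_sol a b p q r lam v v1"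
    and u_princ: "principal_at_a a b p q r lam u" and v_nonprinc: "nonprincipal_at_a a b p q r lam u v"
    and W_vu: "\<forall>x\<in>SL_int a b. v x * u1 x - v1 x * u x = 1"
    and c0: "c0 \<in> SL_int a b"
    and H_int: "set_integrable lebesgue (left_ray a c0) (\<lambda>x. u x * v x * r x)"
  obtains c where "SL_end a b p q r lam u u1 v v1 c"
proof -
  obtain c1 where c1: "c1 \<in> SL_int a b" "c1 \<le> c0" "\<And>x. a < ereal x \<Longrightarrow> x \<le> c1 \<Longrightarrow> u x \<noteq> 0"
    using nontrivial_nonoscillatory_nonzero[OF nonosc u_sol _ c0] u_princ unfolding principal_at_a_def by blast
  interpret L: SL_left a b p q r lam u u1 v v1 c1
    by unfold_locales (use setting u_sol v_sol W_vu c1 in auto)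
  have "((\<lambda>x. u x / v x) \<longlongrightarrow> 0) (at_left_end a)"
    using u_princ v_sol v_nonprinc unfolding principal_at_a_def nonprincipal_at_a_def by blast
  then have top: "filterlim L.s at_top (at_left_end a)" by (rule L.s_at_top)
  have int: "set_integrable lebesgue (left_ray a c1) (\<lambda>x. u x * v x * r x)"
    by (rule set_integrable_subset[OF H_int]) (use c1(2) in auto)
  have "((\<lambda>x. LINT t:left_ray a x|lebesgue. \<bar>u t * v t * r t\<bar>) \<longlongrightarrow> 0) (at_left_end a)"
    by (rule tendsto_left_ray_integral[OF L.a_less_c set_integrable_abs[OF int]])
  then have "\<forall>\<^sub>F x in at_left_end a. (LINT t:left_ray a x|lebesgue. \<bar>u t * v t * r t\<bar>) < 1 / 4"
    by (rule order_tendstoD(2)) simp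
  moreover have "\<forall>\<^sub>F x in at_left_end a. 1 \<le> L.s x"
    using top unfolding filterlim_at_top by blast
  ultimately have "\<forall>\<^sub>F x in at_left_end a. (LINT t:left_ray a x|lebesgue. \<bar>u t * v t * r t\<bar>) < 1 / 4 \<and> 1 \<le> L.s x"
    by (rule eventually_conj)
  then obtain c where c: "c \<in> left_ray a c1"
    and P: "\<And>x. x \<in> left_ray a c1 \<Longrightarrow> x \<le> c \<Longrightarrow>
      (LINT t:left_ray a x|lebesgue. \<bar>u t * v t * r t\<bar>) < 1 / 4 \<and> 1 \<le> L.s x"
    unfolding L.eventually_F by blast
  have cc1: "a < ereal c" "c \<le> c1" using c by auto
  show ?thesis
  proof (rule that[of c], unfold_locales)
    show "c \<in> SL_int a b" using L.J_subset_SL_int c by blast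
    show "u x \<noteq> 0" if "a < ereal x" "x \<le> c" for x using c1(3) that cc1 by simp
    show "1 \<le> SL_left.s u v x" if "a < ereal x" "x \<le> c" for x using P[of x] that cc1 by simp
    show "(LINT x:left_ray a c|lebesgue. \<bar>u x * v x * r x\<bar>) \<le> 1 / 4" using P[OF c] by simp
    show "set_integrable lebesgue (left_ray a c) (\<lambda>x. u x * v x * r x)"
      by (rule set_integrable_subset[OF int]) (use cc1 in auto)
  qed (use setting u_sol v_sol W_vu top in auto)
qed

theorem mainTheorem15:
  fixes a b :: ereal and p q r :: "real \<Rightarrow> real"
    and lam :: real and u u1 v v1 :: "real \<Rightarrow> real" and c0 :: real
    and \<kappa> :: complex
    and phi phi1 theta theta1 :: "complex \<Rightarrow> real \<Rightarrow> complex"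
    and phn thn :: "nat \<Rightarrow> real \<Rightarrow> complex"
  assumes setting: "SL_setting a b p q r"
    \<comment> \<open>Hypothesis (H_a) at lam, with the solutions u, v used in Construction (C)\<close>
    and nonosc: "nonoscillatory_at_a a b p q r lam"
    and u_sol: "SL_sol a b p q r lam u u1" and v_sol: "SL_sol a b p q r lam v v1"
    and u_princ: "principal_at_a a b p q r lam u"
    and v_nonprinc: "nonprincipal_at_a a b p q r lam u v"
    and W_vu: "\<forall>x\<in>SL_int a b. v x * u1 x - v1 x * u x = 1"
    and c0_in: "c0 \<in> SL_int a b"
    and H_int: "set_integrable lebesgue {x. a < ereal x \<and> x \<le> c0} (\<lambda>x. u x * v x * r x)"
    \<comment> \<open>phi is a nonzero constant multiple of the function of Construction (C)\<close>
    and kappa_nz: "\<kappa> \<noteq> 0"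
    and phi_def: "\<forall>z. \<forall>x\<in>SL_int a b. phi z x = \<kappa> * phiC a r u v lam z x"
    and phn_def: "\<forall>n. \<forall>x\<in>SL_int a b. phn n x = \<kappa> * complex_of_real (phiC_coeff a r u v n x)"
    and phi_sol: "\<forall>z. SL_sol a b p q r z (phi z) (phi1 z)"
    \<comment> \<open>theta: solution, entire in z, real for real z, with expansion coefficients thn about lam\<close>
    and theta_sol: "\<forall>z. SL_sol a b p q r z (theta z) (theta1 z)"
    and theta_entire: "\<forall>x\<in>SL_int a b. (\<lambda>z. theta z x) holomorphic_on UNIV"
    and theta_real: "\<forall>t::real. \<forall>x\<in>SL_int a b. theta (complex_of_real t) x \<in> \<real>"
    and theta_series: "\<forall>z. \<forall>x\<in>SL_int a b.
        (\<lambda>n. thn n x * (z - complex_of_real lam) ^ n) sums theta z x"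
    and W_theta_phi: "\<forall>z. \<forall>x\<in>SL_int a b. theta z x * phi1 z x - theta1 z x * phi z x = 1"
    \<comment> \<open>natural normalization\<close>
    and nat_norm: "\<forall>n. reg_index (at_left_end a) (phn 0) thn < enat n \<longrightarrow>
        ((\<lambda>x. thn n x / phn 0 x) \<longlongrightarrow> 0) (at_left_end a)"
  shows "(\<forall>k. ((\<lambda>x. phn (Suc k) x / phn k x) \<longlongrightarrow> 0) (at_left_end a) \<and>
              ((\<lambda>x. thn (Suc k) x / thn k x) \<longlongrightarrow> 0) (at_left_end a)) \<and>
         (\<forall>l. reg_index (at_left_end a) (phn 0) thn = enat l \<longrightarrow>
           (\<forall>k. ((\<lambda>x. phn k x / thn (l + k) x) \<longlongrightarrow> 0) (at_left_end a) \<and>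
                ((\<lambda>x. thn (l + k + 1) x / phn k x) \<longlongrightarrow> 0) (at_left_end a)))"
proof -
  have "set_integrable lebesgue (left_ray a c0) (\<lambda>x. u x * v x * r x)"
    using H_int by (simp add: left_ray_def)
  then obtain c where "SL_end a b p q r lam u u1 v v1 c"
    using SL_end_exists[OF setting nonosc u_sol v_sol u_princ v_nonprinc W_vu c0_in] by blast
  then interpret SL_end a b p q r lam u u1 v v1 c .
  note * = naturally_normalized_asymptotics[OF kappa_nz phi_def[rule_format] phn_def[rule_format]
      phi_sol[rule_format] theta_sol[rule_format] theta_entire[rule_format] theta_real[rule_format]
      theta_series[rule_format] W_theta_phi[rule_format] nat_norm[rule_format]]
  show ?thesis
    using * by blast
qed

end
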